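(* Let $(X_0,\tau_0)$ be a complete Hausdorff locally convex space whose topology is given by a system $(p_{\gamma,0})_{\gamma\in\Gamma}$ of seminorms, and let $T_0=(T_0(t))_{t\geqslant 0}$ be a strongly continuous and exponentially equicontinuous semigroup on $X_0$ whose generator $A_0\colon D(A_0)\to X_0$ is bijective with continuous inverse $A_0^{-1}\colon X_0\to X_0$. Let $(X_n,\tau_n)$, $T_n$, $A_n$ ($n\in\mathbb{Z}$) be the associated Sobolev tower. Assume that the inductive limit $(X,\tau)=\operatorname{ind}_{n}(X_n,\tau_n)$ is Hausdorff, let $(X_{-\infty},\tau_{-\infty})$ be its completion (the universal extrapolation space), and let $T_{-\infty}=(T_{-\infty}(t))_{t\geqslant 0}$ and $A_{-\infty}$ be the extensions to $X_{-\infty}$ of the maps $T(t)$ and $A$ on $X$ induced by the $T_n(t)$ and $A_n$. (i) $T_{-\infty}$ is a strongly continuous and exponentially equicontinuous semigroup on $X_{-\infty}$. Its generator $(G,D(G))$ satisfies $X\subseteq D(G)\subseteq X_{-\infty}$ and $A_{-\infty}|_{D(G)}=G$. In particular, $G\colon(D(G),\tau_{-\infty})\to X_{-\infty}$ is continuous. (ii) If $X_{-\infty}$ is barrelled, then $D(G)=X_{-\infty}$ and consequently $G=A_{-\infty}$. (iii) The operator $A_{-\infty}\colon X_{-\infty}\to X_{-\infty}$ is an isomorphism (linear homeomorphism). Its inverse $A_{-\infty}^{-1}$ is the unique continuous extension of the map $A^{-1}\colon X\to X$ induced by the inverses $A_n^{-1}\colon X_n\to X_{n+1}$ of the operators $A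_n$.
   Context: A strongly continuous and exponentially equicontinuous semigroup on a locally convex space $Y$ is a map $T\colon[0,\infty)\to L(Y)$ (continuous linear operators on $Y$) such that $T(t+s)=T(t)T(s)$ for $s,t\geqslant 0$, $T(0)=I$, $t\mapsto T(t)x$ is continuous for every $x\in Y$, and there is $\omega\in\mathbb{R}$ such that $\{e^{\omega t}T(t) : t\geqslant 0\}\subseteq L(Y)$ is equicontinuous. Its generator $(A,D(A))$ is $Ax=\lim_{t\searrow 0}\frac{T(t)x-x}{t}$ with $D(A)$ the set of all $x\in Y$ for which this limit exists. Sobolev tower, defined recursively from $(X_0,\tau_0)$, $T_0$, $A_0$: For $n\geqslant 1$: $X_n=D(A_{n-1})$, with topology $\tau_n$ given by the seminorms $p_{\gamma,n}(x)=p_{\gamma,n-1}(A_{n-1}x)$ for $x\in X_n$, $\gamma\in\Gamma$. For $t\geqslant 0$, $T_n(t)=T_{n-1}(t)|_{X_n}\colon X_n\to X_n$, and $(A_n,D(A_n))$ is the generator of $T_n=(T_n(t))_{t\geqslant 0}$. For $n\leqslant -1$: let $\check\tau_n$ be the topology on $X_{n+1}$ given by the seminorms $\check p_{\gamma,n}(x)=p_{\gamma,n+1}(A_{n+1}^{-1}x)$ for $x\in X_{n+1}$, $\gamma\in\Gamma$, and let $(X_n,\tau_n)$ be the completion of $(X_{n+1},\check\tau_n)$, with $p_{\gamma,n}$ the continuous extension of $\check p_{\gamma,n}$. For $t\geqslant 0$, $T_n(t)\colon X_n\to X_n$ is the unique continuous extension of $T_{n+1}(t)$, and $(A_n,D(A_n))$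 is the generator of $T_n=(T_n(t))_{t\geqslant 0}$. With these definitions, for all $n\in\mathbb{Z}$: $(X_n,\tau_n)$ is complete, $X_n\subseteq X_{n-1}$ with continuous dense inclusion, $T_n$ is a strongly continuous exponentially equicontinuous semigroup on $X_n$ and $T_n(t)=T_{n-1}(t)|_{X_n}$, $D(A_n)=X_{n+1}$, and $A_n\colon X_{n+1}\to X_n$ is a linear homeomorphism with $A_n=A_{n-1}|_{X_{n+1}}$. Universal extrapolation space: $X=\bigcup_{n\in\mathbb{Z}}X_n$ is endowed with the finest locally convex topology $\tau$ making all inclusions $(X_n,\tau_n)\hookrightarrow X$ continuous. The maps $T_n(t)$ define continuous linear operators $T(t)\colon X\to X$ ($t\geqslant 0$) and the maps $A_n\colon X_{n+1}\to X_n$ define a continuous linear operator $A\colon X\to X$. $X_{-\infty}$ is the completion of $(X,\tau)$, and $T_{-\infty}(t),A_{-\infty}\colon X_{-\infty}\to X_{-\infty}$ are the unique continuous linear extensions of $T(t)$ and $A$. *)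

theory Defs
  imports "HOL-Analysis.Analysis"
begin

text \<open>
  A locally convex space is a topology \<open>\<tau>\<close> whose \<open>topspace\<close> is a linear subspace of an ambient
  vector space \<open>'a\<close> over the scalar field \<open>'k\<close>. Up to isometric isomorphism, the only instances
  of \<open>real_normed_field\<close> are the real and the complex numbers. The spaces of a Sobolev tower, their
  union and its completion are subspaces of one ambient space, so that all the canonical
  embeddings become inclusions. Functions on these spaces are total on \<open>'a\<close>; only their values on
  the relevant \<open>topspace\<close> matter.
\<close>

definition seminorm_on :: "('k::real_normed_field \<Rightarrow> 'a::ab_group_add \<Rightarrow> 'a) \<Rightarrow> 'a set \<Rightarrow> ('a \<Rightarrow> real) \<Rightarrow> bool"
  where "seminorm_on scl V q \<longleftrightarrow>
    (\<forall>x\<in>V. 0 \<le> q x) \<and>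
    (\<forall>c. \<forall>x\<in>V. q (scl c x) = norm c * q x) \<and>
    (\<forall>x\<in>V. \<forall>y\<in>V. q (x + y) \<le> q x + q y)"

text \<open>The family \<open>Q\<close> is not assumed to be directed; \<open>V\<close> is in the subbase for the case of empty \<open>Q\<close>.\<close>

definition seminorm_topology :: "'a::ab_group_add set \<Rightarrow> ('a \<Rightarrow> real) set \<Rightarrow> 'a topology"
  where "seminorm_topology V Q =
    topology_generated_by (insert V {{y \<in> V. q (y - x) < e} | q x e. q \<in> Q \<and> x \<in> V \<and> 0 < e})"

lemma topspace_seminorm_topology [simp]: "topspace (seminorm_topology V Q) = V"
  unfolding seminorm_topology_def topology_generated_by_topspace by auto

definition lc_space :: "('k::real_normed_field \<Rightarrow> 'a::ab_group_add \<Rightarrow> 'a) \<Rightarrow> 'a topology \<Rightarrow> bool"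
  where "lc_space scl \<tau> \<longleftrightarrow>
    module.subspace scl (topspace \<tau>) \<and>
    (\<exists>Q. (\<forall>q\<in>Q. seminorm_on scl (topspace \<tau>) q) \<and> \<tau> = seminorm_topology (topspace \<tau>) Q)"

definition cauchy_filter_lc :: "'a::ab_group_add topology \<Rightarrow> 'a filter \<Rightarrow> bool"
  where "cauchy_filter_lc \<tau> F \<longleftrightarrow>
    F \<noteq> bot \<and> (\<forall>\<^sub>F x in F. x \<in> topspace \<tau>) \<and>
    (\<forall>U. openin \<tau> U \<and> 0 \<in> U \<longrightarrow>
      (\<exists>M. (\<forall>\<^sub>F x in F. x \<in> M) \<and> (\<forall>x\<in>M. \<forall>y\<in>M. x - y \<in> U)))"

definition complete_lc :: "'a::ab_group_add topology \<Rightarrow> bool"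
  where "complete_lc \<tau> \<longleftrightarrow> (\<forall>F. cauchy_filter_lc \<tau> F \<longrightarrow> (\<exists>l. limitin \<tau> (\<lambda>x. x) l F))"

definition is_completion :: "('k::real_normed_field \<Rightarrow> 'a::ab_group_add \<Rightarrow> 'a) \<Rightarrow> 'a topology \<Rightarrow> 'a topology \<Rightarrow> bool"
  where "is_completion scl \<sigma> \<tau> \<longleftrightarrow>
    lc_space scl \<tau> \<and> Hausdorff_space \<tau> \<and> complete_lc \<tau> \<and>
    topspace \<sigma> \<subseteq> topspace \<tau> \<and> subtopology \<tau> (topspace \<sigma>) = \<sigma> \<and>
    \<tau> closure_of (topspace \<sigma>) = topspace \<tau>"

definition linear_on_space :: "('k::real_normed_field \<Rightarrow> 'a::ab_group_add \<Rightarrow> 'a) \<Rightarrow> 'a set \<Rightarrow> ('a \<Rightarrow> 'a) \<Rightarrow> bool"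
  where "linear_on_space scl V f \<longleftrightarrow>
    (\<forall>x\<in>V. \<forall>y\<in>V. f (x + y) = f x + f y) \<and> (\<forall>c. \<forall>x\<in>V. f (scl c x) = scl c (f x))"

definition cont_operator :: "('k::real_normed_field \<Rightarrow> 'a::ab_group_add \<Rightarrow> 'a) \<Rightarrow> 'a topology \<Rightarrow> ('a \<Rightarrow> 'a) \<Rightarrow> bool"
  where "cont_operator scl \<tau> f \<longleftrightarrow> linear_on_space scl (topspace \<tau>) f \<and> continuous_map \<tau> \<tau> f"

text \<open>Equicontinuity at the origin, which for sets of linear operators is equicontinuity.\<close>

definition equicontinuous_lc :: "'a::ab_group_add topology \<Rightarrow> ('a \<Rightarrow> 'a) set \<Rightarrow> bool"
  where "equicontinuous_lc \<tau> H \<longleftrightarrow>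
    (\<forall>U. openin \<tau> U \<and> 0 \<in> U \<longrightarrow> (\<exists>W. openin \<tau> W \<and> 0 \<in> W \<and> (\<forall>f\<in>H. f ` W \<subseteq> U)))"

definition sc_exp_equicont_semigroup ::
    "('k::real_normed_field \<Rightarrow> 'a::ab_group_add \<Rightarrow> 'a) \<Rightarrow> 'a topology \<Rightarrow> (real \<Rightarrow> 'a \<Rightarrow> 'a) \<Rightarrow> bool"
  where "sc_exp_equicont_semigroup scl \<tau> T \<longleftrightarrow>
    (\<forall>t\<ge>0. cont_operator scl \<tau> (T t)) \<and>
    (\<forall>t\<ge>0. \<forall>s\<ge>0. \<forall>x\<in>topspace \<tau>. T (t + s) x = T t (T s x)) \<and>
    (\<forall>x\<in>topspace \<tau>. T 0 x = x) \<and>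
    (\<forall>x\<in>topspace \<tau>. continuous_map (top_of_set {0..}) \<tau> (\<lambda>t. T t x)) \<and>
    (\<exists>\<omega>. equicontinuous_lc \<tau> {\<lambda>x. scl (of_real (exp (\<omega> * t))) (T t x) | t. 0 \<le> t})"

definition gen_limit ::
    "('k::real_normed_field \<Rightarrow> 'a::ab_group_add \<Rightarrow> 'a) \<Rightarrow> 'a topology \<Rightarrow> (real \<Rightarrow> 'a \<Rightarrow> 'a) \<Rightarrow> 'a \<Rightarrow> 'a \<Rightarrow> bool"
  where "gen_limit scl \<tau> T x y \<longleftrightarrow>
    limitin \<tau> (\<lambda>t. scl (of_real (1 / t)) (T t x - x)) y (at_right (0::real))"

definition gen_dom ::
    "('k::real_normed_field \<Rightarrow> 'a::ab_group_add \<Rightarrow> 'a) \<Rightarrow> 'a topology \<Rightarrow> (real \<Rightarrow> 'a \<Rightarrow> 'a) \<Rightarrow> 'a set"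
  where "gen_dom scl \<tau> T = {x \<in> topspace \<tau>. \<exists>y. gen_limit scl \<tau> T x y}"

definition gen ::
    "('k::real_normed_field \<Rightarrow> 'a::ab_group_add \<Rightarrow> 'a) \<Rightarrow> 'a topology \<Rightarrow> (real \<Rightarrow> 'a \<Rightarrow> 'a) \<Rightarrow> 'a \<Rightarrow> 'a"
  where "gen scl \<tau> T x = (THE y. gen_limit scl \<tau> T x y)"

definition gen_inv ::
    "('k::real_normed_field \<Rightarrow> 'a::ab_group_add \<Rightarrow> 'a) \<Rightarrow> 'a topology \<Rightarrow> (real \<Rightarrow> 'a \<Rightarrow> 'a) \<Rightarrow> 'a \<Rightarrow> 'a"
  where "gen_inv scl \<tau> T = the_inv_into (gen_dom scl \<tau> T) (gen scl \<tau> T)"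

definition cont_extension :: "'a topology \<Rightarrow> 'a set \<Rightarrow> ('a \<Rightarrow> 'a) \<Rightarrow> ('a \<Rightarrow> 'a) \<Rightarrow> bool"
  where "cont_extension \<tau> Y f g \<longleftrightarrow> continuous_map \<tau> \<tau> g \<and> (\<forall>x\<in>Y. g x = f x)"

text \<open>
  The recursion defining the Sobolev tower of \<open>(\<tau> 0, p 0, T 0)\<close>: the level \<open>n\<close> space is
  \<open>topspace (\<tau> n)\<close> and its operator is \<open>gen scl (\<tau> n) (T n)\<close>. Completions are determined only
  up to isomorphism, hence a predicate on the whole tower rather than a function of level \<open>0\<close>.
\<close>

definition sobolev_tower ::
    "('k::real_normed_field \<Rightarrow> 'a::ab_group_add \<Rightarrow> 'a) \<Rightarrow> 'g set \<Rightarrow> (int \<Rightarrow> 'a topology) \<Rightarrow>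
     (int \<Rightarrow> 'g \<Rightarrow> 'a \<Rightarrow> real) \<Rightarrow> (int \<Rightarrow> real \<Rightarrow> 'a \<Rightarrow> 'a) \<Rightarrow> bool"
  where "sobolev_tower scl \<Gamma> \<tau> p T \<longleftrightarrow>
    (\<forall>n\<ge>1.
      topspace (\<tau> n) = gen_dom scl (\<tau> (n - 1)) (T (n - 1)) \<and>
      (\<forall>\<gamma>\<in>\<Gamma>. \<forall>x\<in>topspace (\<tau> n). p n \<gamma> x = p (n - 1) \<gamma> (gen scl (\<tau> (n - 1)) (T (n - 1)) x)) \<and>
      \<tau> n = seminorm_topology (topspace (\<tau> n)) (p n ` \<Gamma>) \<and>
      (\<forall>t\<ge>0. \<forall>x\<in>topspace (\<tau> n). T n t x = T (n - 1) t x)) \<and>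
    (\<forall>n\<le>-1.
      let Y = topspace (\<tau> (n + 1));
          p' = (\<lambda>\<gamma> x. p (n + 1) \<gamma> (gen_inv scl (\<tau> (n + 1)) (T (n + 1)) x))
      in is_completion scl (seminorm_topology Y (p' ` \<Gamma>)) (\<tau> n) \<and>
         (\<forall>\<gamma>\<in>\<Gamma>. continuous_map (\<tau> n) euclideanreal (p n \<gamma>) \<and> (\<forall>x\<in>Y. p n \<gamma> x = p' \<gamma> x)) \<and>
         (\<forall>t\<ge>0. cont_extension (\<tau> n) Y (T (n + 1) t) (T n t)))"

definition is_lc_inductive_limit ::
    "('k::real_normed_field \<Rightarrow> 'a::ab_group_add \<Rightarrow> 'a) \<Rightarrow> (int \<Rightarrow> 'a topology) \<Rightarrow> 'a topology \<Rightarrow> bool"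
  where "is_lc_inductive_limit scl \<tau> \<sigma> \<longleftrightarrow>
    lc_space scl \<sigma> \<and> topspace \<sigma> = (\<Union>n. topspace (\<tau> n)) \<and>
    (\<forall>n. continuous_map (\<tau> n) \<sigma> (\<lambda>x. x)) \<and>
    (\<forall>\<sigma>'. lc_space scl \<sigma>' \<and> topspace \<sigma>' = (\<Union>n. topspace (\<tau> n)) \<and>
       (\<forall>n. continuous_map (\<tau> n) \<sigma>' (\<lambda>x. x)) \<longrightarrow> (\<forall>U. openin \<sigma>' U \<longrightarrow> openin \<sigma> U))"

text \<open>The map on \<open>\<Union>n. D n\<close> induced by maps \<open>f n\<close> on \<open>D n\<close> that agree on overlaps.\<close>

definition induced_map :: "(int \<Rightarrow> 'a set) \<Rightarrow> (int \<Rightarrow> 'a \<Rightarrow> 'a) \<Rightarrow> 'a \<Rightarrow> 'a"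
  where "induced_map D f x = (THE y. \<exists>n. x \<in> D n \<and> y = f n x)"

definition barrel :: "('k::real_normed_field \<Rightarrow> 'a::ab_group_add \<Rightarrow> 'a) \<Rightarrow> 'a topology \<Rightarrow> 'a set \<Rightarrow> bool"
  where "barrel scl \<tau> B \<longleftrightarrow>
    closedin \<tau> B \<and>
    (\<forall>x\<in>B. \<forall>y\<in>B. \<forall>u\<in>{0..1}. scl (of_real u) x + scl (of_real (1 - u)) y \<in> B) \<and>
    (\<forall>x\<in>B. \<forall>c. norm c \<le> 1 \<longrightarrow> scl c x \<in> B) \<and>
    (\<forall>x\<in>topspace \<tau>. \<exists>r>0. \<forall>c. norm c \<le> r \<longrightarrow> scl c x \<in> B)"

definition barrelled :: "('k::real_normed_field \<Rightarrow> 'a::ab_group_add \<Rightarrow> 'a) \<Rightarrow> 'a topology \<Rightarrow> bool"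
  where "barrelled scl \<tau> \<longleftrightarrow>
    (\<forall>B. barrel scl \<tau> B \<longrightarrow> (\<exists>U. openin \<tau> U \<and> 0 \<in> U \<and> U \<subseteq> B))"

end

theory Submission
  imports Defs
begin

text \<open>
  All steps of the tower are copies of \<open>(\<tau> 0, T 0)\<close>: upwards the conjugating isomorphism is the
  generator, downwards it is the extension of the inverse of the generator to the completion. Hence
  every step has the same growth exponent, generator bijectivity and completeness, and seminorms of
  the inductive limit can be bounded uniformly along the rescaled orbits; completion preserves
  these bounds.

  The difference quotients satisfy \<open>q ((T t x - x) / t) \<le> r (A x)\<close> for \<open>0 < t \<le> 1\<close>. On the dense
  subspace \<open>\<Union>n. X n\<close> this bounds them by a continuous seminorm of \<open>Ainf x\<close>, so they are
  equicontinuous on the whole completion and converge to \<open>Ainf x\<close> at every point: the generator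
  is everywhere defined.
\<close>

text \<open>The generator is unbounded on each level but continuous on the union: \<open>A n\<close>
  loses one level, its inverse gains one, and a tower without ends absorbs the shift. The obstacle
  is uniformity in time, since infinitely many levels might come with unrelated growth bounds.
  Conjugation leaves the exponent of level 0 untouched. The bounding seminorms still depend on the
  level; their dependence is removed by a supremum over time, which is continuous on the inductive
  limit as soon as it is continuous on each level. The estimate behind the difference quotients
  comes from telescoping: \<open>T t x - x\<close> is a sum of terms
  \<open>T (k * h) (T h x - x)\<close> with \<open>h = t / n\<close>, and
  \<open>(T h x - x) / h\<close> is close to the generator at \<open>x\<close>. If \<open>r\<close>
  dominates \<open>q\<close> after every \<open>T s\<close> with \<open>0 \<le> s \<le> 1\<close>,
  the sum is at most \<open>t * r (A x)\<close> up to a small error. As \<open>Ainf\<close> is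
  continuous, \<open>r\<close> composed with \<open>Ainf\<close> is a continuous seminorm, so the
  estimate survives the passage to the completion.\<close>

lemma topology_eq_if_id_continuous:
  assumes "continuous_map \<sigma> \<rho> (\<lambda>x. x)" "continuous_map \<rho> \<sigma> (\<lambda>x. x)" "topspace \<sigma> = topspace \<rho>"
  shows "\<sigma> = \<rho>"
proof (subst topology_eq, intro allI iffI)
  fix U
  have eq: "{x \<in> topspace \<rho>. x \<in> U} = U" if "U \<subseteq> topspace \<rho>" using that by auto
  show "openin \<rho> U" if "openin \<sigma> U"
    using openin_continuous_map_preimage[OF assms(2) that] eq openin_subset[OF that] assms(3) by simp
  show "openin \<sigma> U" if "openin \<rho> U"
    using openin_continuous_map_preimage[OF assms(1) that] eq openin_subset[OF that] assms(3) by simp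
qed

lemma induced_map_eq:
  assumes "x \<in> D n" "\<And>m. x \<in> D m \<Longrightarrow> f m x = f n x"
  shows "induced_map D f x = f n x"
  unfolding induced_map_def
proof (rule the_equality)
  show "\<exists>m. x \<in> D m \<and> f n x = f m x" using assms(1) by blast
  fix y assume "\<exists>m. x \<in> D m \<and> y = f m x"
  then obtain m where "x \<in> D m" "y = f m x" by (elim exE conjE)
  then show "y = f n x" using assms(2)[of m] by (elim trans)
qed

text \<open>Removes the exponential weight on a bounded time interval. The sign of the exponent is
  unknown, so \<open>- \<omega> * t\<close> is bounded by \<open>\<bar>\<omega>\<bar> * c\<close>,
  uniformly in \<open>t\<close>.\<close>

lemma exp_weight_le:
  fixes a b :: real
  assumes "exp (\<omega> * t) * a \<le> b" "0 \<le> b" "0 \<le> t" "t \<le> c"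
  shows "a \<le> exp (\<bar>\<omega>\<bar> * c) * b"
proof -
  have "a = exp (- \<omega> * t) * (exp (\<omega> * t) * a)" by (simp add: mult.assoc[symmetric] exp_minus)
  also have "\<dots> \<le> exp (- \<omega> * t) * b" using assms by (intro mult_left_mono) auto
  also have "- \<omega> * t \<le> \<bar>\<omega>\<bar> * c" using assms by (intro mult_mono) auto
  then have "exp (- \<omega> * t) * b \<le> exp (\<bar>\<omega>\<bar> * c) * b" using assms by (intro mult_right_mono) auto
  finally show ?thesis .
qed

section \<open>Continuous seminorms\<close>

locale scalar_space = vector_space scl
  for scl :: "'k::real_normed_field \<Rightarrow> 'a::ab_group_add \<Rightarrow> 'a"
begin

section \<open>Algebra of seminorms and of linear maps on subspaces\<close>

lemma seminorm_nonneg: "seminorm_on scl V q \<Longrightarrow> x \<in> V \<Longrightarrow> 0 \<le> q x"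
  by (simp add: seminorm_on_def)

lemma seminorm_scale: "seminorm_on scl V q \<Longrightarrow> x \<in> V \<Longrightarrow> q (scl c x) = norm c * q x"
  by (simp add: seminorm_on_def)

lemma seminorm_add: "seminorm_on scl V q \<Longrightarrow> x \<in> V \<Longrightarrow> y \<in> V \<Longrightarrow> q (x + y) \<le> q x + q y"
  by (simp add: seminorm_on_def)

lemma seminorm_zero:
  assumes "seminorm_on scl V q" "subspace V"
  shows "q 0 = 0"
  using seminorm_scale[OF assms(1) subspace_0[OF assms(2)], of 0] by simp

lemma seminorm_minus:
  assumes "seminorm_on scl V q" "x \<in> V"
  shows "q (- x) = q x"
  using seminorm_scale[OF assms, of "-1"] by simp

lemma seminorm_diff_commute:
  assumes "seminorm_on scl V q" "subspace V" "x \<in> V" "y \<in> V"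
  shows "q (x - y) = q (y - x)"
  using seminorm_minus[OF assms(1) subspace_diff[OF assms(2,3,4)]] by (metis minus_diff_eq)

lemma seminorm_triangle:
  assumes "seminorm_on scl V q" "subspace V" "x \<in> V" "y \<in> V" "z \<in> V"
  shows "q (x - z) \<le> q (x - y) + q (y - z)"
  using seminorm_add[OF assms(1) subspace_diff[OF assms(2,3,4)] subspace_diff[OF assms(2,4,5)]]
  by simp

lemma seminorm_diff_le:
  assumes "seminorm_on scl V q" "subspace V" "x \<in> V" "y \<in> V"
  shows "q x \<le> q (x - y) + q y"
  using seminorm_triangle[OF assms(1-4) subspace_0[OF assms(2)]] by simp

lemma seminorm_sum:
  assumes q: "seminorm_on scl V q" and V: "subspace V" and "\<And>i. i < (n::nat) \<Longrightarrow> f i \<in> V"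
  shows "q (\<Sum>i<n. f i) \<le> (\<Sum>i<n. q (f i))"
  using assms(3)
proof (induction n)
  case 0
  then show ?case by (simp add: seminorm_zero[OF q V])
next
  case (Suc n)
  have "(\<Sum>i<n. f i) \<in> V" using Suc.prems by (intro subspace_sum[OF V]) auto
  then have "q (\<Sum>i<Suc n. f i) \<le> q (\<Sum>i<n. f i) + q (f n)"
    using seminorm_add[OF q _ Suc.prems[of n]] by simp
  with Suc show ?case by force
qed

lemma seminorm_onI:
  assumes "\<And>x. x \<in> V \<Longrightarrow> 0 \<le> q x"
    and "\<And>c x. x \<in> V \<Longrightarrow> q (scl c x) = norm c * q x"
    and "\<And>x y. x \<in> V \<Longrightarrow> y \<in> V \<Longrightarrow> q (x + y) \<le> q x + q y"
  shows "seminorm_on scl V q"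
  unfolding seminorm_on_def using assms by blast

lemma linear_on_spaceI:
  assumes "\<And>x y. x \<in> V \<Longrightarrow> y \<in> V \<Longrightarrow> f (x + y) = f x + f y"
    and "\<And>c x. x \<in> V \<Longrightarrow> f (scl c x) = scl c (f x)"
  shows "linear_on_space scl V f"
  unfolding linear_on_space_def using assms by blast

lemma linear_on_space_add:
  "linear_on_space scl V f \<Longrightarrow> x \<in> V \<Longrightarrow> y \<in> V \<Longrightarrow> f (x + y) = f x + f y"
  by (simp add: linear_on_space_def)

lemma linear_on_space_scale:
  "linear_on_space scl V f \<Longrightarrow> x \<in> V \<Longrightarrow> f (scl c x) = scl c (f x)"
  by (simp add: linear_on_space_def)

lemma linear_on_space_diff:
  assumes "linear_on_space scl V f" "subspace V" "x \<in> V" "y \<in> V"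
  shows "f (x - y) = f x - f y"
proof -
  have "f (x - y) + f y = f x"
    using linear_on_space_add[OF assms(1) subspace_diff[OF assms(2-4)] assms(4)] by simp
  then show ?thesis by (simp add: eq_diff_eq)
qed

lemma linear_on_space_compose:
  assumes "linear_on_space scl V f" "linear_on_space scl W g" "f ` V \<subseteq> W"
  shows "linear_on_space scl V (\<lambda>x. g (f x))"
  using assms unfolding linear_on_space_def by (simp add: image_subset_iff)

lemma linear_on_space_inverse:
  assumes f: "linear_on_space scl V f" and V: "subspace V"
    and g: "\<And>x. x \<in> W \<Longrightarrow> g x \<in> V \<and> f (g x) = x" and gf: "\<And>x. x \<in> V \<Longrightarrow> g (f x) = x"
  shows "linear_on_space scl W g"
proof (rule linear_on_spaceI)
  fix x y assume "x \<in> W" "y \<in> W"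
  then show "g (x + y) = g x + g y"
    using gf[of "g x + g y"] linear_on_space_add[OF f, of "g x" "g y"] subspace_add[OF V] g by simp
next
  fix c x assume "x \<in> W"
  then show "g (scl c x) = scl c (g x)"
    using gf[of "scl c (g x)"] linear_on_space_scale[OF f, of "g x"] subspace_scale[OF V] g by simp
qed

lemma seminorm_pullback:
  assumes "seminorm_on scl W q" "linear_on_space scl V f" "f ` V \<subseteq> W"
  shows "seminorm_on scl V (\<lambda>x. q (f x))"
  using assms unfolding seminorm_on_def linear_on_space_def by (simp add: image_subset_iff)

text \<open>All continuous seminorms, not a generating family: this set is closed under maxima and
  positive multiples, so one member always suffices and estimates carry no constants. Openness of
  balls is demanded at every centre, so no translation invariance of the topology has to be known
  beforehand.\<close>

definition csn :: "'a topology \<Rightarrow> ('a \<Rightarrow> real) set"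
  where "csn \<tau> = {q. seminorm_on scl (topspace \<tau>) q \<and>
    (\<forall>x\<in>topspace \<tau>. \<forall>e>0. openin \<tau> {y \<in> topspace \<tau>. q (y - x) < e})}"

lemma csn_seminorm: "q \<in> csn \<tau> \<Longrightarrow> seminorm_on scl (topspace \<tau>) q"
  by (simp add: csn_def)

lemma csn_ball_open:
  "q \<in> csn \<tau> \<Longrightarrow> x \<in> topspace \<tau> \<Longrightarrow> 0 < e \<Longrightarrow> openin \<tau> {y \<in> topspace \<tau>. q (y - x) < e}"
  by (simp add: csn_def)

lemma lc_subspace: "lc_space scl \<tau> \<Longrightarrow> subspace (topspace \<tau>)"
  by (simp add: lc_space_def)

lemma lc_seminorm_topology:
  "subspace V \<Longrightarrow> (\<And>q. q \<in> Q \<Longrightarrow> seminorm_on scl V q) \<Longrightarrow> lc_space scl (seminorm_topology V Q)"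
  unfolding lc_space_def by auto

lemma csn_seminorm_topology:
  assumes "q \<in> Q" "seminorm_on scl V q"
  shows "q \<in> csn (seminorm_topology V Q)"
proof -
  have "openin (seminorm_topology V Q) {y \<in> V. q (y - x) < e}" if "x \<in> V" "e > 0" for x e
    unfolding seminorm_topology_def openin_topology_generated_by_iff
    by (rule generate_topology_on.Basis) (use assms that in blast)
  then show ?thesis using assms by (simp add: csn_def)
qed

lemma csn_max:
  assumes "q \<in> csn \<tau>" "r \<in> csn \<tau>"
  shows "(\<lambda>x. max (q x) (r x)) \<in> csn \<tau>"
proof -
  have "seminorm_on scl (topspace \<tau>) (\<lambda>x. max (q x) (r x))"
  proof (rule seminorm_onI)
    note q = csn_seminorm[OF assms(1)] and r = csn_seminorm[OF assms(2)]
    fix x assume x: "x \<in> topspace \<tau>"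
    show "0 \<le> max (q x) (r x)" using seminorm_nonneg[OF q x] by simp
    show "max (q (scl c x)) (r (scl c x)) = norm c * max (q x) (r x)" for c
      by (simp add: seminorm_scale[OF q x] seminorm_scale[OF r x] max_mult_distrib_left)
    show "max (q (x + y)) (r (x + y)) \<le> max (q x) (r x) + max (q y) (r y)"
      if "y \<in> topspace \<tau>" for y
      using seminorm_add[OF q x that] seminorm_add[OF r x that] by linarith
  qed
  moreover have "openin \<tau> {y \<in> topspace \<tau>. max (q (y - x)) (r (y - x)) < e}"
    if "x \<in> topspace \<tau>" "e > 0" for x e
  proof -
    have "{y \<in> topspace \<tau>. max (q (y - x)) (r (y - x)) < e} =
        {y \<in> topspace \<tau>. q (y - x) < e} \<inter> {y \<in> topspace \<tau>. r (y - x) < e}"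
      by auto
    then show ?thesis
      using csn_ball_open[OF assms(1) that] csn_ball_open[OF assms(2) that] by auto
  qed
  ultimately show ?thesis by (simp add: csn_def)
qed

lemma csn_mult:
  assumes q: "q \<in> csn \<tau>" and c: "0 < c"
  shows "(\<lambda>x. c * q x) \<in> csn \<tau>"
proof -
  have "seminorm_on scl (topspace \<tau>) (\<lambda>x. c * q x)"
    using csn_seminorm[OF q] c unfolding seminorm_on_def
    by (auto simp flip: distrib_left)
  moreover have "openin \<tau> {y \<in> topspace \<tau>. c * q (y - x) < e}" if "x \<in> topspace \<tau>" "e > 0" for x e
    using csn_ball_open[OF q that(1), of "e / c"] that c by (simp add: field_simps)
  ultimately show ?thesis by (simp add: csn_def)
qed

lemma csn_zero: "(\<lambda>x. 0) \<in> csn \<tau>"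
  by (auto simp: csn_def seminorm_on_def)

text \<open>Induction over the generated topology. Finite intersections are absorbed by
  \<open>csn_max\<close> and radii by \<open>csn_mult\<close>, so a generating family that is not
  directed still yields a single unit ball.\<close>

lemma openin_csn_imp:
  assumes lc: "lc_space scl \<tau>" and U: "openin \<tau> U" and "x \<in> U"
  shows "\<exists>q\<in>csn \<tau>. {y \<in> topspace \<tau>. q (y - x) < 1} \<subseteq> U"
proof -
  define V where "V = topspace \<tau>"
  have V: "subspace V" using lc lc_subspace V_def by simp
  obtain Q where Q: "\<And>q. q \<in> Q \<Longrightarrow> seminorm_on scl V q" and \<tau>: "\<tau> = seminorm_topology V Q"
    using lc unfolding lc_space_def V_def by blast
  have "generate_topology_on (insert V {{y \<in> V. q (y - x) < e} | q x e. q \<in> Q \<and> x \<in> V \<and> 0 < e}) U"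
    using U unfolding \<tau> seminorm_topology_def openin_topology_generated_by_iff .
  then have "\<forall>x\<in>U. \<exists>q\<in>csn \<tau>. {y \<in> V. q (y - x) < 1} \<subseteq> U"
  proof (induction rule: generate_topology_on.induct)
    case Empty
    then show ?case by simp
  next
    case (Int a b)
    show ?case
    proof
      fix x assume "x \<in> a \<inter> b"
      then obtain q r where "q \<in> csn \<tau>" "{y \<in> V. q (y - x) < 1} \<subseteq> a"
        "r \<in> csn \<tau>" "{y \<in> V. r (y - x) < 1} \<subseteq> b" using Int by blast
      then show "\<exists>q\<in>csn \<tau>. {y \<in> V. q (y - x) < 1} \<subseteq> a \<inter> b"
        by (intro bexI[OF _ csn_max[of q _ r]]) auto
    qed
  next
    case (UN K)
    then show ?case by (meson UnionE Union_upper order_trans)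
  next
    case (Basis s)
    then consider "s = V" | q z e where "s = {y \<in> V. q (y - z) < e}" "q \<in> Q" "z \<in> V" "e > 0" by blast
    then show ?case
    proof cases
      case 1
      then show ?thesis using csn_zero[of \<tau>] V_def by auto
    next
      case 2
      have q: "q \<in> csn \<tau>" unfolding \<tau> by (rule csn_seminorm_topology) (use 2 Q in auto)
      show ?thesis
      proof
        fix x assume x: "x \<in> s"
        \<comment> \<open>The room left between \<open>x\<close> and the boundary of the ball about
          \<open>z\<close>; scaling by \<open>1 / d\<close> turns radius \<open>d\<close> into
          radius 1.\<close>
        define d where "d = e - q (x - z)"
        have d: "d > 0" using x 2 d_def by simp
        have "{y \<in> V. (1 / d) * q (y - x) < 1} \<subseteq> s"
        proof
          fix y assume y: "y \<in> {y \<in> V. (1 / d) * q (y - x) < 1}"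
          then have "q (y - x) < d" using d by (simp add: field_simps)
          moreover have "q (y - z) \<le> q (y - x) + q (x - z)"
            using seminorm_triangle[OF Q[OF 2(2)] V] x y 2 by blast
          ultimately show "y \<in> s" using 2 y d_def by simp
        qed
        then show "\<exists>q\<in>csn \<tau>. {y \<in> V. q (y - x) < 1} \<subseteq> s"
          using csn_mult[OF q, of "1 / d"] d by (intro bexI[of _ "\<lambda>x. 1 / d * q x"]) simp_all
      qed
    qed
  qed
  then show ?thesis using \<open>x \<in> U\<close> V_def by simp
qed

lemma openin_csnI:
  assumes sub: "U \<subseteq> topspace \<tau>" and V: "subspace (topspace \<tau>)"
    and U: "\<And>x. x \<in> U \<Longrightarrow> \<exists>q\<in>csn \<tau>. \<exists>e>0. {y \<in> topspace \<tau>. q (y - x) < e} \<subseteq> U"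
  shows "openin \<tau> U"
proof (subst openin_subopen, intro ballI)
  fix x assume x: "x \<in> U"
  then obtain q e where q: "q \<in> csn \<tau>" "e > 0" "{y \<in> topspace \<tau>. q (y - x) < e} \<subseteq> U"
    using U by blast
  moreover have "x \<in> {y \<in> topspace \<tau>. q (y - x) < e}"
    using x sub q seminorm_zero[OF csn_seminorm[OF q(1)] V] by auto
  ultimately show "\<exists>T. openin \<tau> T \<and> x \<in> T \<and> T \<subseteq> U"
    using csn_ball_open[OF q(1), of x e] x sub by blast
qed

text \<open>The usual source of new members of \<open>csn\<close>: suprema over time and extended
  maps come with a dominating seminorm, while the openness of their balls is not visible
  directly.\<close>

lemma csn_le:
  assumes V: "subspace (topspace \<tau>)" and q: "q \<in> csn \<tau>"
    and r: "seminorm_on scl (topspace \<tau>) r" and le: "\<And>x. x \<in> topspace \<tau> \<Longrightarrow> r x \<le> q x"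
  shows "r \<in> csn \<tau>"
proof -
  have "openin \<tau> {y \<in> topspace \<tau>. r (y - x) < e}" if x: "x \<in> topspace \<tau>" "e > 0" for x e
  proof (rule openin_csnI[OF _ V])
    fix z assume z: "z \<in> {y \<in> topspace \<tau>. r (y - x) < e}"
    have "{y \<in> topspace \<tau>. q (y - z) < e - r (z - x)} \<subseteq> {y \<in> topspace \<tau>. r (y - x) < e}"
    proof safe
      fix y assume y: "y \<in> topspace \<tau>" "q (y - z) < e - r (z - x)"
      then show "r (y - x) < e"
        using seminorm_triangle[OF r V y(1) _ x(1), of z] le[of "y - z"] subspace_diff[OF V] z by force
    qed
    then show "\<exists>q\<in>csn \<tau>. \<exists>ea>0. {y \<in> topspace \<tau>. q (y - z) < ea} \<subseteq> {y \<in> topspace \<tau>. r (y - x) < e}"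
      using q z by (intro bexI[of _ q] exI[of _ "e - r (z - x)"]) auto
  qed auto
  then show ?thesis using r by (simp add: csn_def)
qed

text \<open>Seminorms are total functions with arbitrary values off the space, so agreement on the
  space has to take the place of equality.\<close>

lemma csn_cong:
  assumes V: "subspace (topspace \<tau>)" and q: "q \<in> csn \<tau>" and eq: "\<And>x. x \<in> topspace \<tau> \<Longrightarrow> r x = q x"
  shows "r \<in> csn \<tau>"
proof (rule csn_le[OF V q])
  show "seminorm_on scl (topspace \<tau>) r"
    using csn_seminorm[OF q] subspace_add[OF V] subspace_scale[OF V] eq
    unfolding seminorm_on_def by simp
qed (simp add: eq)

section \<open>Continuity of maps tested by seminorms\<close>

lemma continuous_map_lcI:
  assumes lc: "lc_space scl \<tau>" and f: "\<And>x. x \<in> topspace X \<Longrightarrow> f x \<in> topspace \<tau>"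
    and cont: "\<And>q x. q \<in> csn \<tau> \<Longrightarrow> x \<in> topspace X \<Longrightarrow>
      \<exists>U. openin X U \<and> x \<in> U \<and> (\<forall>y\<in>U. q (f y - f x) < 1)"
  shows "continuous_map X \<tau> f"
  unfolding continuous_map_def
proof (intro conjI allI impI)
  show "f \<in> topspace X \<rightarrow> topspace \<tau>" using f by blast
next
  fix U assume U: "openin \<tau> U"
  show "openin X {x \<in> topspace X. f x \<in> U}"
  proof (subst openin_subopen, intro ballI)
    fix x assume x: "x \<in> {x \<in> topspace X. f x \<in> U}"
    then obtain q where q: "q \<in> csn \<tau>" "{y \<in> topspace \<tau>. q (y - f x) < 1} \<subseteq> U"
      using openin_csn_imp[OF lc U, of "f x"] by blast
    obtain W where W: "openin X W" "x \<in> W" "\<forall>y\<in>W. q (f y - f x) < 1"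
      using cont[OF q(1)] x by blast
    have "W \<subseteq> {x \<in> topspace X. f x \<in> U}"
    proof
      fix y assume "y \<in> W"
      moreover from this have "y \<in> topspace X" using openin_subset[OF W(1)] by blast
      ultimately show "y \<in> {x \<in> topspace X. f x \<in> U}" using W(3) f q(2) by blast
    qed
    then show "\<exists>T. openin X T \<and> x \<in> T \<and> T \<subseteq> {x \<in> topspace X. f x \<in> U}" using W by blast
  qed
qed

lemma csn_continuous:
  assumes V: "subspace (topspace \<tau>)" and q: "q \<in> csn \<tau>"
  shows "continuous_map \<tau> euclideanreal q"
  unfolding continuous_map_def
proof (intro conjI allI impI)
  fix U :: "real set" assume "openin euclidean U"
  then have U: "open U" by simp
  show "openin \<tau> {x \<in> topspace \<tau>. q x \<in> U}"
  proof (rule openin_csnI[OF _ V])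
    fix x assume x: "x \<in> {x \<in> topspace \<tau>. q x \<in> U}"
    then obtain e where e: "e > 0" "\<And>a. dist a (q x) < e \<Longrightarrow> a \<in> U"
      using U unfolding open_dist by blast
    have "{y \<in> topspace \<tau>. q (y - x) < e} \<subseteq> {x \<in> topspace \<tau>. q x \<in> U}"
    proof safe
      fix y assume y: "y \<in> topspace \<tau>" "q (y - x) < e"
      then have "\<bar>q y - q x\<bar> \<le> q (y - x)"
        using seminorm_diff_le[OF csn_seminorm[OF q] V, of y x]
          seminorm_diff_le[OF csn_seminorm[OF q] V, of x y]
          seminorm_diff_commute[OF csn_seminorm[OF q] V, of x y] x by auto
      then show "q y \<in> U" using e y by (simp add: dist_real_def)
    qed
    then show "\<exists>r\<in>csn \<tau>. \<exists>e>0. {y \<in> topspace \<tau>. r (y - x) < e} \<subseteq> {x \<in> topspace \<tau>. q x \<in> U}"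
      using q e by blast
  qed auto
qed auto

lemma csn_pullback:
  assumes V: "subspace (topspace \<sigma>)" and f: "continuous_map \<sigma> \<tau> f"
    and lin: "linear_on_space scl (topspace \<sigma>) f" and q: "q \<in> csn \<tau>"
  shows "(\<lambda>x. q (f x)) \<in> csn \<sigma>"
proof -
  have img: "f ` topspace \<sigma> \<subseteq> topspace \<tau>" using f by (simp add: continuous_map_image_subset_topspace)
  have "openin \<sigma> {y \<in> topspace \<sigma>. q (f (y - x)) < e}" if x: "x \<in> topspace \<sigma>" "e > 0" for x e
  proof -
    have "openin \<sigma> {y \<in> topspace \<sigma>. f y \<in> {z \<in> topspace \<tau>. q (z - f x) < e}}"
      by (rule openin_continuous_map_preimage[OF f csn_ball_open[OF q]]) (use x img in auto)
    also have "{y \<in> topspace \<sigma>. f y \<in> {z \<in> topspace \<tau>. q (z - f x) < e}} =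
        {y \<in> topspace \<sigma>. q (f (y - x)) < e}"
      using img x by (auto simp: linear_on_space_diff[OF lin V])
    finally show ?thesis .
  qed
  then show ?thesis
    using seminorm_pullback[OF csn_seminorm[OF q] lin img] by (simp add: csn_def)
qed

lemma continuous_map_linearI:
  assumes V: "subspace (topspace \<sigma>)" and \<tau>: "lc_space scl \<tau>" and lin: "linear_on_space scl (topspace \<sigma>) f"
    and img: "\<And>x. x \<in> topspace \<sigma> \<Longrightarrow> f x \<in> topspace \<tau>"
    and q: "\<And>q. q \<in> csn \<tau> \<Longrightarrow> (\<lambda>x. q (f x)) \<in> csn \<sigma>"
  shows "continuous_map \<sigma> \<tau> f"
proof (rule continuous_map_lcI[OF \<tau> img])
  fix r x assume r: "r \<in> csn \<tau>" and x: "x \<in> topspace \<sigma>"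
  show "\<exists>U. openin \<sigma> U \<and> x \<in> U \<and> (\<forall>y\<in>U. r (f y - f x) < 1)"
    by (rule exI[of _ "{y \<in> topspace \<sigma>. r (f (y - x)) < 1}"])
      (use csn_ball_open[OF q[OF r] x, of 1] x seminorm_zero[OF csn_seminorm[OF q[OF r]] V]
        in \<open>auto simp: linear_on_space_diff[OF lin V]\<close>)
qed

text \<open>Tests only the generating seminorms of the target, which are the ones that the tower
  prescribes. The centre \<open>z\<close> of a subbasic ball need not lie in the range of
  \<open>f\<close>, hence the reduced radius in the proof.\<close>

lemma continuous_map_linear_seminorm_topologyI:
  assumes V: "subspace (topspace \<sigma>)" and lin: "linear_on_space scl (topspace \<sigma>) f"
    and W: "subspace W" and Q: "\<And>q. q \<in> Q \<Longrightarrow> seminorm_on scl W q"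
    and img: "\<And>x. x \<in> topspace \<sigma> \<Longrightarrow> f x \<in> W"
    and q: "\<And>q. q \<in> Q \<Longrightarrow> (\<lambda>x. q (f x)) \<in> csn \<sigma>"
  shows "continuous_map \<sigma> (seminorm_topology W Q) f"
  unfolding seminorm_topology_def
proof (rule continuous_on_generated_topo)
  fix U assume "U \<in> insert W {{y \<in> W. q (y - x) < e} | q x e. q \<in> Q \<and> x \<in> W \<and> 0 < e}"
  then have "U = W \<or> (\<exists>r z e. U = {y \<in> W. r (y - z) < e} \<and> r \<in> Q \<and> z \<in> W \<and> e > 0)"
    by simp
  then consider "U = W" | r z e where "U = {y \<in> W. r (y - z) < e}" "r \<in> Q" "z \<in> W" "e > 0"
    by metis
  then show "openin \<sigma> (f -` U \<inter> topspace \<sigma>)"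
  proof cases
    case 1
    then have "f -` U \<inter> topspace \<sigma> = topspace \<sigma>" using img by auto
    then show ?thesis by simp
  next
    case 2
    note r = Q[OF 2(2)]
    show ?thesis
    proof (rule openin_csnI[OF _ V])
      fix x assume x: "x \<in> f -` U \<inter> topspace \<sigma>"
      have "{y \<in> topspace \<sigma>. r (f (y - x)) < e - r (f x - z)} \<subseteq> f -` U \<inter> topspace \<sigma>"
      proof safe
        fix y assume y: "y \<in> topspace \<sigma>" "r (f (y - x)) < e - r (f x - z)"
        then show "y \<in> f -` U"
          using seminorm_triangle[OF r W img[OF y(1)] img[of x] 2(3)] x img 2
          by (auto simp: linear_on_space_diff[OF lin V])
      qed
      then show "\<exists>q\<in>csn \<sigma>. \<exists>e>0. {y \<in> topspace \<sigma>. q (y - x) < e} \<subseteq> f -` U \<inter> topspace \<sigma>"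
        using x 2 by (intro bexI[OF _ q[OF 2(2)]] exI[of _ "e - r (f x - z)"]) auto
    qed auto
  qed
next
  show "f ` topspace \<sigma> \<subseteq> \<Union> (insert W {{y \<in> W. q (y - x) < e} | q x e. q \<in> Q \<and> x \<in> W \<and> 0 < e})"
    using img by auto
qed

text \<open>Homogeneity turns an inclusion of unit balls into a pointwise bound. The vector is
  scaled by \<open>1 / c\<close> for arbitrary \<open>c\<close> above \<open>q x\<close>, and not by
  \<open>1 / q x\<close>, because \<open>q x\<close> may vanish.\<close>

lemma seminorm_le_if_nbhd:
  assumes V: "subspace V" and q: "seminorm_on scl V q" and r: "seminorm_on scl V r"
    and le: "\<And>x. x \<in> V \<Longrightarrow> q x < 1 \<Longrightarrow> r x \<le> 1" and x: "x \<in> V"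
  shows "r x \<le> q x"
proof -
  have "r x \<le> c" if "q x < c" for c
  proof -
    have c: "c > 0" using that seminorm_nonneg[OF q x] by linarith
    have "r (scl (of_real (1/c)) x) \<le> 1"
      by (rule le) (use x c that V in \<open>auto simp: subspace_scale seminorm_scale[OF q x] norm_divide field_simps\<close>)
    then show ?thesis using seminorm_scale[OF r x, of "of_real (1/c)"] c
        mult_right_mono[of "r (scl (of_real (1/c)) x)" 1 c]
      by (simp add: norm_divide field_simps)
  qed
  then show "r x \<le> q x" using dense_ge by blast
qed

text \<open>Carries estimates from a subspace to the surrounding space, in particular from the
  inductive limit to its completion: an open set that traces the unit ball of \<open>p\<close> on
  \<open>Y\<close> contains a unit ball of some \<open>r\<close>, and homogeneity does the
  rest.\<close>

lemma csn_subtopology_dominated: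
  assumes \<sigma>: "lc_space scl \<sigma>" and Y: "subspace Y" "Y \<subseteq> topspace \<sigma>"
    and p: "p \<in> csn (subtopology \<sigma> Y)"
  shows "\<exists>r\<in>csn \<sigma>. \<forall>y\<in>Y. p y \<le> r y"
proof -
  note V = lc_subspace[OF \<sigma>]
  have tY: "topspace (subtopology \<sigma> Y) = Y" using Y(2) by auto
  have p': "seminorm_on scl Y p" using csn_seminorm[OF p] tY by simp
  have "openin (subtopology \<sigma> Y) {y \<in> Y. p (y - 0) < 1}"
    using csn_ball_open[OF p, of 0 1] subspace_0[OF Y(1)] unfolding tY by simp
  then obtain U where U: "openin \<sigma> U" "{y \<in> Y. p (y - 0) < 1} = U \<inter> Y"
    unfolding openin_subtopology by metis
  have "0 \<in> {y \<in> Y. p (y - 0) < 1}" using subspace_0[OF Y(1)] seminorm_zero[OF p' Y(1)] by simp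
  then have "0 \<in> U" unfolding U(2) by simp
  then obtain r where r: "r \<in> csn \<sigma>" "{y \<in> topspace \<sigma>. r (y - 0) < 1} \<subseteq> U"
    using openin_csn_imp[OF \<sigma> U(1)] by blast
  have r': "seminorm_on scl Y r"
    using csn_seminorm[OF r(1)] Y(2) unfolding seminorm_on_def by blast
  have "p y \<le> r y" if "y \<in> Y" for y
  proof (rule seminorm_le_if_nbhd[OF Y(1) r' p' _ that])
    fix x assume "x \<in> Y" "r x < 1"
    then have "x \<in> U \<inter> Y" using r(2) Y(2) by auto
    then show "p x \<le> 1" unfolding U(2)[symmetric] by simp
  qed
  then show ?thesis using r(1) by blast
qed

lemma csn_subtopology:
  assumes "subspace (topspace \<sigma>)" "Y \<subseteq> topspace \<sigma>" "subspace Y" "q \<in> csn \<sigma>"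
  shows "q \<in> csn (subtopology \<sigma> Y)"
proof -
  have "topspace (subtopology \<sigma> Y) = Y" using assms(2) by auto
  then show ?thesis
    using csn_pullback[OF _ _ _ assms(4), of "subtopology \<sigma> Y" "\<lambda>x. x"] assms(3)
    by (simp add: linear_on_spaceI)
qed

section \<open>Limits, separation and density in terms of seminorms\<close>

lemma limitin_csnD:
  assumes "limitin \<tau> f l F" "q \<in> csn \<tau>" "e > 0"
  shows "\<forall>\<^sub>F x in F. f x \<in> topspace \<tau> \<and> q (f x - l) < e"
proof -
  note l = limitin_topspace[OF assms(1)]
  have "\<forall>\<^sub>F x in F. f x \<in> topspace \<tau>" using limitinD[OF assms(1) openin_topspace l] .
  moreover have "q (l - l) < e"
    using seminorm_scale[OF csn_seminorm[OF assms(2)] l, of 0] assms(3) by simp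
  then have "\<forall>\<^sub>F x in F. f x \<in> {y \<in> topspace \<tau>. q (y - l) < e}"
    using limitinD[OF assms(1) csn_ball_open[OF assms(2) l assms(3)]] l by simp
  ultimately show ?thesis by simp
qed

lemma limitin_lcI:
  assumes "lc_space scl \<tau>" "l \<in> topspace \<tau>" "\<forall>\<^sub>F x in F. f x \<in> topspace \<tau>"
    and q: "\<And>q. q \<in> csn \<tau> \<Longrightarrow> \<forall>\<^sub>F x in F. q (f x - l) < 1"
  shows "limitin \<tau> f l F"
  unfolding limitin_def
proof (intro conjI allI impI)
  fix U assume U: "openin \<tau> U \<and> l \<in> U"
  then obtain q where "q \<in> csn \<tau>" "{y \<in> topspace \<tau>. q (y - l) < 1} \<subseteq> U"
    using openin_csn_imp[OF assms(1)] by blast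
  with q[of q] assms(3) show "\<forall>\<^sub>F x in F. f x \<in> U"
    by (auto elim: eventually_elim2)
qed (rule assms)

text \<open>The fixed bound 1 suffices because every neighbourhood of 0 contains the unit ball of
  some continuous seminorm. Identities between extended maps are later proved by estimating their
  difference this way.\<close>

lemma Hausdorff_csn_zero:
  assumes \<tau>: "lc_space scl \<tau>" and H: "Hausdorff_space \<tau>" and w: "w \<in> topspace \<tau>"
    and q: "\<And>q. q \<in> csn \<tau> \<Longrightarrow> q w < 1"
  shows "w = 0"
proof (rule ccontr)
  assume "w \<noteq> 0"
  then obtain U where U: "openin \<tau> U" "0 \<in> U" "w \<notin> U"
    using H w subspace_0[OF lc_subspace[OF \<tau>]] unfolding Hausdorff_space_def disjnt_def by blast
  then obtain q where "q \<in> csn \<tau>" "{y \<in> topspace \<tau>. q (y - 0) < 1} \<subseteq> U"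
    using openin_csn_imp[OF \<tau>] by blast
  then show False using U(3) w assms(4)[of q] by auto
qed

lemma dense_meets_open:
  assumes "\<sigma> closure_of Y = topspace \<sigma>" "openin \<sigma> S" "x \<in> S"
  shows "\<exists>y\<in>Y. y \<in> S"
proof -
  have "x \<in> \<sigma> closure_of Y" using assms openin_subset by fastforce
  then show ?thesis using assms(2,3) unfolding in_closure_of by blast
qed

lemma dense_csn_approx:
  assumes V: "subspace (topspace \<sigma>)" and d: "\<sigma> closure_of Y = topspace \<sigma>"
    and x: "x \<in> topspace \<sigma>" and q: "q \<in> csn \<sigma>" and e: "e > 0"
  shows "\<exists>y\<in>Y. y \<in> topspace \<sigma> \<and> q (y - x) < e"
proof -
  have "x \<in> {y \<in> topspace \<sigma>. q (y - x) < e}"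
    using x e seminorm_zero[OF csn_seminorm[OF q] V] by simp
  from dense_meets_open[OF d csn_ball_open[OF q x e] this] show ?thesis by simp
qed

lemma dense_csnI:
  assumes \<sigma>: "lc_space scl \<sigma>"
    and q: "\<And>x q. x \<in> topspace \<sigma> \<Longrightarrow> q \<in> csn \<sigma> \<Longrightarrow> \<exists>y\<in>Y. y \<in> topspace \<sigma> \<and> q (y - x) < 1"
  shows "\<sigma> closure_of Y = topspace \<sigma>"
proof
  show "topspace \<sigma> \<subseteq> \<sigma> closure_of Y"
  proof
    fix x assume x: "x \<in> topspace \<sigma>"
    have "\<exists>y. y \<in> Y \<and> y \<in> U" if U: "x \<in> U" "openin \<sigma> U" for U
    proof -
      obtain r where "r \<in> csn \<sigma>" "{y \<in> topspace \<sigma>. r (y - x) < 1} \<subseteq> U"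
        using openin_csn_imp[OF \<sigma> U(2,1)] by blast
      then show ?thesis using q[OF x, of r] by blast
    qed
    then show "x \<in> \<sigma> closure_of Y" unfolding in_closure_of using x by blast
  qed
qed (rule closure_of_subset_topspace)

lemma dense_eq:
  assumes "\<sigma> closure_of Y = topspace \<sigma>" "Hausdorff_space \<rho>"
    and "continuous_map \<sigma> \<rho> f" "continuous_map \<sigma> \<rho> g" "\<And>y. y \<in> Y \<Longrightarrow> f y = g y"
    and "x \<in> topspace \<sigma>"
  shows "f x = g x"
proof (rule forall_in_closure_of_eq[OF _ assms(2-5)])
  show "x \<in> \<sigma> closure_of Y" using assms(1,6) by simp
qed

section \<open>Completeness and extension of linear maps\<close>

lemma cauchy_filter_csnD:
  assumes \<tau>: "subspace (topspace \<tau>)" and F: "cauchy_filter_lc \<tau> F" and q: "q \<in> csn \<tau>"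
  shows "\<exists>M. (\<forall>\<^sub>F x in F. x \<in> M) \<and> (\<forall>x\<in>M. \<forall>y\<in>M. q (x - y) < 1)"
proof -
  have "openin \<tau> {y \<in> topspace \<tau>. q (y - 0) < 1}"
    using csn_ball_open[OF q subspace_0[OF \<tau>]] by simp
  moreover have "0 \<in> {y \<in> topspace \<tau>. q (y - 0) < 1}"
    using subspace_0[OF \<tau>] seminorm_zero[OF csn_seminorm[OF q] \<tau>] by simp
  ultimately obtain M where "\<forall>\<^sub>F x in F. x \<in> M"
    "\<forall>x\<in>M. \<forall>y\<in>M. x - y \<in> {y \<in> topspace \<tau>. q (y - 0) < 1}"
    using F unfolding cauchy_filter_lc_def by blast
  then show ?thesis by (intro exI[of _ M]) auto
qed

lemma cauchy_filter_csnI: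
  assumes \<tau>: "lc_space scl \<tau>" and "F \<noteq> bot" "\<forall>\<^sub>F x in F. x \<in> topspace \<tau>"
    and q: "\<And>q. q \<in> csn \<tau> \<Longrightarrow> \<exists>M. (\<forall>\<^sub>F x in F. x \<in> M) \<and> (\<forall>x\<in>M. \<forall>y\<in>M. q (x - y) < 1)"
  shows "cauchy_filter_lc \<tau> F"
  unfolding cauchy_filter_lc_def
proof (intro conjI allI impI assms(2,3))
  fix U assume U: "openin \<tau> U \<and> 0 \<in> U"
  then obtain r where r: "r \<in> csn \<tau>" "{y \<in> topspace \<tau>. r (y - 0) < 1} \<subseteq> U"
    using openin_csn_imp[OF \<tau>] by blast
  obtain M where M: "\<forall>\<^sub>F x in F. x \<in> M" "\<forall>x\<in>M. \<forall>y\<in>M. r (x - y) < 1" using q[OF r(1)] by blast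
  have "\<forall>\<^sub>F x in F. x \<in> M \<inter> topspace \<tau>" using M(1) assms(3) by (simp add: eventually_conj_iff)
  moreover have "\<forall>x\<in>M \<inter> topspace \<tau>. \<forall>y\<in>M \<inter> topspace \<tau>. x - y \<in> U"
    using M(2) r(2) subspace_diff[OF lc_subspace[OF \<tau>]] by auto
  ultimately show "\<exists>M. (\<forall>\<^sub>F x in F. x \<in> M) \<and> (\<forall>x\<in>M. \<forall>y\<in>M. x - y \<in> U)" by blast
qed

text \<open>One limit \<open>l\<close> serves all pairs \<open>q\<close>, \<open>r\<close> at once.
  The estimate in the conclusion keeps everything that is needed about \<open>l\<close>, so that
  linearity and continuity of the extension can be derived without returning to filters.\<close>

lemma extend_by_limits:
  assumes \<sigma>: "lc_space scl \<sigma>" and \<rho>: "lc_space scl \<rho>" and comp: "complete_lc \<rho>"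
    and Y: "subspace Y" "Y \<subseteq> topspace \<sigma>" and dense: "\<sigma> closure_of Y = topspace \<sigma>"
    and lin: "linear_on_space scl Y f" and img: "\<And>y. y \<in> Y \<Longrightarrow> f y \<in> topspace \<rho>"
    and bd: "\<And>q. q \<in> csn \<rho> \<Longrightarrow> \<exists>r\<in>csn \<sigma>. \<forall>y\<in>Y. q (f y) \<le> r y"
    and x: "x \<in> topspace \<sigma>"
  shows "\<exists>l\<in>topspace \<rho>. \<forall>q\<in>csn \<rho>. \<forall>r\<in>csn \<sigma>. (\<forall>y\<in>Y. q (f y) \<le> r y) \<longrightarrow>
    (\<forall>y\<in>Y. q (f y - l) \<le> r (y - x))"
proof -
  note V = lc_subspace[OF \<sigma>] and W = lc_subspace[OF \<rho>]
  \<comment> \<open>The image under \<open>f\<close> of the traces on \<open>Y\<close> of the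
    neighbourhoods of \<open>x\<close>. Density makes it proper, and domination of \<open>q\<close>
    after \<open>f\<close> by \<open>r\<close> makes it Cauchy.\<close>
  define F where "F = filtermap f (inf (nhdsin \<sigma> x) (principal Y))"
  have evF: "eventually P F \<longleftrightarrow> (\<exists>S. openin \<sigma> S \<and> x \<in> S \<and> (\<forall>y\<in>S. y \<in> Y \<longrightarrow> P (f y)))" for P
    using x by (simp add: F_def eventually_filtermap eventually_inf_principal eventually_nhdsin)
  note near = dense_meets_open[OF dense]
  have "cauchy_filter_lc \<rho> F"
  proof (rule cauchy_filter_csnI[OF \<rho>])
    show "F \<noteq> bot" unfolding trivial_limit_def evF using near by blast
    show "\<forall>\<^sub>F x in F. x \<in> topspace \<rho>" unfolding evF using img x by blast
    fix q assume q: "q \<in> csn \<rho>"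
    then obtain r where r: "r \<in> csn \<sigma>" "\<forall>y\<in>Y. q (f y) \<le> r y" using bd by blast
    define B where "B = {y \<in> topspace \<sigma>. r (y - x) < 1 / 2}"
    have "openin \<sigma> B" "x \<in> B"
      using csn_ball_open[OF r(1) x, of "1/2"] x seminorm_zero[OF csn_seminorm[OF r(1)] V]
      by (auto simp: B_def)
    then have "\<forall>\<^sub>F z in F. z \<in> f ` (B \<inter> Y)" unfolding evF by blast
    moreover have "q (f y - f z) < 1" if "y \<in> B \<inter> Y" "z \<in> B \<inter> Y" for y z
    proof -
      have "q (f y - f z) = q (f (y - z))" using linear_on_space_diff[OF lin Y(1)] that by simp
      also have "\<dots> \<le> r (y - z)" using r(2) subspace_diff[OF Y(1)] that by blast
      also have "\<dots> \<le> r (y - x) + r (x - z)"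
        using seminorm_triangle[OF csn_seminorm[OF r(1)] V] that x B_def by blast
      also have "\<dots> < 1"
        using that seminorm_diff_commute[OF csn_seminorm[OF r(1)] V x, of z] by (auto simp: B_def)
      finally show ?thesis .
    qed
    ultimately show "\<exists>M. (\<forall>\<^sub>F x in F. x \<in> M) \<and> (\<forall>x\<in>M. \<forall>y\<in>M. q (x - y) < 1)"
      by (intro exI[of _ "f ` (B \<inter> Y)"]) blast
  qed
  then obtain l where l: "limitin \<rho> (\<lambda>x. x) l F" using comp unfolding complete_lc_def by blast
  then have lW: "l \<in> topspace \<rho>" by (rule limitin_topspace)
  have "q (f y - l) \<le> r (y - x)"
    if q: "q \<in> csn \<rho>" and r: "r \<in> csn \<sigma>" "\<forall>y\<in>Y. q (f y) \<le> r y" and y: "y \<in> Y" for q r y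
  proof (rule field_le_epsilon)
    fix e :: real assume e: "e > 0"
    have "\<forall>\<^sub>F z in F. z \<in> topspace \<rho> \<and> q (z - l) < e / 2"
      using limitin_csnD[OF l q, of "e / 2"] e by simp
    then obtain S where S: "openin \<sigma> S" "x \<in> S" "\<forall>z\<in>S. z \<in> Y \<longrightarrow> q (f z - l) < e / 2"
      unfolding evF by blast
    define B where "B = {y \<in> topspace \<sigma>. r (y - x) < e / 2}"
    have "openin \<sigma> B" "x \<in> B"
      using csn_ball_open[OF r(1) x, of "e/2"] x e seminorm_zero[OF csn_seminorm[OF r(1)] V]
      by (auto simp: B_def)
    \<comment> \<open>An intermediate point of \<open>Y\<close> whose image is close to
      \<open>l\<close> and which is itself close to \<open>x\<close>; each distance costs half of
      \<open>e\<close>.\<close>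
    then obtain z where z: "z \<in> Y" "z \<in> S" "z \<in> B" using near[of "S \<inter> B"] S by blast
    have zV: "z \<in> topspace \<sigma>" "y \<in> topspace \<sigma>" using z y Y by auto
    have "q (f y - l) \<le> q (f y - f z) + q (f z - l)"
      using seminorm_triangle[OF csn_seminorm[OF q] W img[OF y] img[OF z(1)] lW] .
    also have "q (f y - f z) = q (f (y - z))" using linear_on_space_diff[OF lin Y(1)] y z by simp
    also have "\<dots> \<le> r (y - z)" using r(2) subspace_diff[OF Y(1)] y z by blast
    also have "\<dots> \<le> r (y - x) + r (x - z)"
      using seminorm_triangle[OF csn_seminorm[OF r(1)] V zV(2) x zV(1)] .
    also have "r (x - z) < e / 2"
      using z seminorm_diff_commute[OF csn_seminorm[OF r(1)] V x zV(1)] by (auto simp: B_def)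
    also have "q (f z - l) < e / 2" using S z by blast
    finally show "q (f y - l) \<le> r (y - x) + e" by simp
  qed
  then show ?thesis using lW by blast
qed

text \<open>All three properties of \<open>g\<close> come from the one estimate \<open>est\<close>,
  with separation of \<open>\<rho>\<close> turning estimates into equalities.\<close>

lemma continuous_linear_extension:
  assumes \<sigma>: "lc_space scl \<sigma>" and \<rho>: "lc_space scl \<rho>" "complete_lc \<rho>" "Hausdorff_space \<rho>"
    and Y: "subspace Y" "Y \<subseteq> topspace \<sigma>" and dense: "\<sigma> closure_of Y = topspace \<sigma>"
    and lin: "linear_on_space scl Y f" and f: "continuous_map (subtopology \<sigma> Y) \<rho> f"
  shows "\<exists>g. continuous_map \<sigma> \<rho> g \<and> linear_on_space scl (topspace \<sigma>) g \<and> (\<forall>y\<in>Y. g y = f y)"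
proof -
  note V = lc_subspace[OF \<sigma>] and W = lc_subspace[OF \<rho>(1)]
  have tY: "topspace (subtopology \<sigma> Y) = Y" using Y(2) by auto
  have img: "f y \<in> topspace \<rho>" if "y \<in> Y" for y
    using continuous_map_image_subset_topspace[OF f] that tY by auto
  have bd: "\<exists>r\<in>csn \<sigma>. \<forall>y\<in>Y. q (f y) \<le> r y" if "q \<in> csn \<rho>" for q
    by (rule csn_subtopology_dominated[OF \<sigma> Y csn_pullback[OF _ f _ that]]) (use tY Y lin in auto)
  obtain g where g: "\<And>x. x \<in> topspace \<sigma> \<Longrightarrow> g x \<in> topspace \<rho>"
    and est: "\<And>x q r y. \<lbrakk>x \<in> topspace \<sigma>; q \<in> csn \<rho>; r \<in> csn \<sigma>; \<forall>y\<in>Y. q (f y) \<le> r y; y \<in> Y\<rbrakk> \<Longrightarrow>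
      q (f y - g x) \<le> r (y - x)"
    using extend_by_limits[OF \<sigma> \<rho>(1,2) Y dense lin img bd] by metis
  have ext: "g y = f y" if y: "y \<in> Y" for y
  proof -
    have "f y - g y = 0"
    proof (rule Hausdorff_csn_zero[OF \<rho>(1,3)])
      show "f y - g y \<in> topspace \<rho>" using subspace_diff[OF W] img[OF y] g y Y by blast
      fix q assume q: "q \<in> csn \<rho>"
      then obtain r where r: "r \<in> csn \<sigma>" "\<forall>y\<in>Y. q (f y) \<le> r y" using bd by blast
      \<comment> \<open>At the point \<open>y\<close> itself the right-hand side of
        \<open>est\<close> is \<open>r 0 = 0\<close>.\<close>
      then show "q (f y - g y) < 1"
        using est[OF _ q r y, of y] seminorm_zero[OF csn_seminorm[OF r(1)] V] y Y by auto
    qed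
    then show ?thesis by simp
  qed
  note mem = g img subspace_add[OF V] subspace_add[OF W] subspace_add[OF Y(1)] subspace_diff[OF V]
    subspace_diff[OF W] subspace_scale[OF V] subspace_scale[OF W] subspace_scale[OF Y(1)]
  have gl: "linear_on_space scl (topspace \<sigma>) g"
  proof (rule linear_on_spaceI)
    fix x y assume xy: "x \<in> topspace \<sigma>" "y \<in> topspace \<sigma>"
    have "g (x + y) - (g x + g y) = 0"
    proof (rule Hausdorff_csn_zero[OF \<rho>(1,3)])
      show "g (x + y) - (g x + g y) \<in> topspace \<rho>"
        using xy by (simp add: mem)
      fix q assume q: "q \<in> csn \<rho>"
      note sq = csn_seminorm[OF q]
      obtain r where r: "r \<in> csn \<sigma>" "\<forall>y\<in>Y. q (f y) \<le> r y" using bd[OF q] by blast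
      note sr = csn_seminorm[OF r(1)]
      \<comment> \<open>Each of \<open>r (u - x)\<close> and \<open>r (v - y)\<close> enters the
        final bound twice, hence the quarters.\<close>
      obtain u where u: "u \<in> Y" "u \<in> topspace \<sigma>" "r (u - x) < 1 / 4"
        using dense_csn_approx[OF V dense xy(1) r(1), of "1/4"] by auto
      obtain v where v: "v \<in> Y" "v \<in> topspace \<sigma>" "r (v - y) < 1 / 4"
        using dense_csn_approx[OF V dense xy(2) r(1), of "1/4"] by auto
      have "q (g (x + y) - (g x + g y)) \<le>
          q (g (x + y) - f (u + v)) + q (f (u + v) - (g x + g y))"
        by (rule seminorm_triangle[OF sq W]) (use u v xy in \<open>simp_all add: mem\<close>)
      also have "q (g (x + y) - f (u + v)) = q (f (u + v) - g (x + y))"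
        by (rule seminorm_diff_commute[OF sq W]) (use u v xy in \<open>simp_all add: mem\<close>)
      also have "\<dots> \<le> r (u + v - (x + y))"
        by (rule est[OF _ q r]) (use u v xy in \<open>simp_all add: mem\<close>)
      also have "u + v - (x + y) = (u - x) + (v - y)" by (simp add: algebra_simps)
      also have "r \<dots> \<le> r (u - x) + r (v - y)"
        by (rule seminorm_add[OF sr]) (use u v xy in \<open>simp_all add: mem\<close>)
      also have "f (u + v) - (g x + g y) = (f u - g x) + (f v - g y)"
        by (simp add: linear_on_space_add[OF lin u(1) v(1)] algebra_simps)
      also have "q \<dots> \<le> q (f u - g x) + q (f v - g y)"
        by (rule seminorm_add[OF sq]) (use u v xy in \<open>simp_all add: mem\<close>)
      also have "\<dots> \<le> r (u - x) + r (v - y)"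
        using est[OF xy(1) q r u(1)] est[OF xy(2) q r v(1)] by simp
      finally show "q (g (x + y) - (g x + g y)) < 1" using u v by simp
    qed
    then show "g (x + y) = g x + g y" by simp
  next
    fix c x assume x: "x \<in> topspace \<sigma>"
    have "g (scl c x) - scl c (g x) = 0"
    proof (rule Hausdorff_csn_zero[OF \<rho>(1,3)])
      show "g (scl c x) - scl c (g x) \<in> topspace \<rho>"
        using x by (simp add: mem)
      fix q assume q: "q \<in> csn \<rho>"
      note sq = csn_seminorm[OF q]
      obtain r where r: "r \<in> csn \<sigma>" "\<forall>y\<in>Y. q (f y) \<le> r y" using bd[OF q] by blast
      note sr = csn_seminorm[OF r(1)]
      \<comment> \<open>The final bound is \<open>2 * norm c * r (u - x)\<close>; the summand 1
        keeps the denominator positive when \<open>c = 0\<close> and makes the inequality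
        strict.\<close>
      have c: "2 * norm c + 1 > 0" using norm_ge_zero[of c] by linarith
      then have "1 / (2 * norm c + 1) > 0" by simp
      then obtain u where u: "u \<in> Y" "u \<in> topspace \<sigma>" "r (u - x) < 1 / (2 * norm c + 1)"
        using dense_csn_approx[OF V dense x r(1)] by blast
      have "q (g (scl c x) - scl c (g x)) \<le>
          q (g (scl c x) - f (scl c u)) + q (f (scl c u) - scl c (g x))"
        by (rule seminorm_triangle[OF sq W]) (use u x in \<open>simp_all add: mem\<close>)
      also have "q (g (scl c x) - f (scl c u)) = q (f (scl c u) - g (scl c x))"
        by (rule seminorm_diff_commute[OF sq W]) (use u x in \<open>simp_all add: mem\<close>)
      also have "\<dots> \<le> r (scl c u - scl c x)"
        by (rule est[OF _ q r]) (use u x in \<open>simp_all add: mem\<close>)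
      also have "\<dots> = norm c * r (u - x)"
        using seminorm_scale[OF sr, of "u - x" c] subspace_diff[OF V u(2) x]
        by (simp add: scale_right_diff_distrib)
      also have "f (scl c u) - scl c (g x) = scl c (f u - g x)"
        by (simp add: linear_on_space_scale[OF lin u(1)] scale_right_diff_distrib)
      also have "q \<dots> = norm c * q (f u - g x)"
        by (rule seminorm_scale[OF sq]) (use u x in \<open>simp_all add: mem\<close>)
      also have "\<dots> \<le> norm c * r (u - x)"
        using est[OF x q r u(1)] by (simp add: mult_left_mono)
      finally have "q (g (scl c x) - scl c (g x)) \<le> 2 * norm c * r (u - x)" by simp
      also have "\<dots> \<le> 2 * norm c * (1 / (2 * norm c + 1))"
        using u(3) by (intro mult_left_mono) auto
      also have "\<dots> < 1" using c by (simp add: field_simps)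
      finally show "q (g (scl c x) - scl c (g x)) < 1" .
    qed
    then show "g (scl c x) = scl c (g x)" by simp
  qed
  have "continuous_map \<sigma> \<rho> g"
  proof (rule continuous_map_linearI[OF V \<rho>(1) gl g])
    fix q assume q: "q \<in> csn \<rho>"
    obtain r where r: "r \<in> csn \<sigma>" "\<forall>y\<in>Y. q (f y) \<le> r y" using bd[OF q] by blast
    note sr = csn_seminorm[OF r(1)]
    have f0: "f 0 = 0" using linear_on_space_diff[OF lin Y(1), of 0 0] subspace_0[OF Y(1)] by simp
    show "(\<lambda>x. q (g x)) \<in> csn \<sigma>"
    proof (rule csn_le[OF V r(1)])
      show "seminorm_on scl (topspace \<sigma>) (\<lambda>x. q (g x))"
        using seminorm_pullback[OF csn_seminorm[OF q] gl] g by blast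
      fix x assume x: "x \<in> topspace \<sigma>"
      \<comment> \<open>This is \<open>est\<close> at the element 0 of \<open>Y\<close>, where
        \<open>f\<close> vanishes.\<close>
      show "q (g x) \<le> r x"
        using est[OF x q r subspace_0[OF Y(1)]] seminorm_minus[OF csn_seminorm[OF q] g[OF x]]
          seminorm_minus[OF sr x] by (simp add: f0)
    qed
  qed
  then show ?thesis using gl ext by blast
qed

text \<open>A continuous linear map is uniformly continuous, so it sends Cauchy filters to Cauchy
  filters; the limit found in \<open>\<rho>\<close> is brought back by \<open>g\<close>.\<close>

lemma complete_lc_transport:
  assumes \<sigma>: "lc_space scl \<sigma>" and \<rho>: "lc_space scl \<rho>" "complete_lc \<rho>"
    and f: "continuous_map \<sigma> \<rho> f" "linear_on_space scl (topspace \<sigma>) f"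
    and g: "continuous_map \<rho> \<sigma> g" and gf: "\<And>x. x \<in> topspace \<sigma> \<Longrightarrow> g (f x) = x"
  shows "complete_lc \<sigma>"
  unfolding complete_lc_def
proof (intro allI impI)
  note V = lc_subspace[OF \<sigma>]
  fix F assume F: "cauchy_filter_lc \<sigma> F"
  then have evV: "\<forall>\<^sub>F x in F. x \<in> topspace \<sigma>" unfolding cauchy_filter_lc_def by blast
  have img: "f x \<in> topspace \<rho>" if "x \<in> topspace \<sigma>" for x
    using continuous_map_image_subset_topspace[OF f(1)] that by auto
  have "cauchy_filter_lc \<rho> (filtermap f F)"
  proof (rule cauchy_filter_csnI[OF \<rho>(1)])
    show "filtermap f F \<noteq> bot" using F by (simp add: cauchy_filter_lc_def filtermap_bot_iff)
    show "\<forall>\<^sub>F x in filtermap f F. x \<in> topspace \<rho>"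
      unfolding eventually_filtermap using evV by (rule eventually_mono) (rule img)
    fix q assume q: "q \<in> csn \<rho>"
    obtain M where M: "\<forall>\<^sub>F x in F. x \<in> M" "\<forall>x\<in>M. \<forall>y\<in>M. q (f (x - y)) < 1"
      using cauchy_filter_csnD[OF V F csn_pullback[OF V f q]] by blast
    have "\<forall>\<^sub>F x in filtermap f F. x \<in> f ` (M \<inter> topspace \<sigma>)"
      unfolding eventually_filtermap using evV M(1) by (auto elim: eventually_elim2)
    moreover have "q (f x - f y) < 1" if "x \<in> M \<inter> topspace \<sigma>" "y \<in> M \<inter> topspace \<sigma>" for x y
      using M(2) that by (simp flip: linear_on_space_diff[OF f(2) V])
    ultimately show "\<exists>M. (\<forall>\<^sub>F x in filtermap f F. x \<in> M) \<and> (\<forall>x\<in>M. \<forall>y\<in>M. q (x - y) < 1)"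
      by (intro exI[of _ "f ` (M \<inter> topspace \<sigma>)"]) blast
  qed
  then obtain l where "limitin \<rho> (\<lambda>x. x) l (filtermap f F)"
    using \<rho>(2) unfolding complete_lc_def by blast
  then have "limitin \<rho> f l F" unfolding limitin_def eventually_filtermap .
  then have "limitin \<sigma> (g \<circ> f) (g l) F" by (rule continuous_map_limit[OF g])
  moreover have "\<forall>\<^sub>F x in F. (g \<circ> f) x = x"
    using evV by (rule eventually_mono) (simp add: gf)
  ultimately have "limitin \<sigma> (\<lambda>x. x) (g l) F" by (metis limitin_transform_eventually)
  then show "\<exists>l. limitin \<sigma> (\<lambda>x. x) l F" by blast
qed

lemma continuous_map_in: "continuous_map \<sigma> \<rho> f \<Longrightarrow> x \<in> topspace \<sigma> \<Longrightarrow> f x \<in> topspace \<rho>"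
  using continuous_map_image_subset_topspace[of \<sigma> \<rho> f] by auto

section \<open>Semigroups and generators\<close>

lemma limitin_add_lc:
  assumes \<tau>: "lc_space scl \<tau>" and f: "limitin \<tau> f a F" and g: "limitin \<tau> g b F"
  shows "limitin \<tau> (\<lambda>x. f x + g x) (a + b) F"
proof -
  note V = lc_subspace[OF \<tau>]
  have a: "a \<in> topspace \<tau>" and b: "b \<in> topspace \<tau>" using f g by (auto dest: limitin_topspace)
  show ?thesis
  proof (rule limitin_lcI[OF \<tau>])
    show "a + b \<in> topspace \<tau>" using a b subspace_add[OF V] by simp
    show "\<forall>\<^sub>F x in F. f x + g x \<in> topspace \<tau>"
      using limitinD[OF f openin_topspace a] limitinD[OF g openin_topspace b]
      by eventually_elim (rule subspace_add[OF V])
    fix q assume q: "q \<in> csn \<tau>"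
    have "\<forall>\<^sub>F x in F. f x \<in> topspace \<tau> \<and> q (f x - a) < 1 / 2"
      "\<forall>\<^sub>F x in F. g x \<in> topspace \<tau> \<and> q (g x - b) < 1 / 2"
      by (rule limitin_csnD[OF f q] limitin_csnD[OF g q], simp)+
    then show "\<forall>\<^sub>F x in F. q (f x + g x - (a + b)) < 1"
    proof eventually_elim
      case (elim x)
      have "q ((f x - a) + (g x - b)) \<le> q (f x - a) + q (g x - b)"
        by (rule seminorm_add[OF csn_seminorm[OF q]]) (use elim a b subspace_diff[OF V] in auto)
      then show ?case using elim by (simp add: algebra_simps)
    qed
  qed
qed

lemma continuous_map_scl:
  assumes \<tau>: "lc_space scl \<tau>"
  shows "continuous_map \<tau> \<tau> (scl c)"
proof -
  note V = lc_subspace[OF \<tau>]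
  have lin: "linear_on_space scl (topspace \<tau>) (scl c)"
    by (rule linear_on_spaceI) (simp_all add: scale_right_distrib scale_left_commute)
  have img: "scl c x \<in> topspace \<tau>" if "x \<in> topspace \<tau>" for x using subspace_scale[OF V that] .
  show ?thesis
  proof (rule continuous_map_linearI[OF V \<tau> lin img])
    fix q assume q: "q \<in> csn \<tau>"
    have "norm c + 1 > 0" using norm_ge_zero[of c] by linarith
    then show "(\<lambda>x. q (scl c x)) \<in> csn \<tau>"
    proof (rule csn_le[OF V csn_mult[OF q]])
      show "seminorm_on scl (topspace \<tau>) (\<lambda>x. q (scl c x))"
        by (rule seminorm_pullback[OF csn_seminorm[OF q] lin]) (use img in auto)
      fix x assume x: "x \<in> topspace \<tau>"
      show "q (scl c x) \<le> (norm c + 1) * q x"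
        using seminorm_scale[OF csn_seminorm[OF q] x] seminorm_nonneg[OF csn_seminorm[OF q] x]
        by (simp add: distrib_right)
    qed
  qed
qed

text \<open>The exponent is a parameter because one value has to serve all levels of the tower.
  Equicontinuity is phrased as domination by a seminorm that does not depend on time.\<close>

definition semigroup_exp :: "'a topology \<Rightarrow> (real \<Rightarrow> 'a \<Rightarrow> 'a) \<Rightarrow> real \<Rightarrow> bool"
  where "semigroup_exp \<tau> T \<omega> \<longleftrightarrow>
    (\<forall>t\<ge>0. cont_operator scl \<tau> (T t)) \<and>
    (\<forall>t\<ge>0. \<forall>s\<ge>0. \<forall>x\<in>topspace \<tau>. T (t + s) x = T t (T s x)) \<and>
    (\<forall>x\<in>topspace \<tau>. T 0 x = x) \<and>
    (\<forall>x\<in>topspace \<tau>. continuous_map (top_of_set {0..}) \<tau> (\<lambda>t. T t x)) \<and>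
    (\<forall>q\<in>csn \<tau>. \<exists>r\<in>csn \<tau>. \<forall>t\<ge>0. \<forall>x\<in>topspace \<tau>. exp (\<omega> * t) * q (T t x) \<le> r x)"

lemma cont_operatorD:
  assumes "cont_operator scl \<tau> f"
  shows "linear_on_space scl (topspace \<tau>) f" "continuous_map \<tau> \<tau> f"
  using assms by (simp_all add: cont_operator_def)

lemma semigroup_expD:
  assumes "semigroup_exp \<tau> T \<omega>" "t \<ge> 0"
  shows "linear_on_space scl (topspace \<tau>) (T t)" "continuous_map \<tau> \<tau> (T t)"
    and "x \<in> topspace \<tau> \<Longrightarrow> T t x \<in> topspace \<tau>"
    and "s \<ge> 0 \<Longrightarrow> x \<in> topspace \<tau> \<Longrightarrow> T (t + s) x = T t (T s x)"
    and "x \<in> topspace \<tau> \<Longrightarrow> T 0 x = x"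
proof -
  have "cont_operator scl \<tau> (T t)" using assms by (simp add: semigroup_exp_def)
  note * = cont_operatorD[OF this]
  from * show "linear_on_space scl (topspace \<tau>) (T t)" "continuous_map \<tau> \<tau> (T t)" by auto
  show "x \<in> topspace \<tau> \<Longrightarrow> T t x \<in> topspace \<tau>" using continuous_map_in[OF *(2)] .
qed (use assms in \<open>simp_all add: semigroup_exp_def\<close>)

text \<open>The neighbourhood \<open>W\<close> is common to all times, hence so is the seminorm
  \<open>r\<close> whose unit ball it contains; \<open>seminorm_le_if_nbhd\<close> applied at each
  time gives the domination.\<close>

lemma exp_equicontinuous_iff:
  assumes \<tau>: "lc_space scl \<tau>" and T: "\<And>t. t \<ge> 0 \<Longrightarrow> cont_operator scl \<tau> (T t)"
  shows "equicontinuous_lc \<tau> {\<lambda>x. scl (of_real (exp (\<omega> * t))) (T t x) | t. 0 \<le> t} \<longleftrightarrow>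
    (\<forall>q\<in>csn \<tau>. \<exists>r\<in>csn \<tau>. \<forall>t\<ge>0. \<forall>x\<in>topspace \<tau>. exp (\<omega> * t) * q (T t x) \<le> r x)"
    (is "?L \<longleftrightarrow> ?R")
proof
  note V = lc_subspace[OF \<tau>]
  have Tin: "T t x \<in> topspace \<tau>" if "t \<ge> 0" "x \<in> topspace \<tau>" for t x
    using continuous_map_in[OF cont_operatorD(2)[OF T[OF that(1)]] that(2)] .
  have expq: "q (scl (of_real (exp (\<omega> * t))) (T t x)) = exp (\<omega> * t) * q (T t x)"
    if "q \<in> csn \<tau>" "t \<ge> 0" "x \<in> topspace \<tau>" for q t x
    using seminorm_scale[OF csn_seminorm[OF that(1)] Tin[OF that(2,3)]] by simp
  show ?R if L: ?L
  proof
    fix q assume q: "q \<in> csn \<tau>"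
    define U where "U = {y \<in> topspace \<tau>. q (y - 0) < 1}"
    have "openin \<tau> U" "0 \<in> U"
      using csn_ball_open[OF q subspace_0[OF V], of 1] subspace_0[OF V]
        seminorm_zero[OF csn_seminorm[OF q] V] by (simp_all add: U_def)
    then have "\<exists>W. openin \<tau> W \<and> 0 \<in> W \<and>
        (\<forall>f\<in>{\<lambda>x. scl (of_real (exp (\<omega> * t))) (T t x) | t. 0 \<le> t}. f ` W \<subseteq> U)"
      by (intro L[unfolded equicontinuous_lc_def, rule_format] conjI)
    then obtain W where W: "openin \<tau> W" "0 \<in> W"
      "\<forall>f\<in>{\<lambda>x. scl (of_real (exp (\<omega> * t))) (T t x) | t. 0 \<le> t}. f ` W \<subseteq> U"
      by (elim exE conjE)
    have WU: "scl (of_real (exp (\<omega> * t))) (T t x) \<in> U" if "x \<in> W" "t \<ge> 0" for t x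
      using bspec[OF W(3), of "\<lambda>x. scl (of_real (exp (\<omega> * t))) (T t x)"] that by blast
    obtain r where r: "r \<in> csn \<tau>" "{y \<in> topspace \<tau>. r (y - 0) < 1} \<subseteq> W"
      using openin_csn_imp[OF \<tau> W(1,2)] by blast
    have "exp (\<omega> * t) * q (T t x) \<le> r x" if t: "t \<ge> 0" and x: "x \<in> topspace \<tau>" for t x
    proof (rule seminorm_le_if_nbhd[OF V csn_seminorm[OF r(1)] _ _ x])
      show "seminorm_on scl (topspace \<tau>) (\<lambda>x. exp (\<omega> * t) * q (T t x))"
        by (rule csn_seminorm, rule csn_mult, rule csn_pullback[OF V _ _ q])
          (use cont_operatorD[OF T[OF t]] in auto)
      fix z assume z: "z \<in> topspace \<tau>" "r z < 1"
      then have "z \<in> W" using r(2) by auto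
      from WU[OF this t] show "exp (\<omega> * t) * q (T t z) \<le> 1"
        using expq[OF q t z(1)] by (simp add: U_def)
    qed
    then show "\<exists>r\<in>csn \<tau>. \<forall>t\<ge>0. \<forall>x\<in>topspace \<tau>. exp (\<omega> * t) * q (T t x) \<le> r x"
      using r(1) by blast
  qed
  show ?L if R: ?R
    unfolding equicontinuous_lc_def
  proof (intro allI impI)
    fix U assume U: "openin \<tau> U \<and> 0 \<in> U"
    then obtain q where q: "q \<in> csn \<tau>" "{y \<in> topspace \<tau>. q (y - 0) < 1} \<subseteq> U"
      using openin_csn_imp[OF \<tau>] by blast
    obtain r where r: "r \<in> csn \<tau>" "\<forall>t\<ge>0. \<forall>x\<in>topspace \<tau>. exp (\<omega> * t) * q (T t x) \<le> r x"
      using bspec[OF R q(1)] by (rule bexE)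
    define W where "W = {y \<in> topspace \<tau>. r (y - 0) < 1}"
    have "openin \<tau> W" "0 \<in> W"
      using csn_ball_open[OF r(1) subspace_0[OF V], of 1] subspace_0[OF V]
        seminorm_zero[OF csn_seminorm[OF r(1)] V] by (simp_all add: W_def)
    moreover have "scl (of_real (exp (\<omega> * t))) (T t x) \<in> U" if "t \<ge> 0" "x \<in> W" for t x
    proof -
      have x: "x \<in> topspace \<tau>" "r x < 1" using that by (simp_all add: W_def)
      then have "q (scl (of_real (exp (\<omega> * t))) (T t x)) < 1"
        using r(2)[rule_format, OF that(1) x(1)] expq[OF q(1) that(1) x(1)] by simp
      then show ?thesis using q(2) subspace_scale[OF V Tin[OF that(1) x(1)]] by auto
    qed
    ultimately show "\<exists>W. openin \<tau> W \<and> 0 \<in> W \<and>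
        (\<forall>f\<in>{\<lambda>x. scl (of_real (exp (\<omega> * t))) (T t x) | t. 0 \<le> t}. f ` W \<subseteq> U)"
      by (intro exI[of _ W]) auto
  qed
qed

lemma sc_exp_equicont_semigroup_iff:
  assumes "lc_space scl \<tau>"
  shows "sc_exp_equicont_semigroup scl \<tau> T \<longleftrightarrow> (\<exists>\<omega>. semigroup_exp \<tau> T \<omega>)"
proof (cases "\<forall>t\<ge>0. cont_operator scl \<tau> (T t)")
  case True
  then show ?thesis
    unfolding sc_exp_equicont_semigroup_def semigroup_exp_def
    using exp_equicontinuous_iff[OF assms, of T] by simp
next
  case False
  then show ?thesis unfolding sc_exp_equicont_semigroup_def semigroup_exp_def by blast
qed

text \<open>A continuous linear map that intertwines two orbits carries the derivative at 0 along.
  Used with scalar multiplication, with the operators of the semigroup, with inclusions of levels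
  and with the isomorphisms between levels.\<close>

lemma gen_limit_image:
  assumes f: "continuous_map \<sigma> \<rho> f" "linear_on_space scl (topspace \<sigma>) f"
    and V: "subspace (topspace \<sigma>)" and S: "\<And>t. t \<ge> 0 \<Longrightarrow> S t x \<in> topspace \<sigma>"
    and fS: "\<And>t. t \<ge> 0 \<Longrightarrow> f (S t x) = R t (f x)"
    and x: "x \<in> topspace \<sigma>" and lim: "gen_limit scl \<sigma> S x y"
  shows "gen_limit scl \<rho> R (f x) (f y)"
  unfolding gen_limit_def
proof (rule limitin_transform_eventually)
  show "limitin \<rho> (f \<circ> (\<lambda>t. scl (of_real (1 / t)) (S t x - x))) (f y) (at_right 0)"
    by (rule continuous_map_limit[OF f(1) lim[unfolded gen_limit_def]])
  have "\<forall>\<^sub>F t in at_right (0::real). t > 0" by (rule eventually_at_right_less)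
  then show "\<forall>\<^sub>F t in at_right 0. (f \<circ> (\<lambda>t. scl (of_real (1 / t)) (S t x - x))) t =
      scl (of_real (1 / t)) (R t (f x) - f x)"
  proof eventually_elim
    case (elim t)
    have "f (scl (of_real (1 / t)) (S t x - x)) = scl (of_real (1 / t)) (f (S t x - x))"
      by (rule linear_on_space_scale[OF f(2)]) (use elim S x subspace_diff[OF V] in simp)
    also have "f (S t x - x) = R t (f x) - f x"
      using linear_on_space_diff[OF f(2) V S x, of t] fS[of t] elim by simp
    finally show ?case by simp
  qed
qed

section \<open>Generators: uniqueness, linearity, commutation with the semigroup\<close>

lemma gen_limit_unique:
  assumes "Hausdorff_space \<tau>" "gen_limit scl \<tau> T x y" "gen_limit scl \<tau> T x z"
  shows "y = z"
  using limitin_Hausdorff_unique[OF assms(2,3)[unfolded gen_limit_def] _ assms(1)]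
  by (simp add: trivial_limit_at_right_real)

lemma gen_eqI:
  assumes "Hausdorff_space \<tau>" "gen_limit scl \<tau> T x y"
  shows "gen scl \<tau> T x = y"
  unfolding gen_def using gen_limit_unique[OF assms(1)] assms(2) by (intro the_equality)

lemma gen_domI: "x \<in> topspace \<tau> \<Longrightarrow> gen_limit scl \<tau> T x y \<Longrightarrow> x \<in> gen_dom scl \<tau> T"
  unfolding gen_dom_def by blast

lemma gen_dom_subset: "gen_dom scl \<tau> T \<subseteq> topspace \<tau>"
  unfolding gen_dom_def by blast

lemma gen_limit_gen:
  assumes "Hausdorff_space \<tau>" "x \<in> gen_dom scl \<tau> T"
  shows "gen_limit scl \<tau> T x (gen scl \<tau> T x)"
proof -
  obtain y where "gen_limit scl \<tau> T x y" using assms(2) unfolding gen_dom_def by blast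
  then show ?thesis using gen_eqI[OF assms(1)] by simp
qed

lemma gen_limit_add:
  assumes \<tau>: "lc_space scl \<tau>" and T: "semigroup_exp \<tau> T \<omega>" and xy: "x \<in> topspace \<tau>" "y \<in> topspace \<tau>"
    and lim: "gen_limit scl \<tau> T x u" "gen_limit scl \<tau> T y v"
  shows "gen_limit scl \<tau> T (x + y) (u + v)"
  unfolding gen_limit_def
proof (rule limitin_transform_eventually)
  show "limitin \<tau> (\<lambda>t. scl (of_real (1 / t)) (T t x - x) + scl (of_real (1 / t)) (T t y - y)) (u + v)
      (at_right 0)"
    using limitin_add_lc[OF \<tau> lim[unfolded gen_limit_def]] .
  have "\<forall>\<^sub>F t in at_right (0::real). t > 0" by (rule eventually_at_right_less)
  then show "\<forall>\<^sub>F t in at_right 0. scl (of_real (1 / t)) (T t x - x) + scl (of_real (1 / t)) (T t y - y) =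
      scl (of_real (1 / t)) (T t (x + y) - (x + y))"
  proof eventually_elim
    case (elim t)
    have "T t (x + y) = T t x + T t y"
      using linear_on_space_add[OF semigroup_expD(1)[OF T] xy] elim by simp
    then show ?case by (simp add: algebra_simps flip: scale_right_distrib)
  qed
qed

lemma gen_limit_scl:
  assumes \<tau>: "lc_space scl \<tau>" and T: "semigroup_exp \<tau> T \<omega>" and x: "x \<in> topspace \<tau>"
    and lim: "gen_limit scl \<tau> T x u"
  shows "gen_limit scl \<tau> T (scl c x) (scl c u)"
proof (rule gen_limit_image[OF continuous_map_scl[OF \<tau>] _ lc_subspace[OF \<tau>] _ _ x lim])
  show "linear_on_space scl (topspace \<tau>) (scl c)"
    by (rule linear_on_spaceI) (simp_all add: scale_right_distrib scale_left_commute)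
  show "t \<ge> 0 \<Longrightarrow> T t x \<in> topspace \<tau>" for t using semigroup_expD(3)[OF T _ x] .
  show "t \<ge> 0 \<Longrightarrow> scl c (T t x) = T t (scl c x)" for t
    using linear_on_space_scale[OF semigroup_expD(1)[OF T] x] by simp
qed

lemma gen_limit_semigroup:
  assumes \<tau>: "lc_space scl \<tau>" and T: "semigroup_exp \<tau> T \<omega>" and x: "x \<in> topspace \<tau>"
    and lim: "gen_limit scl \<tau> T x u" and s: "s \<ge> 0"
  shows "gen_limit scl \<tau> T (T s x) (T s u)"
proof (rule gen_limit_image[OF semigroup_expD(2)[OF T s] semigroup_expD(1)[OF T s] lc_subspace[OF \<tau>] _ _ x lim])
  show "t \<ge> 0 \<Longrightarrow> T t x \<in> topspace \<tau>" for t using semigroup_expD(3)[OF T _ x] .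
  show "t \<ge> 0 \<Longrightarrow> T s (T t x) = T t (T s x)" for t
    using semigroup_expD(4)[OF T s, of t x] semigroup_expD(4)[OF T, of t s x] s x
    by (simp add: add.commute)
qed

lemma gen_dom_subspace:
  assumes \<tau>: "lc_space scl \<tau>" and T: "semigroup_exp \<tau> T \<omega>" and H: "Hausdorff_space \<tau>"
  shows "subspace (gen_dom scl \<tau> T)" "linear_on_space scl (gen_dom scl \<tau> T) (gen scl \<tau> T)"
proof -
  note V = lc_subspace[OF \<tau>]
  have D: "x \<in> topspace \<tau>" "gen_limit scl \<tau> T x (gen scl \<tau> T x)" if "x \<in> gen_dom scl \<tau> T" for x
    using that gen_limit_gen[OF H that] by (auto simp: gen_dom_def)
  have add: "gen_limit scl \<tau> T (x + y) (gen scl \<tau> T x + gen scl \<tau> T y)"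
    if "x \<in> gen_dom scl \<tau> T" "y \<in> gen_dom scl \<tau> T" for x y
    using gen_limit_add[OF \<tau> T D(1)[OF that(1)] D(1)[OF that(2)] D(2)[OF that(1)] D(2)[OF that(2)]] .
  have scale: "gen_limit scl \<tau> T (scl c x) (scl c (gen scl \<tau> T x))"
    if "x \<in> gen_dom scl \<tau> T" for c x
    using gen_limit_scl[OF \<tau> T D[OF that]] .
  show "linear_on_space scl (gen_dom scl \<tau> T) (gen scl \<tau> T)"
    by (rule linear_on_spaceI) (simp_all add: gen_eqI[OF H add] gen_eqI[OF H scale])
  show "subspace (gen_dom scl \<tau> T)"
  proof (rule subspaceI)
    show "0 \<in> gen_dom scl \<tau> T"
    proof (rule gen_domI[OF subspace_0[OF V]])
      have "\<forall>\<^sub>F t in at_right (0::real). t > 0" by (rule eventually_at_right_less)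
      then have "\<forall>\<^sub>F t in at_right (0::real). 0 = scl (of_real (1 / t)) (T t 0 - 0)"
      proof eventually_elim
        case (elim t)
        have "T t (0 - 0) = T t 0 - T t 0"
          by (rule linear_on_space_diff[OF semigroup_expD(1)[OF T] V]) (use elim subspace_0[OF V] in auto)
        then show ?case by simp
      qed
      then show "gen_limit scl \<tau> T 0 0" unfolding gen_limit_def
        by (rule limitin_transform_eventually) (simp add: subspace_0[OF V])
    qed
  next
    fix x y assume xy: "x \<in> gen_dom scl \<tau> T" "y \<in> gen_dom scl \<tau> T"
    show "x + y \<in> gen_dom scl \<tau> T"
      using gen_domI[OF subspace_add[OF V D(1)[OF xy(1)] D(1)[OF xy(2)]] add[OF xy]] .
  next
    fix c x assume x: "x \<in> gen_dom scl \<tau> T"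
    show "scl c x \<in> gen_dom scl \<tau> T"
      using gen_domI[OF subspace_scale[OF V D(1)[OF x]] scale[OF x]] .
  qed
qed

text \<open>The part of the hypotheses on level 0 that is invariant under similarity, with the
  exponent made explicit.\<close>

definition invertible_level :: "'a topology \<Rightarrow> (real \<Rightarrow> 'a \<Rightarrow> 'a) \<Rightarrow> real \<Rightarrow> bool"
  where "invertible_level \<tau> T \<omega> \<longleftrightarrow> lc_space scl \<tau> \<and> Hausdorff_space \<tau> \<and> complete_lc \<tau> \<and>
    semigroup_exp \<tau> T \<omega> \<and> bij_betw (gen scl \<tau> T) (gen_dom scl \<tau> T) (topspace \<tau>) \<and>
    continuous_map \<tau> \<tau> (gen_inv scl \<tau> T)"

lemma invertible_levelD:
  assumes "invertible_level \<tau> T \<omega>"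
  shows "lc_space scl \<tau>" "Hausdorff_space \<tau>" "complete_lc \<tau>" "semigroup_exp \<tau> T \<omega>"
    "continuous_map \<tau> \<tau> (gen_inv scl \<tau> T)"
    and "y \<in> topspace \<tau> \<Longrightarrow> gen_inv scl \<tau> T y \<in> gen_dom scl \<tau> T"
    and "y \<in> topspace \<tau> \<Longrightarrow> gen scl \<tau> T (gen_inv scl \<tau> T y) = y"
    and "x \<in> gen_dom scl \<tau> T \<Longrightarrow> gen_inv scl \<tau> T (gen scl \<tau> T x) = x"
    and "x \<in> gen_dom scl \<tau> T \<Longrightarrow> gen scl \<tau> T x \<in> topspace \<tau>"
proof -
  have b: "bij_betw (gen scl \<tau> T) (gen_dom scl \<tau> T) (topspace \<tau>)"
    using assms by (simp add: invertible_level_def)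
  show "y \<in> topspace \<tau> \<Longrightarrow> gen_inv scl \<tau> T y \<in> gen_dom scl \<tau> T"
    unfolding gen_inv_def using bij_betwE[OF bij_betw_the_inv_into[OF b]] by blast
  show "y \<in> topspace \<tau> \<Longrightarrow> gen scl \<tau> T (gen_inv scl \<tau> T y) = y"
    unfolding gen_inv_def using f_the_inv_into_f_bij_betw[OF b] by blast
  show "x \<in> gen_dom scl \<tau> T \<Longrightarrow> gen_inv scl \<tau> T (gen scl \<tau> T x) = x"
    unfolding gen_inv_def by (rule the_inv_into_f_f[OF bij_betw_imp_inj_on[OF b]])
  show "x \<in> gen_dom scl \<tau> T \<Longrightarrow> gen scl \<tau> T x \<in> topspace \<tau>" using bij_betwE[OF b] by blast
qed (use assms in \<open>simp_all add: invertible_level_def\<close>)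

lemma gen_inv_linear:
  assumes L: "invertible_level \<tau> T \<omega>"
  shows "linear_on_space scl (topspace \<tau>) (gen_inv scl \<tau> T)"
  using linear_on_space_inverse[OF gen_dom_subspace(2,1)[OF invertible_levelD(1,4,2)[OF L]],
      of "topspace \<tau>" "gen_inv scl \<tau> T"] invertible_levelD(6-8)[OF L] by blast

text \<open>This makes restricting the semigroup to the domain of its generator the same as
  conjugating it by the generator.\<close>

lemma gen_inv_semigroup:
  assumes L: "invertible_level \<tau> T \<omega>" and t: "t \<ge> 0" and x: "x \<in> topspace \<tau>"
  shows "gen_inv scl \<tau> T (T t x) = T t (gen_inv scl \<tau> T x)"
proof -
  note LD = invertible_levelD[OF L]
  define y where "y = gen_inv scl \<tau> T x"
  have y: "y \<in> gen_dom scl \<tau> T" "y \<in> topspace \<tau>" "gen scl \<tau> T y = x"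
    using LD(6,7)[OF x] gen_dom_subset by (auto simp: y_def)
  have "gen_limit scl \<tau> T (T t y) (T t x)"
    using gen_limit_semigroup[OF LD(1,4) y(2) gen_limit_gen[OF LD(2) y(1)] t] y(3) by simp
  then have "T t y \<in> gen_dom scl \<tau> T" "gen scl \<tau> T (T t y) = T t x"
    using gen_domI[OF semigroup_expD(3)[OF LD(4) t y(2)]] gen_eqI[OF LD(2)] by auto
  then show ?thesis using LD(8)[of "T t y"] by (simp add: y_def)
qed

text \<open>Every \<open>x\<close> is the limit of the difference quotients of \<open>A\<^sup>-\<^sup>1 x\<close>, which lie in the domain;
  this makes the usual integral means \<open>1/t \<integral> T(s) x ds\<close> unnecessary.\<close>

lemma gen_dom_dense:
  assumes L: "invertible_level \<tau> T \<omega>"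
  shows "\<tau> closure_of gen_dom scl \<tau> T = topspace \<tau>"
proof (rule dense_csnI)
  note LD = invertible_levelD[OF L]
  show "lc_space scl \<tau>" by (rule LD)
  fix x q assume x: "x \<in> topspace \<tau>" and q: "q \<in> csn \<tau>"
  define y where "y = gen_inv scl \<tau> T x"
  have y: "y \<in> gen_dom scl \<tau> T" "y \<in> topspace \<tau>" "gen scl \<tau> T y = x"
    using LD(6,7)[OF x] gen_dom_subset by (auto simp: y_def)
  have lim: "gen_limit scl \<tau> T y x" using gen_limit_gen[OF LD(2) y(1)] y(3) by simp
  have "\<forall>\<^sub>F t in at_right (0::real). t > 0" by (rule eventually_at_right_less)
  moreover have "\<forall>\<^sub>F t in at_right 0. scl (of_real (1 / t)) (T t y - y) \<in> topspace \<tau> \<and>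
      q (scl (of_real (1 / t)) (T t y - y) - x) < 1"
    using limitin_csnD[OF lim[unfolded gen_limit_def] q] by simp
  ultimately have "\<forall>\<^sub>F t in at_right 0. t > 0 \<and> scl (of_real (1 / t)) (T t y - y) \<in> topspace \<tau> \<and>
      q (scl (of_real (1 / t)) (T t y - y) - x) < 1"
    by eventually_elim simp
  then obtain t where t: "t > 0" "scl (of_real (1 / t)) (T t y - y) \<in> topspace \<tau>"
      "q (scl (of_real (1 / t)) (T t y - y) - x) < 1"
    using eventually_happens[of _ "at_right (0::real)"] by (auto simp: trivial_limit_at_right_real)
  have "T t y \<in> gen_dom scl \<tau> T"
    using gen_domI[OF semigroup_expD(3)[OF LD(4) _ y(2)] gen_limit_semigroup[OF LD(1,4) y(2) lim]] t(1)
    by simp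
  then have "scl (of_real (1 / t)) (T t y - y) \<in> gen_dom scl \<tau> T"
    using gen_dom_subspace(1)[OF LD(1,4,2)] y(1) by (simp add: subspace_diff subspace_scale)
  then show "\<exists>y\<in>gen_dom scl \<tau> T. y \<in> topspace \<tau> \<and> q (y - x) < 1" using t by blast
qed

section \<open>Bounds on compact time intervals and difference quotients\<close>

lemma semigroup_local_bound:
  assumes T: "semigroup_exp \<tau> T \<omega>" and q: "q \<in> csn \<tau>"
  shows "\<exists>r\<in>csn \<tau>. \<forall>t\<in>{0..a}. \<forall>x\<in>topspace \<tau>. q (T t x) \<le> r x"
proof -
  have "\<forall>q\<in>csn \<tau>. \<exists>r\<in>csn \<tau>. \<forall>t\<ge>0. \<forall>x\<in>topspace \<tau>. exp (\<omega> * t) * q (T t x) \<le> r x"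
    using T by (simp add: semigroup_exp_def)
  from bspec[OF this q] obtain r where r: "r \<in> csn \<tau>"
    "\<forall>t\<ge>0. \<forall>x\<in>topspace \<tau>. exp (\<omega> * t) * q (T t x) \<le> r x"
    by (rule bexE)
  have "q (T t x) \<le> exp (\<bar>\<omega>\<bar> * a) * r x" if "t \<in> {0..a}" "x \<in> topspace \<tau>" for t x
    by (rule exp_weight_le[of \<omega> t])
      (use that r(2) seminorm_nonneg[OF csn_seminorm[OF r(1)]] in auto)
  then show ?thesis by (intro bexI[OF _ csn_mult[OF r(1), of "exp (\<bar>\<omega>\<bar> * a)"]]) auto
qed

text \<open>Telescoping over \<open>N\<close> equal steps replaces the integral \<open>T(t)x - x = \<integral> T(s) A x ds\<close>.\<close>

lemma semigroup_diff_le_gen: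
  assumes \<tau>: "lc_space scl \<tau>" and T: "semigroup_exp \<tau> T \<omega>" and q: "q \<in> csn \<tau>" and r: "r \<in> csn \<tau>"
    and bd: "\<And>t x. 0 \<le> t \<Longrightarrow> t \<le> 1 \<Longrightarrow> x \<in> topspace \<tau> \<Longrightarrow> q (T t x) \<le> r x"
    and x: "x \<in> topspace \<tau>" and lim: "gen_limit scl \<tau> T x y" and t: "0 < t" "t \<le> 1"
  shows "q (T t x - x) \<le> t * r y"
proof (rule field_le_epsilon)
  note V = lc_subspace[OF \<tau>]
  have y: "y \<in> topspace \<tau>" using limitin_topspace[OF lim[unfolded gen_limit_def]] .
  fix e :: real assume e: "e > 0"
  have "\<forall>\<^sub>F h in at_right 0. scl (of_real (1 / h)) (T h x - x) \<in> topspace \<tau> \<and>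
      r (scl (of_real (1 / h)) (T h x - x) - y) < e"
    by (rule limitin_csnD[OF lim[unfolded gen_limit_def] r e])
  then obtain b where b: "b > 0" "\<forall>h>0. h < b \<longrightarrow> scl (of_real (1 / h)) (T h x - x) \<in> topspace \<tau> \<and>
      r (scl (of_real (1 / h)) (T h x - x) - y) < e"
    unfolding eventually_at_right_field by blast
  \<comment> \<open>Enough steps to push the step length \<open>t / n\<close> below
    \<open>b\<close>, where the difference quotient is already \<open>e\<close>-close to
    \<open>y\<close>.\<close>
  obtain n where n: "t / b < real n" using reals_Archimedean2 by blast
  then have n0: "n > 0" using t b by (metis divide_pos_pos gr0I less_trans not_less_iff_gr_or_eq of_nat_0)
  define h where "h = t / real n"
  have h: "h > 0" "h < b" "real n * h = t"
    using n n0 t b(1) by (simp_all add: h_def field_simps)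
  define z where "z = T h x - x"
  have Tx: "T s x \<in> topspace \<tau>" if "s \<ge> 0" for s using semigroup_expD(3)[OF T that x] .
  have z: "z \<in> topspace \<tau>" using Tx[of h] x h by (simp add: z_def subspace_diff[OF V])
  have "T t x - x = (\<Sum>k<n. T (real (Suc k) * h) x - T (real k * h) x)"
    using sum_lessThan_telescope[of "\<lambda>k. T (real k * h) x" n] semigroup_expD(5)[OF T _ x] h
    by (metis mult_zero_left of_nat_0 order_refl)
  also have "\<dots> = (\<Sum>k<n. T (real k * h) z)"
  proof (rule sum.cong)
    fix k
    have kh: "real k * h \<ge> 0" using h by simp
    have "T (real (Suc k) * h) x = T (real k * h + h) x" by (simp add: algebra_simps)
    also have "\<dots> = T (real k * h) (T h x)" using semigroup_expD(4)[OF T kh _ x] h by simp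
    finally show "T (real (Suc k) * h) x - T (real k * h) x = T (real k * h) z"
      using linear_on_space_diff[OF semigroup_expD(1)[OF T kh] V Tx x, of h] h by (simp add: z_def)
  qed simp
  finally have "q (T t x - x) = q (\<Sum>k<n. T (real k * h) z)" by simp
  also have "\<dots> \<le> (\<Sum>k<n. q (T (real k * h) z))"
    by (rule seminorm_sum[OF csn_seminorm[OF q] V]) (use semigroup_expD(3)[OF T _ z] h in simp)
  also have "\<dots> \<le> (\<Sum>k<n. r z)"
  proof (rule sum_mono)
    fix k assume "k \<in> {..<n}"
    then have "real k * h \<le> real n * h" using h by (intro mult_right_mono) auto
    then show "q (T (real k * h) z) \<le> r z" using h t z by (intro bd) auto
  qed
  also have "\<dots> = real n * r z" by simp
  also have "r z = h * r (scl (of_real (1 / h)) z)"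
    using seminorm_scale[OF csn_seminorm[OF r] z, of "of_real (1 / h)"] h by (simp add: norm_divide)
  also have "real n * (h * r (scl (of_real (1 / h)) z)) = t * r (scl (of_real (1 / h)) z)"
    using h by (simp flip: mult.assoc)
  also have "r (scl (of_real (1 / h)) z) \<le> r (scl (of_real (1 / h)) z - y) + r y"
    by (rule seminorm_diff_le[OF csn_seminorm[OF r] V]) (use b h y in \<open>auto simp: z_def\<close>)
  also have "\<dots> \<le> e + r y" using b h by (force simp: z_def)
  finally have "q (T t x - x) \<le> t * (e + r y)" using t by simp
  \<comment> \<open>The error \<open>t * e\<close> is at most \<open>e\<close> because
    \<open>t \<le> 1\<close>.\<close>
  also have "\<dots> \<le> t * r y + e" using t e by (simp add: distrib_left)
  finally show "q (T t x - x) \<le> t * r y + e" .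
qed

text \<open>The Lipschitz bound \<open>Lip\<close> makes the difference quotients equicontinuous: at
  \<open>x - y\<close> they are at most \<open>r (A (x - y))\<close>, whatever the time. Pointwise
  convergence on a dense set then spreads to the whole space, with continuity of \<open>A\<close>
  identifying the limit.\<close>

lemma gen_limit_from_dense:
  assumes \<tau>: "lc_space scl \<tau>" and T: "semigroup_exp \<tau> T \<omega>"
    and D: "\<tau> closure_of D = topspace \<tau>" and A: "cont_operator scl \<tau> A"
    and lim: "\<And>x. x \<in> D \<Longrightarrow> x \<in> topspace \<tau> \<Longrightarrow> gen_limit scl \<tau> T x (A x)" and x: "x \<in> topspace \<tau>"
  shows "gen_limit scl \<tau> T x (A x)"
  unfolding gen_limit_def
proof (rule limitin_lcI[OF \<tau>])
  note V = lc_subspace[OF \<tau>] and Alin = cont_operatorD(1)[OF A] and Acont = cont_operatorD(2)[OF A]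
  note Ain = continuous_map_in[OF Acont]
  have pos: "\<forall>\<^sub>F t in at_right (0::real). t > 0 \<and> t \<le> 1"
    unfolding eventually_at_right_field by (intro exI[of _ 1]) auto
  have Tin: "T t y \<in> topspace \<tau>" if "t \<ge> 0" "y \<in> topspace \<tau>" for t y
    using semigroup_expD(3)[OF T that] .
  have quot: "scl (of_real (1 / t)) (T t y - y) \<in> topspace \<tau>" if "t \<ge> 0" "y \<in> topspace \<tau>" for t y
    using Tin[OF that] that by (simp add: subspace_scale[OF V] subspace_diff[OF V])
  show "A x \<in> topspace \<tau>" using Ain[OF x] .
  show "\<forall>\<^sub>F t in at_right 0. scl (of_real (1 / t)) (T t x - x) \<in> topspace \<tau>"
    using pos by eventually_elim (use quot x in auto)
  fix q assume q: "q \<in> csn \<tau>"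
  note sq = csn_seminorm[OF q]
  from semigroup_local_bound[OF T q, of 1]
  obtain r where r: "r \<in> csn \<tau>" and rbd: "\<forall>t\<in>{0..1}. \<forall>x\<in>topspace \<tau>. q (T t x) \<le> r x"
    by (rule bexE)
  have rA: "(\<lambda>x. r (A x)) \<in> csn \<tau>" and qA: "(\<lambda>x. q (A x)) \<in> csn \<tau>"
    using csn_pullback[OF V Acont Alin] r q by auto
  have Lip: "q (T t z - z) \<le> t * r (A z)" if z: "z \<in> topspace \<tau>" and t: "0 < t" "t \<le> 1" for t z
  proof (rule field_le_epsilon)
    fix e :: real assume e: "e > 0"
    \<comment> \<open>One seminorm controls the three errors of replacing \<open>z\<close> by
      \<open>y\<close>: in the generator term, in \<open>T t z - T t y\<close> and in
      \<open>y - z\<close>.\<close>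
    define m where "m = (\<lambda>x. max (r (A x)) (max (r x) (q x)))"
    have "m \<in> csn \<tau>" unfolding m_def by (intro csn_max rA r q)
    then obtain y where y: "y \<in> D" "y \<in> topspace \<tau>" "m (y - z) < e / 3"
      using dense_csn_approx[OF V D z, of m "e / 3"] e by auto
    note yz = subspace_diff[OF V y(2) z] and t0 = less_imp_le[OF t(1)]
    have "q (T t z - z) \<le> q (T t z - T t y) + q (T t y - z)"
      by (rule seminorm_triangle[OF sq V]) (use z y t Tin in auto)
    also have "q (T t y - z) \<le> q (T t y - y) + q (y - z)"
      by (rule seminorm_triangle[OF sq V]) (use z y t Tin in auto)
    also have "q (T t z - T t y) = q (T t y - T t z)"
      by (rule seminorm_diff_commute[OF sq V]) (use z y t Tin in auto)
    also have "T t y - T t z = T t (y - z)"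
      using linear_on_space_diff[OF semigroup_expD(1)[OF T t0] V y(2) z] by simp
    also have "q (T t (y - z)) \<le> r (y - z)" using rbd yz t by simp
    also have "q (T t y - y) \<le> t * r (A y)"
      by (rule semigroup_diff_le_gen[OF \<tau> T q r _ y(2) lim[OF y(1,2)] t]) (use rbd in auto)
    also have "r (A y) \<le> r (A y - A z) + r (A z)"
      by (rule seminorm_diff_le[OF csn_seminorm[OF r] V Ain[OF y(2)] Ain[OF z]])
    also have "A y - A z = A (y - z)" using linear_on_space_diff[OF Alin V y(2) z] by simp
    finally have "q (T t z - z) \<le> r (y - z) + (t * (r (A (y - z)) + r (A z)) + q (y - z))"
      using t by simp
    moreover have "t * r (A (y - z)) \<le> 1 * r (A (y - z))"
      using t seminorm_nonneg[OF csn_seminorm[OF r] Ain[OF yz]] by (intro mult_right_mono) auto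
    ultimately show "q (T t z - z) \<le> t * r (A z) + e"
      using y(3) by (simp add: m_def distrib_left)
  qed
  \<comment> \<open>Here \<open>r\<close> after \<open>A\<close> bounds the difference quotient at
    \<open>x - y\<close>, and \<open>q\<close> after \<open>A\<close> bounds
    \<open>A y - A x\<close>. Together with convergence at \<open>y\<close> three quarters add up to
    less than 1.\<close>
  define m where "m = (\<lambda>x. max (r (A x)) (q (A x)))"
  have "m \<in> csn \<tau>" unfolding m_def by (intro csn_max rA qA)
  then obtain y where y: "y \<in> D" "y \<in> topspace \<tau>" "m (y - x) < 1 / 4"
    using dense_csn_approx[OF V D x, of m "1 / 4"] by auto
  note xy = subspace_diff[OF V x y(2)] and yx = subspace_diff[OF V y(2) x]
  have "\<forall>\<^sub>F t in at_right 0. scl (of_real (1 / t)) (T t y - y) \<in> topspace \<tau> \<and>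
      q (scl (of_real (1 / t)) (T t y - y) - A y) < 1 / 4"
    by (rule limitin_csnD[OF lim[OF y(1,2), unfolded gen_limit_def] q]) simp
  with pos show "\<forall>\<^sub>F t in at_right 0. q (scl (of_real (1 / t)) (T t x - x) - A x) < 1"
  proof eventually_elim
    case (elim t)
    then have t: "0 < t" "t \<le> 1" "0 \<le> t" by auto
    note Qx = quot[OF t(3) x] and Qy = quot[OF t(3) y(2)]
    have "q (scl (of_real (1 / t)) (T t x - x) - A x) \<le>
        q (scl (of_real (1 / t)) (T t x - x) - scl (of_real (1 / t)) (T t y - y)) +
        q (scl (of_real (1 / t)) (T t y - y) - A x)"
      by (rule seminorm_triangle[OF sq V Qx Qy Ain[OF x]])
    also have "q (scl (of_real (1 / t)) (T t y - y) - A x) \<le>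
        q (scl (of_real (1 / t)) (T t y - y) - A y) + q (A y - A x)"
      by (rule seminorm_triangle[OF sq V Qy Ain[OF y(2)] Ain[OF x]])
    also have "q (A y - A x) < 1 / 4"
      using y(3) linear_on_space_diff[OF Alin V y(2) x] by (simp add: m_def)
    also have "q (scl (of_real (1 / t)) (T t y - y) - A y) < 1 / 4" using elim by simp
    also have "scl (of_real (1 / t)) (T t x - x) - scl (of_real (1 / t)) (T t y - y) =
        scl (of_real (1 / t)) (T t (x - y) - (x - y))"
      using linear_on_space_diff[OF semigroup_expD(1)[OF T t(3)] V x y(2)]
      by (simp add: algebra_simps flip: scale_right_diff_distrib)
    also have "q \<dots> = (1 / t) * q (T t (x - y) - (x - y))"
      using seminorm_scale[OF sq subspace_diff[OF V Tin[OF t(3) xy] xy], of "of_real (1 / t)"] t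
      by (simp add: norm_divide)
    also have "\<dots> \<le> (1 / t) * (t * r (A (x - y)))"
      using Lip[OF xy t(1,2)] t by (intro mult_left_mono) auto
    also have "\<dots> = r (A (x - y))" using t by simp
    also have "\<dots> = r (A (y - x))"
      using seminorm_diff_commute[OF csn_seminorm[OF rA] V x y(2)] .
    also have "\<dots> < 1 / 4" using y(3) by (simp add: m_def)
    finally show ?case by simp
  qed
qed

text \<open>Serves both directions of the tower: upwards \<open>f\<close> is the generator,
  downwards \<open>f\<close> is the extension of its inverse. The exponent survives because a bound
  \<open>r\<close> for \<open>q\<close> after \<open>g\<close> on \<open>\<rho>\<close> becomes the
  bound \<open>r\<close> after \<open>f\<close> for \<open>q\<close> on \<open>\<sigma>\<close>,
  with the weight in time unchanged.\<close>

lemma invertible_level_transport: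
  assumes L: "invertible_level \<rho> R \<omega>" and \<sigma>: "lc_space scl \<sigma>"
    and f: "continuous_map \<sigma> \<rho> f" "linear_on_space scl (topspace \<sigma>) f"
    and g: "continuous_map \<rho> \<sigma> g"
    and gf: "\<And>x. x \<in> topspace \<sigma> \<Longrightarrow> g (f x) = x" and fg: "\<And>x. x \<in> topspace \<rho> \<Longrightarrow> f (g x) = x"
    and S: "\<And>t x. t \<ge> 0 \<Longrightarrow> x \<in> topspace \<sigma> \<Longrightarrow> S t x = g (R t (f x))"
  shows "invertible_level \<sigma> S \<omega>"
    and "x \<in> gen_dom scl \<sigma> S \<longleftrightarrow> x \<in> topspace \<sigma> \<and> f x \<in> gen_dom scl \<rho> R"
    and "x \<in> gen_dom scl \<sigma> S \<Longrightarrow> gen scl \<sigma> S x = g (gen scl \<rho> R (f x))"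
    and "x \<in> topspace \<sigma> \<Longrightarrow> gen_inv scl \<sigma> S x = g (gen_inv scl \<rho> R (f x))"
proof -
  note LD = invertible_levelD[OF L]
  note V = lc_subspace[OF \<sigma>] and W = lc_subspace[OF LD(1)]
  note fin = continuous_map_in[OF f(1)] and gin = continuous_map_in[OF g]
  have glin: "linear_on_space scl (topspace \<rho>) g"
    by (rule linear_on_space_inverse[OF f(2) V _ gf]) (use gin fg in auto)
  note RD = semigroup_expD[OF LD(4)]
  have Sin: "S t x \<in> topspace \<sigma>" if "t \<ge> 0" "x \<in> topspace \<sigma>" for t x
    using S[OF that] gin[OF RD(3)[OF that(1) fin[OF that(2)]]] by simp
  have H: "Hausdorff_space \<sigma>"
    by (rule Hausdorff_space_injective_preimage[OF LD(2) f(1) inj_on_inverseI]) (rule gf)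
  have SG: "semigroup_exp \<sigma> S \<omega>"
    unfolding semigroup_exp_def
  proof (intro conjI allI impI ballI)
    fix t :: real assume t: "t \<ge> 0"
    have "linear_on_space scl (topspace \<sigma>) (\<lambda>x. g (R t (f x)))"
      by (rule linear_on_space_compose[OF linear_on_space_compose[OF f(2) RD(1)[OF t]] glin])
        (use fin RD(3)[OF t] in auto)
    then have "linear_on_space scl (topspace \<sigma>) (S t)"
      unfolding linear_on_space_def using S[OF t] subspace_add[OF V] subspace_scale[OF V] by simp
    moreover have "continuous_map \<sigma> \<sigma> (g \<circ> (R t \<circ> f))"
      by (intro continuous_map_compose[OF _ g] continuous_map_compose[OF f(1)] RD(2)[OF t])
    then have "continuous_map \<sigma> \<sigma> (S t)"
      by (rule continuous_map_eq) (simp add: S[OF t])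
    ultimately show "cont_operator scl \<sigma> (S t)" by (simp add: cont_operator_def)
    fix s x assume s: "(s::real) \<ge> 0" and x: "x \<in> topspace \<sigma>"
    show "S (t + s) x = S t (S s x)"
      using S[of "t + s" x] S[OF t Sin[OF s x]] S[OF s x] RD(4)[OF t s fin[OF x]]
        fg[OF RD(3)[OF s fin[OF x]]] t s x by simp
  next
    fix x assume x: "x \<in> topspace \<sigma>"
    show "S 0 x = x" using S[of 0 x] RD(5)[OF order_refl fin[OF x]] gf[OF x] x by simp
    have "continuous_map (top_of_set {0..}) \<rho> (\<lambda>t. R t (f x))"
      using LD(4) fin[OF x] by (simp add: semigroup_exp_def)
    from continuous_map_compose[OF this g]
    show "continuous_map (top_of_set {0..}) \<sigma> (\<lambda>t. S t x)"
      by (rule continuous_map_eq) (use S x in simp)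
  next
    fix q assume q: "q \<in> csn \<sigma>"
    have "\<forall>q\<in>csn \<rho>. \<exists>r\<in>csn \<rho>. \<forall>t\<ge>0. \<forall>x\<in>topspace \<rho>. exp (\<omega> * t) * q (R t x) \<le> r x"
      using LD(4) by (simp add: semigroup_exp_def)
    from bspec[OF this csn_pullback[OF W g glin q]]
    obtain r where r: "r \<in> csn \<rho>" "\<forall>t\<ge>0. \<forall>x\<in>topspace \<rho>. exp (\<omega> * t) * q (g (R t x)) \<le> r x"
      by (rule bexE)
    then show "\<exists>r\<in>csn \<sigma>. \<forall>t\<ge>0. \<forall>x\<in>topspace \<sigma>. exp (\<omega> * t) * q (S t x) \<le> r x"
      using S fin by (intro bexI[OF _ csn_pullback[OF V f r(1)]]) simp
  qed
  have lim_f: "gen_limit scl \<rho> R (f x) (f y)" if "x \<in> topspace \<sigma>" "gen_limit scl \<sigma> S x y" for x y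
    by (rule gen_limit_image[OF f V Sin _ that])
      (use that S fg RD(3) fin in auto)
  have lim_g: "gen_limit scl \<sigma> S (g x) (g y)" if "x \<in> topspace \<rho>" "gen_limit scl \<rho> R x y" for x y
    by (rule gen_limit_image[OF g glin W RD(3) _ that])
      (use that S fg gin in auto)
  have dom: "x \<in> gen_dom scl \<sigma> S \<longleftrightarrow> x \<in> topspace \<sigma> \<and> f x \<in> gen_dom scl \<rho> R" for x
  proof
    assume x: "x \<in> gen_dom scl \<sigma> S"
    then have x': "x \<in> topspace \<sigma>" using gen_dom_subset by blast
    from gen_domI[OF fin[OF x'] lim_f[OF x' gen_limit_gen[OF H x]]] x'
    show "x \<in> topspace \<sigma> \<and> f x \<in> gen_dom scl \<rho> R" by simp
  next
    assume x: "x \<in> topspace \<sigma> \<and> f x \<in> gen_dom scl \<rho> R"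
    have "gen_limit scl \<sigma> S (g (f x)) (g (gen scl \<rho> R (f x)))"
      by (rule lim_g[OF fin gen_limit_gen[OF LD(2)]]) (use x in auto)
    then show "x \<in> gen_dom scl \<sigma> S" using x gf gen_domI[of x \<sigma> S] by simp
  qed
  have gen: "gen scl \<sigma> S x = g (gen scl \<rho> R (f x))" if "x \<in> gen_dom scl \<sigma> S" for x
  proof -
    have x: "x \<in> topspace \<sigma>" "f x \<in> gen_dom scl \<rho> R" using that dom by auto
    then have "gen_limit scl \<sigma> S (g (f x)) (g (gen scl \<rho> R (f x)))"
      using lim_g[OF fin gen_limit_gen[OF LD(2)]] by simp
    then show ?thesis using gen_eqI[OF H] gf[OF x(1)] by simp
  qed
  have inv: "g (gen_inv scl \<rho> R (f x)) \<in> gen_dom scl \<sigma> S"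
    "gen scl \<sigma> S (g (gen_inv scl \<rho> R (f x))) = x" if "x \<in> topspace \<sigma>" for x
  proof -
    have 1: "gen_inv scl \<rho> R (f x) \<in> gen_dom scl \<rho> R" using LD(6)[OF fin[OF that]] .
    then have 2: "gen_inv scl \<rho> R (f x) \<in> topspace \<rho>" using gen_dom_subset by blast
    show 3: "g (gen_inv scl \<rho> R (f x)) \<in> gen_dom scl \<sigma> S" using dom gin[OF 2] fg[OF 2] 1 by simp
    show "gen scl \<sigma> S (g (gen_inv scl \<rho> R (f x))) = x"
      using gen[OF 3] fg[OF 2] LD(7)[OF fin[OF that]] gf[OF that] by simp
  qed
  have inj: "inj_on (gen scl \<sigma> S) (gen_dom scl \<sigma> S)"
  proof (rule inj_on_inverseI)
    fix x assume x: "x \<in> gen_dom scl \<sigma> S"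
    then have x': "x \<in> topspace \<sigma>" "f x \<in> gen_dom scl \<rho> R" using dom by auto
    show "g (gen_inv scl \<rho> R (f (gen scl \<sigma> S x))) = x"
      using gen[OF x] fg[OF LD(9)[OF x'(2)]] LD(8)[OF x'(2)] gf[OF x'(1)] by simp
  qed
  have img: "gen scl \<sigma> S x \<in> topspace \<sigma>" if "x \<in> gen_dom scl \<sigma> S" for x
    using gen[OF that] gin LD(9) dom that by simp
  have bij: "bij_betw (gen scl \<sigma> S) (gen_dom scl \<sigma> S) (topspace \<sigma>)"
    unfolding bij_betw_def
  proof (intro conjI inj equalityI subsetI)
    fix x assume "x \<in> topspace \<sigma>"
    from inv[OF this] show "x \<in> gen scl \<sigma> S ` gen_dom scl \<sigma> S" by (metis image_eqI)
  qed (use img in auto)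
  have gi: "gen_inv scl \<sigma> S x = g (gen_inv scl \<rho> R (f x))" if "x \<in> topspace \<sigma>" for x
    unfolding gen_inv_def[of _ \<sigma>]
    by (rule the_inv_into_f_eq[OF inj inv(2,1)[OF that]])
  have "continuous_map \<sigma> \<sigma> (g \<circ> (gen_inv scl \<rho> R \<circ> f))"
    by (intro continuous_map_compose[OF _ g] continuous_map_compose[OF f(1)] LD(5))
  then have "continuous_map \<sigma> \<sigma> (gen_inv scl \<sigma> S)"
    by (rule continuous_map_eq) (simp add: gi)
  then show "invertible_level \<sigma> S \<omega>"
    unfolding invertible_level_def
    using \<sigma> H complete_lc_transport[OF \<sigma> LD(1,3) f g gf] SG bij by simp
  show "x \<in> gen_dom scl \<sigma> S \<longleftrightarrow> x \<in> topspace \<sigma> \<and> f x \<in> gen_dom scl \<rho> R" by (rule dom)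
  show "x \<in> gen_dom scl \<sigma> S \<Longrightarrow> gen scl \<sigma> S x = g (gen scl \<rho> R (f x))" by (rule gen)
  show "x \<in> topspace \<sigma> \<Longrightarrow> gen_inv scl \<sigma> S x = g (gen_inv scl \<rho> R (f x))" by (rule gi)
qed

section \<open>Inductive limits and completions\<close>

lemma nested_Union_common:
  fixes X :: "int \<Rightarrow> 'a set"
  assumes nested: "antimono X" and "x \<in> (\<Union>n. X n)" "y \<in> (\<Union>n. X n)"
  shows "\<exists>n. x \<in> X n \<and> y \<in> X n"
proof -
  obtain m where m: "x \<in> X m" using assms(2) by (rule UN_E)
  obtain n where n: "y \<in> X n" using assms(3) by (rule UN_E)
  have "X m \<subseteq> X (min m n)" "X n \<subseteq> X (min m n)" using nested by (simp_all add: antimonoD)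
  then show ?thesis using m n by blast
qed

lemma seminorm_on_nested_Union:
  fixes X :: "int \<Rightarrow> 'a set"
  assumes nested: "antimono X" and r: "\<And>n. seminorm_on scl (X n) r"
  shows "seminorm_on scl (\<Union>n. X n) r"
proof (rule seminorm_onI)
  fix x y assume "x \<in> (\<Union>n. X n)" "y \<in> (\<Union>n. X n)"
  from nested_Union_common[OF nested this] obtain n where "x \<in> X n" "y \<in> X n" by (elim exE conjE)
  then show "r (x + y) \<le> r x + r y" by (rule seminorm_add[OF r])
qed (use seminorm_nonneg[OF r] seminorm_scale[OF r] in auto)

lemma linear_on_nested_Union:
  fixes X :: "int \<Rightarrow> 'a set"
  assumes nested: "antimono X" and f: "\<And>n. linear_on_space scl (X n) f"
  shows "linear_on_space scl (\<Union>n. X n) f"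
proof (rule linear_on_spaceI)
  fix x y assume "x \<in> (\<Union>n. X n)" "y \<in> (\<Union>n. X n)"
  from nested_Union_common[OF nested this] obtain n where "x \<in> X n" "y \<in> X n" by (elim exE conjE)
  then show "f (x + y) = f x + f y" by (rule linear_on_space_add[OF f])
qed (use linear_on_space_scale[OF f] in auto)

text \<open>The topology generated by the single seminorm \<open>r\<close> is locally convex and
  makes all inclusions continuous, so the inductive limit topology is finer than it.\<close>

lemma inductive_limit_csnI:
  assumes lim: "is_lc_inductive_limit scl \<tau> \<sigma>"
    and nested: "antimono (\<lambda>n. topspace (\<tau> n))"
    and lc: "\<And>n. lc_space scl (\<tau> n)" and rn: "\<And>n. r \<in> csn (\<tau> n)"
  shows "r \<in> csn \<sigma>"
proof -
  define V where "V = topspace \<sigma>"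
  have \<sigma>: "lc_space scl \<sigma>" and V_eq: "V = (\<Union>n. topspace (\<tau> n))"
    using lim unfolding is_lc_inductive_limit_def V_def by simp_all
  have "\<forall>\<sigma>'. lc_space scl \<sigma>' \<and> topspace \<sigma>' = V \<and> (\<forall>n. continuous_map (\<tau> n) \<sigma>' (\<lambda>x. x)) \<longrightarrow>
      (\<forall>U. openin \<sigma>' U \<longrightarrow> openin \<sigma> U)"
    using lim unfolding is_lc_inductive_limit_def V_eq by (elim conjE)
  note fine = this[rule_format, OF conjI[OF _ conjI]]
  have V: "subspace V" using lc_subspace[OF \<sigma>] by (simp add: V_def)
  have r: "seminorm_on scl (topspace \<sigma>) r"
    unfolding V_def[symmetric] V_eq
    by (rule seminorm_on_nested_Union[OF nested csn_seminorm[OF rn]])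
  define \<sigma>' where "\<sigma>' = seminorm_topology V {r}"
  have "r \<in> csn \<sigma>'"
    unfolding \<sigma>'_def by (rule csn_seminorm_topology) (use r V_def in auto)
  moreover have "openin \<sigma> U" if "openin \<sigma>' U" for U
  proof (rule fine[OF _ _ _ that])
    show "lc_space scl \<sigma>'" unfolding \<sigma>'_def
      by (rule lc_seminorm_topology[OF V]) (use r V_def in auto)
    have "continuous_map (\<tau> n) \<sigma>' (\<lambda>x. x)" for n
      unfolding \<sigma>'_def
      by (rule continuous_map_linear_seminorm_topologyI[OF lc_subspace[OF lc] _ V])
        (use r V_eq rn in \<open>auto simp: linear_on_space_def V_def\<close>)
    then show "\<forall>n. continuous_map (\<tau> n) \<sigma>' (\<lambda>x. x)" by blast
  qed (simp add: \<sigma>'_def)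
  ultimately show ?thesis using r by (simp add: csn_def \<sigma>'_def V_def)
qed

text \<open>The supremum of a continuous seminorm over the rescaled orbits is again a seminorm, and it is
  continuous on the inductive limit because the exponent \<open>\<omega>\<close> is the same on every step.\<close>

lemma inductive_limit_exp_bound:
  assumes lim: "is_lc_inductive_limit scl \<tau> \<sigma>"
    and nested: "antimono (\<lambda>n. topspace (\<tau> n))"
    and lc: "\<And>n. lc_space scl (\<tau> n)"
    and T: "\<And>n. semigroup_exp (\<tau> n) (T n) \<omega>"
    and S: "\<And>n t x. t \<ge> 0 \<Longrightarrow> x \<in> topspace (\<tau> n) \<Longrightarrow> S t x = T n t x"
    and q: "q \<in> csn \<sigma>"
  shows "\<exists>r\<in>csn \<sigma>. \<forall>t\<ge>0. \<forall>x\<in>topspace \<sigma>. exp (\<omega> * t) * q (S t x) \<le> r x"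
proof -
  have \<sigma>: "lc_space scl \<sigma>" and top: "topspace \<sigma> = (\<Union>n. topspace (\<tau> n))"
    and incl: "\<And>n. continuous_map (\<tau> n) \<sigma> (\<lambda>x. x)"
    using lim unfolding is_lc_inductive_limit_def by simp_all
  note V = lc_subspace[OF \<sigma>] and Vn = lc_subspace[OF lc]
  define r where "r = (\<lambda>x. SUP t\<in>{0..}. exp (\<omega> * t) * q (S t x))"
  have Sin: "S t x \<in> topspace \<sigma>" if "t \<ge> 0" "x \<in> topspace (\<tau> n)" for t x n
    using S[OF that] continuous_map_in[OF incl semigroup_expD(3)[OF T that]] by simp
  have qn: "q \<in> csn (\<tau> n)" for n
    using csn_pullback[OF Vn incl _ q] by (simp add: linear_on_space_def)
  have bound: "\<exists>s\<in>csn (\<tau> n). \<forall>t\<ge>0. \<forall>x\<in>topspace (\<tau> n). exp (\<omega> * t) * q (S t x) \<le> s x" for n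
  proof -
    have "\<forall>q\<in>csn (\<tau> n). \<exists>s\<in>csn (\<tau> n). \<forall>t\<ge>0. \<forall>x\<in>topspace (\<tau> n). exp (\<omega> * t) * q (T n t x) \<le> s x"
      using T[of n] by (simp add: semigroup_exp_def)
    from bspec[OF this qn] show ?thesis using S by simp
  qed
  \<comment> \<open>Finiteness of the supremum is a question about one vector, so a bound from any
    one level containing it is enough.\<close>
  have bdd: "bdd_above ((\<lambda>t. exp (\<omega> * t) * q (S t x)) ` {0..})" if "x \<in> topspace \<sigma>" for x
  proof -
    obtain n where n: "x \<in> topspace (\<tau> n)" using \<open>x \<in> topspace \<sigma>\<close> top by blast
    obtain s where "\<forall>t\<ge>0. \<forall>x\<in>topspace (\<tau> n). exp (\<omega> * t) * q (S t x) \<le> s x"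
      using bound[of n] by (rule bexE)
    then show ?thesis using n by (intro bdd_aboveI2[of _ _ "s x"]) auto
  qed
  have ub: "exp (\<omega> * t) * q (S t x) \<le> r x" if "t \<ge> 0" "x \<in> topspace \<sigma>" for t x
    unfolding r_def by (rule cSUP_upper[OF _ bdd]) (use that in auto)
  have lub: "r x \<le> c" if "\<And>t. t \<ge> 0 \<Longrightarrow> exp (\<omega> * t) * q (S t x) \<le> c" for x c
    unfolding r_def by (rule cSUP_least) (use that in auto)
  have Slin: "S t (x + y) = S t x + S t y" "S t (scl c x) = scl c (S t x)"
    if t: "t \<ge> 0" and xy: "x \<in> topspace (\<tau> n)" "y \<in> topspace (\<tau> n)" for t x y c n
    using S[OF t, of _ n] xy subspace_add[OF Vn xy] subspace_scale[OF Vn xy(1)]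
      linear_on_space_add[OF semigroup_expD(1)[OF T t] xy]
      linear_on_space_scale[OF semigroup_expD(1)[OF T t] xy(1)] by auto
  have nonneg: "0 \<le> q (S t x)" if "t \<ge> 0" "x \<in> topspace (\<tau> n)" for t x n
    using seminorm_nonneg[OF csn_seminorm[OF q] Sin[OF that]] .
  have rn: "seminorm_on scl (topspace (\<tau> n)) r" for n
  proof (rule seminorm_onI)
    fix x assume x: "x \<in> topspace (\<tau> n)"
    then have x': "x \<in> topspace \<sigma>" using top by blast
    show r0: "0 \<le> r x" using ub[of 0 x] nonneg[OF _ x, of 0] x' by simp
    show "r (x + y) \<le> r x + r y" if y: "y \<in> topspace (\<tau> n)" for y
    proof (rule lub)
      fix t :: real assume t: "t \<ge> 0"
      have y': "y \<in> topspace \<sigma>" using y top by blast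
      have "exp (\<omega> * t) * q (S t (x + y)) \<le> exp (\<omega> * t) * (q (S t x) + q (S t y))"
        using seminorm_add[OF csn_seminorm[OF q] Sin[OF t x] Sin[OF t y]]
        by (simp add: Slin(1)[OF t x y])
      also have "\<dots> \<le> r x + r y" using ub[OF t x'] ub[OF t y'] by (simp add: distrib_left)
      finally show "exp (\<omega> * t) * q (S t (x + y)) \<le> r x + r y" .
    qed
    have qs: "q (S t (scl c x)) = norm c * q (S t x)" if "t \<ge> 0" for t c
      using seminorm_scale[OF csn_seminorm[OF q] Sin[OF that x]] Slin(2)[OF that x x] by simp
    have xc: "scl c x \<in> topspace \<sigma>" for c using subspace_scale[OF V x'] .
    show "r (scl c x) = norm c * r x" for c
    proof (rule antisym)
      show "r (scl c x) \<le> norm c * r x"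
      proof (rule lub)
        fix t :: real assume t: "t \<ge> 0"
        show "exp (\<omega> * t) * q (S t (scl c x)) \<le> norm c * r x"
          using mult_left_mono[OF ub[OF t x'] norm_ge_zero[of c]] qs[OF t] by (simp add: mult_ac)
      qed
      \<comment> \<open>The orbit of \<open>x\<close> is recovered from that of
        \<open>scl c x\<close> by dividing by \<open>norm c\<close>. For \<open>c = 0\<close> the
        claim is nonnegativity of the supremum, read off at time 0.\<close>
      show "norm c * r x \<le> r (scl c x)"
      proof (cases "c = 0")
        case True
        have "0 \<le> exp (\<omega> * 0) * q (S 0 (scl c x))" using qs[of 0 c] True by simp
        also have "\<dots> \<le> r (scl c x)" using ub[OF order_refl xc] .
        finally show ?thesis using True by simp
      next
        case False
        then have c: "norm c > 0" by simp
        have "r x \<le> r (scl c x) / norm c"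
        proof (rule lub)
          fix t :: real assume t: "t \<ge> 0"
          show "exp (\<omega> * t) * q (S t x) \<le> r (scl c x) / norm c"
            using ub[OF t xc[of c]] qs[OF t, of c] c by (simp add: field_simps)
        qed
        then show ?thesis using c by (simp add: field_simps)
      qed
    qed
  qed
  have "r \<in> csn (\<tau> n)" for n
  proof -
    obtain s where s: "s \<in> csn (\<tau> n)" "\<forall>t\<ge>0. \<forall>x\<in>topspace (\<tau> n). exp (\<omega> * t) * q (S t x) \<le> s x"
      using bound[of n] by (rule bexE)
    show ?thesis by (rule csn_le[OF Vn s(1) rn lub]) (use s(2) in auto)
  qed
  from inductive_limit_csnI[OF lim nested lc this] show ?thesis using ub by blast
qed

section \<open>From a dense subspace to the whole space\<close>

lemma csn_le_if_dense:
  assumes V: "subspace (topspace \<tau>)" and Y: "\<tau> closure_of Y = topspace \<tau>"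
    and u: "u \<in> csn \<tau>" and r: "r \<in> csn \<tau>"
    and le: "\<And>y. y \<in> Y \<Longrightarrow> y \<in> topspace \<tau> \<Longrightarrow> u y \<le> r y" and x: "x \<in> topspace \<tau>"
  shows "u x \<le> r x"
proof (rule field_le_epsilon)
  fix e :: real assume "e > 0"
  then obtain y where y: "y \<in> Y" "y \<in> topspace \<tau>" "max (u (y - x)) (r (y - x)) < e / 2"
    using dense_csn_approx[OF V Y x csn_max[OF u r], of "e / 2"] by auto
  have "u x \<le> u (x - y) + u y" "r y \<le> r (y - x) + r x" "u (x - y) = u (y - x)"
    using seminorm_diff_le[OF csn_seminorm[OF u] V x y(2)]
      seminorm_diff_le[OF csn_seminorm[OF r] V y(2) x]
      seminorm_diff_commute[OF csn_seminorm[OF u] V x y(2)] by auto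
  then show "u x \<le> r x + e" using le[OF y(1,2)] y(3) by linarith
qed

text \<open>Algebraic identities extend by continuity and separation, bounds by
  \<open>csn_le_if_dense\<close>. Strong continuity is the delicate part: it needs the orbit of
  \<open>x\<close> to be uniformly close to that of a nearby \<open>y\<close> on a time interval,
  which equicontinuity provides.\<close>

lemma semigroup_exp_from_dense:
  assumes \<tau>: "lc_space scl \<tau>" and H: "Hausdorff_space \<tau>" and Y: "Y \<subseteq> topspace \<tau>"
    and dense: "\<tau> closure_of Y = topspace \<tau>"
    and T: "\<And>t. t \<ge> 0 \<Longrightarrow> cont_operator scl \<tau> (T t)"
    and semi: "\<And>t s y. t \<ge> 0 \<Longrightarrow> s \<ge> 0 \<Longrightarrow> y \<in> Y \<Longrightarrow> T (t + s) y = T t (T s y)"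
    and T0: "\<And>y. y \<in> Y \<Longrightarrow> T 0 y = y"
    and orbit: "\<And>y. y \<in> Y \<Longrightarrow> continuous_map (top_of_set {0..}) \<tau> (\<lambda>t. T t y)"
    and bound: "\<And>q. q \<in> csn \<tau> \<Longrightarrow> \<exists>r\<in>csn \<tau>. \<forall>t\<ge>0. \<forall>y\<in>Y. exp (\<omega> * t) * q (T t y) \<le> r y"
  shows "semigroup_exp \<tau> T \<omega>"
proof -
  note V = lc_subspace[OF \<tau>] and TD = cont_operatorD[OF T]
  note Tin = continuous_map_in[OF TD(2)]
  have bd: "\<exists>r\<in>csn \<tau>. \<forall>t\<ge>0. \<forall>x\<in>topspace \<tau>. exp (\<omega> * t) * q (T t x) \<le> r x"
    if q: "q \<in> csn \<tau>" for q
  proof -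
    obtain r where r: "r \<in> csn \<tau>" "\<forall>t\<ge>0. \<forall>y\<in>Y. exp (\<omega> * t) * q (T t y) \<le> r y"
      using bound[OF q] by (rule bexE)
    have "exp (\<omega> * t) * q (T t x) \<le> r x" if t: "t \<ge> 0" and x: "x \<in> topspace \<tau>" for t x
      by (rule csn_le_if_dense[OF V dense csn_mult[OF csn_pullback[OF V TD(2,1)[OF t] q]] r(1) _ x])
        (use r(2) t in auto)
    then show ?thesis using r(1) by blast
  qed
  have semi': "T (t + s) x = T t (T s x)" if ts: "t \<ge> 0" "s \<ge> 0" and x: "x \<in> topspace \<tau>" for t s x
  proof -
    have "T (t + s) x = (T t \<circ> T s) x"
      by (rule dense_eq[OF dense H _ continuous_map_compose[OF TD(2)[OF ts(2)] TD(2)[OF ts(1)]] _ x])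
        (use TD(2) semi ts in auto)
    then show ?thesis by simp
  qed
  have T0': "T 0 x = x" if x: "x \<in> topspace \<tau>" for x
    by (rule dense_eq[OF dense H TD(2) _ T0 x]) auto
  have orbit': "continuous_map (top_of_set {0..}) \<tau> (\<lambda>t. T t x)" if x: "x \<in> topspace \<tau>" for x
  proof (rule continuous_map_lcI[OF \<tau>])
    fix q t0 assume q: "q \<in> csn \<tau>" and "t0 \<in> topspace (top_of_set {0::real..})"
    then have t0: "t0 \<ge> 0" by simp
    note sq = csn_seminorm[OF q]
    obtain r where r: "r \<in> csn \<tau>" "\<forall>t\<ge>0. \<forall>x\<in>topspace \<tau>. exp (\<omega> * t) * q (T t x) \<le> r x"
      using bd[OF q] by (rule bexE)
    \<comment> \<open>The weight is removed only on a bounded interval; \<open>t0 + 1\<close> leaves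
      room to the right of \<open>t0\<close>, and the neighbourhood \<open>U\<close> is cut off
      there accordingly.\<close>
    define s where "s = (\<lambda>x. exp (\<bar>\<omega>\<bar> * (t0 + 1)) * r x)"
    have s: "s \<in> csn \<tau>" unfolding s_def by (rule csn_mult[OF r(1)]) simp
    have qs: "q (T t z) \<le> s z" if "0 \<le> t" "t \<le> t0 + 1" "z \<in> topspace \<tau>" for t z
      unfolding s_def
      by (rule exp_weight_le[of \<omega> t]) (use that r(2) seminorm_nonneg[OF csn_seminorm[OF r(1)]] in auto)
    obtain y where y: "y \<in> Y" "y \<in> topspace \<tau>" "s (y - x) < 1 / 4"
      using dense_csn_approx[OF V dense x s, of "1 / 4"] by auto
    define U where "U = {t \<in> topspace (top_of_set {0..}). T t y \<in> {z \<in> topspace \<tau>. q (z - T t0 y) < 1 / 4}} \<inter> {..<t0 + 1}"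
    have "openin (top_of_set {0..}) U"
      unfolding U_def
      by (intro openin_Int_open openin_continuous_map_preimage[OF orbit[OF y(1)]] csn_ball_open[OF q])
        (use Tin[OF t0 y(2)] in auto)
    moreover have "t0 \<in> U"
      using t0 Tin[OF t0 y(2)] seminorm_zero[OF sq V] by (simp add: U_def)
    moreover have "q (T t x - T t0 x) < 1" if "t \<in> U" for t
    proof -
      have t: "0 \<le> t" "t \<le> t0 + 1" and near: "q (T t y - T t0 y) < 1 / 4"
        using that by (auto simp: U_def)
      have "q (T t x - T t0 x) \<le> q (T t x - T t y) + q (T t y - T t0 x)"
        by (rule seminorm_triangle[OF sq V]) (use Tin t t0 x y in auto)
      also have "q (T t y - T t0 x) \<le> q (T t y - T t0 y) + q (T t0 y - T t0 x)"
        by (rule seminorm_triangle[OF sq V]) (use Tin t t0 x y in auto)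
      also have "q (T t x - T t y) = q (T t (y - x))"
        using seminorm_diff_commute[OF sq V Tin[OF t(1) x] Tin[OF t(1) y(2)]]
          linear_on_space_diff[OF TD(1)[OF t(1)] V y(2) x] by simp
      also have "q (T t (y - x)) \<le> s (y - x)" using qs[OF t subspace_diff[OF V y(2) x]] .
      also have "q (T t0 y - T t0 x) = q (T t0 (y - x))"
        using linear_on_space_diff[OF TD(1)[OF t0] V y(2) x] by simp
      also have "q (T t0 (y - x)) \<le> s (y - x)"
        using qs[OF t0 _ subspace_diff[OF V y(2) x]] by simp
      finally show ?thesis using near y(3) by linarith
    qed
    ultimately show "\<exists>U. openin (top_of_set {0..}) U \<and> t0 \<in> U \<and> (\<forall>t\<in>U. q (T t x - T t0 x) < 1)"
      by blast
  qed (use Tin x in auto)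
  show ?thesis unfolding semigroup_exp_def using T semi' T0' orbit' bd by blast
qed

end

section \<open>The Sobolev tower\<close>

locale sobolev_setup = scalar_space scl
  for scl :: "'k::real_normed_field \<Rightarrow> 'a::ab_group_add \<Rightarrow> 'a" +
  fixes \<Gamma> :: "'g set"
    and \<tau> :: "int \<Rightarrow> 'a topology"
    and p :: "int \<Rightarrow> 'g \<Rightarrow> 'a \<Rightarrow> real"
    and T :: "int \<Rightarrow> real \<Rightarrow> 'a \<Rightarrow> 'a"
    and \<omega> :: real
  assumes base_seminorms: "\<forall>\<gamma>\<in>\<Gamma>. seminorm_on scl (topspace (\<tau> 0)) (p 0 \<gamma>)"
    and base_topology: "\<tau> 0 = seminorm_topology (topspace (\<tau> 0)) (p 0 ` \<Gamma>)"
    and base_level: "invertible_level (\<tau> 0) (T 0) \<omega>"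
    and tower: "sobolev_tower scl \<Gamma> \<tau> p T"
begin

abbreviation X :: "int \<Rightarrow> 'a set" where "X n \<equiv> topspace (\<tau> n)"
abbreviation D :: "int \<Rightarrow> 'a set" where "D n \<equiv> gen_dom scl (\<tau> n) (T n)"
abbreviation A :: "int \<Rightarrow> 'a \<Rightarrow> 'a" where "A n \<equiv> gen scl (\<tau> n) (T n)"
abbreviation R :: "int \<Rightarrow> 'a \<Rightarrow> 'a" where "R n \<equiv> gen_inv scl (\<tau> n) (T n)"

text \<open>The invariant of the induction in both directions. That \<open>p n\<close> generates the
  topology has to be carried along: for negative \<open>n\<close> the tower only says that
  \<open>\<tau> n\<close> is a completion, yet the next step down is formulated with these
  seminorms.\<close>

definition level :: "int \<Rightarrow> bool"
  where "level n \<longleftrightarrow> invertible_level (\<tau> n) (T n) \<omega> \<and>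
    (\<forall>\<gamma>\<in>\<Gamma>. seminorm_on scl (X n) (p n \<gamma>)) \<and> \<tau> n = seminorm_topology (X n) (p n ` \<Gamma>)"

definition link :: "int \<Rightarrow> bool"
  where "link n \<longleftrightarrow> D n = X (n + 1) \<and> continuous_map (\<tau> (n + 1)) (\<tau> n) (\<lambda>x. x) \<and>
    continuous_map (\<tau> n) (\<tau> (n + 1)) (R n) \<and> (\<forall>t\<ge>0. \<forall>x\<in>X (n + 1). T (n + 1) t x = T n t x)"

text \<open>By definition of \<open>p (n + 1)\<close>, the generator \<open>A n\<close> is an
  isometry for corresponding seminorms, so with its inverse \<open>R n\<close> it is an isomorphism
  of the new level onto the old one.\<close>

lemma level_up:
  assumes n: "n \<ge> 0" and L: "level n"
  shows "level (n + 1) \<and> link n"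
proof -
  have "\<forall>n\<ge>1. topspace (\<tau> n) = D (n - 1) \<and>
      (\<forall>\<gamma>\<in>\<Gamma>. \<forall>x\<in>X n. p n \<gamma> x = p (n - 1) \<gamma> (A (n - 1) x)) \<and>
      \<tau> n = seminorm_topology (X n) (p n ` \<Gamma>) \<and>
      (\<forall>t\<ge>0. \<forall>x\<in>X n. T n t x = T (n - 1) t x)"
    using tower unfolding sobolev_tower_def by (rule conjunct1)
  from this[rule_format, of "n + 1"] n
  have X: "X (n + 1) = D n"
    and pp: "\<And>\<gamma> x. \<gamma> \<in> \<Gamma> \<Longrightarrow> x \<in> X (n + 1) \<Longrightarrow> p (n + 1) \<gamma> x = p n \<gamma> (A n x)"
    and tn: "\<tau> (n + 1) = seminorm_topology (X (n + 1)) (p (n + 1) ` \<Gamma>)"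
    and Tn: "\<And>t x. t \<ge> 0 \<Longrightarrow> x \<in> X (n + 1) \<Longrightarrow> T (n + 1) t x = T n t x"
    by auto
  have I: "invertible_level (\<tau> n) (T n) \<omega>" and sp: "\<And>\<gamma>. \<gamma> \<in> \<Gamma> \<Longrightarrow> seminorm_on scl (X n) (p n \<gamma>)"
    and tn0: "\<tau> n = seminorm_topology (X n) (p n ` \<Gamma>)"
    using L unfolding level_def by auto
  note LD = invertible_levelD[OF I]
  note V = lc_subspace[OF LD(1)]
  have V': "subspace (X (n + 1))" and Alin: "linear_on_space scl (X (n + 1)) (A n)"
    using gen_dom_subspace[OF LD(1,4,2)] X by auto
  have Ain: "A n x \<in> X n" if "x \<in> X (n + 1)" for x using LD(9) that X by simp
  have Rin: "R n x \<in> X (n + 1)" if "x \<in> X n" for x using LD(6)[OF that] X by simp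
  have sp1: "seminorm_on scl (X (n + 1)) (p (n + 1) \<gamma>)" if \<gamma>: "\<gamma> \<in> \<Gamma>" for \<gamma>
  proof -
    have "seminorm_on scl (X (n + 1)) (\<lambda>x. p n \<gamma> (A n x))"
      by (rule seminorm_pullback[OF sp[OF \<gamma>] Alin]) (use Ain in auto)
    then show ?thesis
      using subspace_add[OF V'] subspace_scale[OF V'] pp[OF \<gamma>] unfolding seminorm_on_def by simp
  qed
  have lc: "lc_space scl (\<tau> (n + 1))"
    by (subst tn, rule lc_seminorm_topology[OF V']) (use sp1 in auto)
  have pcsn: "p n \<gamma> \<in> csn (\<tau> n)" if "\<gamma> \<in> \<Gamma>" for \<gamma>
    by (subst tn0, rule csn_seminorm_topology) (use sp that in auto)
  have pcsn1: "p (n + 1) \<gamma> \<in> csn (\<tau> (n + 1))" if "\<gamma> \<in> \<Gamma>" for \<gamma>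
    by (subst tn, rule csn_seminorm_topology) (use sp1 that in auto)
  have Acont: "continuous_map (\<tau> (n + 1)) (\<tau> n) (A n)"
  proof (subst tn0, rule continuous_map_linear_seminorm_topologyI[OF V' Alin V _ Ain])
    fix q assume "q \<in> p n ` \<Gamma>"
    then obtain \<gamma> where \<gamma>: "\<gamma> \<in> \<Gamma>" "q = p n \<gamma>" by blast
    show "seminorm_on scl (X n) q" using sp[OF \<gamma>(1)] \<gamma>(2) by simp
    show "(\<lambda>x. q (A n x)) \<in> csn (\<tau> (n + 1))"
      by (rule csn_cong[OF V' pcsn1[OF \<gamma>(1)]]) (simp add: pp[OF \<gamma>(1)] \<gamma>(2))
  qed
  have Rcont: "continuous_map (\<tau> n) (\<tau> (n + 1)) (R n)"
  proof (subst tn, rule continuous_map_linear_seminorm_topologyI[OF V gen_inv_linear[OF I] V' _ Rin])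
    fix q assume "q \<in> p (n + 1) ` \<Gamma>"
    then obtain \<gamma> where \<gamma>: "\<gamma> \<in> \<Gamma>" "q = p (n + 1) \<gamma>" by blast
    show "seminorm_on scl (X (n + 1)) q" using sp1[OF \<gamma>(1)] \<gamma>(2) by simp
    show "(\<lambda>x. q (R n x)) \<in> csn (\<tau> n)"
      by (rule csn_cong[OF V pcsn[OF \<gamma>(1)]]) (simp add: pp[OF \<gamma>(1) Rin] \<gamma>(2) LD(7))
  qed
  \<comment> \<open>The restricted semigroup in the conjugated form that the transport requires; it
    rests on \<open>R n\<close> commuting with the semigroup.\<close>
  have conj: "T (n + 1) t x = R n (T n t (A n x))" if t: "t \<ge> 0" and x: "x \<in> X (n + 1)" for t x
    using gen_inv_semigroup[OF I t Ain[OF x]] Tn[OF t x] LD(8)[of x] x X by simp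
  have "invertible_level (\<tau> (n + 1)) (T (n + 1)) \<omega>"
    by (rule invertible_level_transport(1)[OF I lc Acont Alin Rcont _ LD(7) conj])
      (use LD(8) X in simp)
  then have "level (n + 1)" unfolding level_def using sp1 tn by blast
  \<comment> \<open>The inclusion factors as \<open>A n\<close> into level \<open>n\<close> followed
    by \<open>R n\<close> within level \<open>n\<close>, so continuity of the inverse generator on
    that level is what makes it continuous.\<close>
  moreover have "continuous_map (\<tau> (n + 1)) (\<tau> n) (\<lambda>x. x)"
    by (rule continuous_map_eq[OF continuous_map_compose[OF Acont LD(5)]]) (use LD(8) X in simp)
  then have "link n" unfolding link_def using X Rcont Tn by simp
  ultimately show ?thesis by simp
qed

text \<open>The lower space is known only as some completion, so the isomorphism has to be built.
  \<open>\<Phi>\<close> extends \<open>R (n + 1)\<close> from the dense subspace,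
  \<open>\<Psi>\<close> extends \<open>A (n + 1)\<close> from its dense domain, and density shows
  that they are inverse to each other. After that the level is a transported copy.\<close>

lemma level_down:
  assumes n: "n < 0" and L: "level (n + 1)"
  shows "level n \<and> link n"
proof -
  define q' where "q' = (\<lambda>\<gamma> x. p (n + 1) \<gamma> (R (n + 1) x))"
  define \<sigma> where "\<sigma> = seminorm_topology (X (n + 1)) (q' ` \<Gamma>)"
  have "\<forall>n\<le>-1.
      let Y = X (n + 1); p' = (\<lambda>\<gamma> x. p (n + 1) \<gamma> (R (n + 1) x))
      in is_completion scl (seminorm_topology Y (p' ` \<Gamma>)) (\<tau> n) \<and>
         (\<forall>\<gamma>\<in>\<Gamma>. continuous_map (\<tau> n) euclideanreal (p n \<gamma>) \<and> (\<forall>x\<in>Y. p n \<gamma> x = p' \<gamma> x)) \<and>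
         (\<forall>t\<ge>0. cont_extension (\<tau> n) Y (T (n + 1) t) (T n t))"
    using tower unfolding sobolev_tower_def by (rule conjunct2)
  from this[rule_format, of n] n
  have compl: "is_completion scl \<sigma> (\<tau> n)"
    and pcont: "\<And>\<gamma>. \<gamma> \<in> \<Gamma> \<Longrightarrow> continuous_map (\<tau> n) euclideanreal (p n \<gamma>)"
    and pp: "\<And>\<gamma> x. \<gamma> \<in> \<Gamma> \<Longrightarrow> x \<in> X (n + 1) \<Longrightarrow> p n \<gamma> x = q' \<gamma> x"
    and Text: "\<And>t. t \<ge> 0 \<Longrightarrow> cont_extension (\<tau> n) (X (n + 1)) (T (n + 1) t) (T n t)"
    unfolding Let_def q'_def \<sigma>_def by auto
  have lc: "lc_space scl (\<tau> n)" and H: "Hausdorff_space (\<tau> n)" and C: "complete_lc (\<tau> n)"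
    and sub: "X (n + 1) \<subseteq> X n" and st: "subtopology (\<tau> n) (X (n + 1)) = \<sigma>"
    and dense: "\<tau> n closure_of X (n + 1) = X n"
    using compl unfolding is_completion_def by (auto simp: \<sigma>_def)
  have Tcont: "continuous_map (\<tau> n) (\<tau> n) (T n t)" and Tn: "x \<in> X (n + 1) \<Longrightarrow> T n t x = T (n + 1) t x"
    if "t \<ge> 0" for t x
    using Text[OF that] unfolding cont_extension_def by auto
  have I: "invertible_level (\<tau> (n + 1)) (T (n + 1)) \<omega>"
    and sp: "\<And>\<gamma>. \<gamma> \<in> \<Gamma> \<Longrightarrow> seminorm_on scl (X (n + 1)) (p (n + 1) \<gamma>)"
    and tn0: "\<tau> (n + 1) = seminorm_topology (X (n + 1)) (p (n + 1) ` \<Gamma>)"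
    using L unfolding level_def by auto
  note LD = invertible_levelD[OF I]
  note V = lc_subspace[OF LD(1)] and W = lc_subspace[OF lc]
  note Rlin = gen_inv_linear[OF I] and Dsub = gen_dom_subspace[OF LD(1,4,2)]
  have DX: "x \<in> X (n + 1)" if "x \<in> D (n + 1)" for x using that gen_dom_subset by blast
  have Rin: "R (n + 1) x \<in> X (n + 1)" if "x \<in> X (n + 1)" for x using DX[OF LD(6)[OF that]] .
  have sq: "seminorm_on scl (X (n + 1)) (q' \<gamma>)" if "\<gamma> \<in> \<Gamma>" for \<gamma>
    unfolding q'_def by (rule seminorm_pullback[OF sp[OF that] Rlin]) (use Rin in auto)
  have t\<sigma>: "topspace \<sigma> = X (n + 1)" by (simp add: \<sigma>_def)
  have qcsn: "q' \<gamma> \<in> csn \<sigma>" if "\<gamma> \<in> \<Gamma>" for \<gamma>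
    unfolding \<sigma>_def by (rule csn_seminorm_topology) (use sq that in auto)
  have pcsn: "p (n + 1) \<gamma> \<in> csn (\<tau> (n + 1))" if "\<gamma> \<in> \<Gamma>" for \<gamma>
    by (subst tn0, rule csn_seminorm_topology) (use sp that in auto)
  \<comment> \<open>An isometry for corresponding seminorms, since \<open>q'\<close> is defined as
    the seminorm after \<open>R (n + 1)\<close>.\<close>
  have "continuous_map \<sigma> (\<tau> (n + 1)) (R (n + 1))"
  proof (subst tn0, rule continuous_map_linear_seminorm_topologyI)
    fix q assume "q \<in> p (n + 1) ` \<Gamma>"
    then obtain \<gamma> where \<gamma>: "\<gamma> \<in> \<Gamma>" "q = p (n + 1) \<gamma>" by blast
    show "seminorm_on scl (X (n + 1)) q" using sp[OF \<gamma>(1)] \<gamma>(2) by simp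
    show "(\<lambda>x. q (R (n + 1) x)) \<in> csn \<sigma>" using qcsn[OF \<gamma>(1)] \<gamma>(2) by (simp add: q'_def)
  qed (use V Rlin Rin t\<sigma> in auto)
  then have "continuous_map (subtopology (\<tau> n) (X (n + 1))) (\<tau> (n + 1)) (R (n + 1))"
    unfolding st .
  from continuous_linear_extension[OF lc LD(1,3,2) V sub dense Rlin this]
  obtain \<Phi> where \<Phi>: "continuous_map (\<tau> n) (\<tau> (n + 1)) \<Phi>" "linear_on_space scl (X n) \<Phi>"
    and \<Phi>R: "\<forall>y\<in>X (n + 1). \<Phi> y = R (n + 1) y"
    by (elim exE conjE)
  \<comment> \<open>The generator is not continuous within level \<open>n + 1\<close>, but it is
    from its domain with the induced topology into the weaker topology \<open>\<sigma>\<close>,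
    because \<open>q'\<close> undoes it.\<close>
  define \<delta> where "\<delta> = subtopology (\<tau> (n + 1)) (D (n + 1))"
  have t\<delta>: "topspace \<delta> = D (n + 1)" using DX by (auto simp: \<delta>_def)
  have "continuous_map \<delta> \<sigma> (A (n + 1))"
    unfolding \<sigma>_def
  proof (rule continuous_map_linear_seminorm_topologyI)
    fix q assume "q \<in> q' ` \<Gamma>"
    then obtain \<gamma> where \<gamma>: "\<gamma> \<in> \<Gamma>" "q = q' \<gamma>" by blast
    show "seminorm_on scl (X (n + 1)) q" using sq[OF \<gamma>(1)] \<gamma>(2) by simp
    have "p (n + 1) \<gamma> \<in> csn \<delta>"
      unfolding \<delta>_def by (rule csn_subtopology[OF V gen_dom_subset Dsub(1) pcsn[OF \<gamma>(1)]])
    then show "(\<lambda>x. q (A (n + 1) x)) \<in> csn \<delta>"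
      by (rule csn_cong[rotated]) (use Dsub(1) LD(8) in \<open>auto simp: t\<delta> \<gamma>(2) q'_def\<close>)
  qed (use V Dsub LD(9) t\<delta> in auto)
  then have "continuous_map \<delta> (\<tau> n) (A (n + 1))"
    unfolding st[symmetric] by (rule continuous_map_into_fulltopology)
  from continuous_linear_extension[OF LD(1) lc C H Dsub(1) gen_dom_subset gen_dom_dense[OF I] Dsub(2)
      this[unfolded \<delta>_def]]
  obtain \<Psi> where \<Psi>: "continuous_map (\<tau> (n + 1)) (\<tau> n) \<Psi>" "linear_on_space scl (X (n + 1)) \<Psi>"
    and \<Psi>A: "\<forall>y\<in>D (n + 1). \<Psi> y = A (n + 1) y"
    by (elim exE conjE)
  note \<Phi>in = continuous_map_in[OF \<Phi>(1)] and \<Psi>in = continuous_map_in[OF \<Psi>(1)]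
  have \<Psi>R: "\<Psi> (R (n + 1) y) = y" if "y \<in> X (n + 1)" for y
    using \<Psi>A LD(6,7)[OF that] by simp
  have id1: "\<Psi> (\<Phi> x) = x" if "x \<in> X n" for x
  proof -
    have "(\<Psi> \<circ> \<Phi>) x = (\<lambda>x. x) x"
      by (rule dense_eq[OF dense H continuous_map_compose[OF \<Phi>(1) \<Psi>(1)] _ _ that])
        (use \<Phi>R \<Psi>R in auto)
    then show ?thesis by simp
  qed
  have id2: "\<Phi> (\<Psi> x) = x" if "x \<in> X (n + 1)" for x
  proof -
    have "(\<Phi> \<circ> \<Psi>) x = (\<lambda>x. x) x"
      by (rule dense_eq[OF gen_dom_dense[OF I] LD(2) continuous_map_compose[OF \<Psi>(1) \<Phi>(1)] _ _ that])
        (use \<Phi>R \<Psi>A LD(8,9) in auto)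
    then show ?thesis by simp
  qed
  have conj: "T n t x = \<Psi> (T (n + 1) t (\<Phi> x))" if t: "t \<ge> 0" and x: "x \<in> X n" for t x
  proof -
    note SD = semigroup_expD[OF LD(4) t]
    have "T n t x = (\<Psi> \<circ> (T (n + 1) t \<circ> \<Phi>)) x"
    proof (rule dense_eq[OF dense H Tcont[OF t] _ _ x])
      show "continuous_map (\<tau> n) (\<tau> n) (\<Psi> \<circ> (T (n + 1) t \<circ> \<Phi>))"
        by (intro continuous_map_compose[OF _ \<Psi>(1)] continuous_map_compose[OF \<Phi>(1)] SD(2))
      show "T n t y = (\<Psi> \<circ> (T (n + 1) t \<circ> \<Phi>)) y" if y: "y \<in> X (n + 1)" for y
        using Tn[OF t y] gen_inv_semigroup[OF I t y] \<Phi>R y \<Psi>R[OF SD(3)[OF y]] by simp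
    qed
    then show ?thesis by simp
  qed
  note tr = invertible_level_transport[OF I lc \<Phi> \<Psi>(1) id1 id2 conj]
  \<comment> \<open>The transported domain consists of the \<open>x\<close> with
    \<open>\<Phi> x\<close> in \<open>D (n + 1)\<close>. On that domain \<open>\<Psi>\<close> is
    \<open>A (n + 1)\<close>, whose range is exactly \<open>X (n + 1)\<close>.\<close>
  have Dn: "D n = X (n + 1)"
  proof (intro equalityI subsetI)
    fix x assume "x \<in> D n"
    then have "x \<in> X n" "\<Phi> x \<in> D (n + 1)" using tr(2) by auto
    then show "x \<in> X (n + 1)" using id1[of x] \<Psi>A LD(9)[of "\<Phi> x"] by simp
  next
    fix x assume x: "x \<in> X (n + 1)"
    then show "x \<in> D n" using tr(2) sub \<Phi>R LD(6)[OF x] by auto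
  qed
  have pn: "p n \<gamma> x = p (n + 1) \<gamma> (\<Phi> x)" if \<gamma>: "\<gamma> \<in> \<Gamma>" and x: "x \<in> X n" for \<gamma> x
  proof -
    have "p n \<gamma> x = (p (n + 1) \<gamma> \<circ> \<Phi>) x"
    proof (rule dense_eq[OF dense _ pcont[OF \<gamma>] continuous_map_compose[OF \<Phi>(1)] _ x])
      show "continuous_map (\<tau> (n + 1)) euclideanreal (p (n + 1) \<gamma>)"
        by (rule csn_continuous[OF V pcsn[OF \<gamma>]])
      show "p n \<gamma> y = (p (n + 1) \<gamma> \<circ> \<Phi>) y" if "y \<in> X (n + 1)" for y
        using pp[OF \<gamma> that] \<Phi>R that by (simp add: q'_def)
    qed simp
    then show ?thesis by simp
  qed
  have pcsn': "p n \<gamma> \<in> csn (\<tau> n)" if "\<gamma> \<in> \<Gamma>" for \<gamma>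
    by (rule csn_cong[OF W csn_pullback[OF W \<Phi> pcsn[OF that]] pn[OF that]])
  \<comment> \<open>The completion prescribes the topology only on the dense subspace. To identify
    it with the one generated by the extended seminorms, the identity from \<open>\<kappa>\<close>
    is factored through \<open>\<Phi>\<close> and \<open>\<Psi>\<close>.\<close>
  define \<kappa> where "\<kappa> = seminorm_topology (X n) (p n ` \<Gamma>)"
  have t\<kappa>: "topspace \<kappa> = X n" by (simp add: \<kappa>_def)
  have "\<tau> n = \<kappa>"
  proof (rule topology_eq_if_id_continuous)
    show "continuous_map (\<tau> n) \<kappa> (\<lambda>x. x)"
      unfolding \<kappa>_def
    proof (rule continuous_map_linear_seminorm_topologyI[OF W _ W])
      fix q assume "q \<in> p n ` \<Gamma>"
      then obtain \<gamma> where \<gamma>: "\<gamma> \<in> \<Gamma>" "q = p n \<gamma>" by blast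
      show "seminorm_on scl (X n) q" "(\<lambda>x. q x) \<in> csn (\<tau> n)"
        using pcsn'[OF \<gamma>(1)] csn_seminorm \<gamma>(2) by auto
    qed (simp_all add: linear_on_space_def)
    have "continuous_map \<kappa> (\<tau> (n + 1)) \<Phi>"
    proof (subst tn0, rule continuous_map_linear_seminorm_topologyI)
      fix q assume "q \<in> p (n + 1) ` \<Gamma>"
      then obtain \<gamma> where \<gamma>: "\<gamma> \<in> \<Gamma>" "q = p (n + 1) \<gamma>" by blast
      show "seminorm_on scl (X (n + 1)) q" using sp[OF \<gamma>(1)] \<gamma>(2) by simp
      have "p n \<gamma> \<in> csn \<kappa>"
        unfolding \<kappa>_def by (rule csn_seminorm_topology) (use \<gamma>(1) csn_seminorm[OF pcsn'] in auto)
      then show "(\<lambda>x. q (\<Phi> x)) \<in> csn \<kappa>"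
        by (rule csn_cong[rotated]) (use W pn[OF \<gamma>(1)] in \<open>auto simp: t\<kappa> \<gamma>(2)\<close>)
    qed (use W V \<Phi>in \<Phi>(2) in \<open>auto simp: t\<kappa>\<close>)
    from continuous_map_compose[OF this \<Psi>(1)]
    show "continuous_map \<kappa> (\<tau> n) (\<lambda>x. x)"
      by (rule continuous_map_eq) (simp add: t\<kappa> id1)
  qed (simp add: t\<kappa>)
  then have "level n"
    unfolding level_def using tr(1) csn_seminorm[OF pcsn'] by (auto simp: \<kappa>_def)
  \<comment> \<open>Again a factorisation of the inclusion, now as \<open>R (n + 1)\<close> within
    level \<open>n + 1\<close> followed by \<open>\<Psi>\<close>.\<close>
  moreover have "continuous_map (\<tau> (n + 1)) (\<tau> n) (\<lambda>x. x)"
    by (rule continuous_map_eq[OF continuous_map_compose[OF LD(5) \<Psi>(1)]]) (simp add: \<Psi>R)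
  moreover have "continuous_map (\<tau> n) (\<tau> (n + 1)) (R n)"
  proof (rule continuous_map_eq[OF \<Phi>(1)])
    fix x assume x: "x \<in> X n"
    have "R n x = \<Psi> (R (n + 1) (\<Phi> x))" by (rule tr(4)) (use x in auto)
    then show "\<Phi> x = R n x" using \<Psi>R[OF \<Phi>in[OF x]] by simp
  qed
  ultimately show ?thesis unfolding link_def using Dn Tn by simp
qed

lemma level_all: "level n"
proof -
  have 0: "level 0" unfolding level_def using base_level base_seminorms base_topology by blast
  show ?thesis
  proof (cases "n \<ge> 0")
    case True
    then show ?thesis
      by (induction n rule: int_ge_induct) (use 0 level_up in auto)
  next
    case False
    then have "n \<le> 0" by simp
    then show ?thesis
    proof (induction n rule: int_le_induct)
      case (step i)
      then show ?case using level_down[of "i - 1"] by simp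
    qed (rule 0)
  qed
qed

lemma link_all: "link n"
  using level_up[of n] level_down[of n] level_all by (cases "n \<ge> 0") auto

section \<open>Consistency of spaces and maps across the levels\<close>

lemma inv_level: "invertible_level (\<tau> n) (T n) \<omega>"
  using level_all[of n] by (simp add: level_def)

lemma gen_dom_tower: "D n = X (n + 1)"
  using link_all[of n] by (simp add: link_def)

lemma gen_inv_tower_continuous: "continuous_map (\<tau> n) (\<tau> (n + 1)) (R n)"
  using link_all[of n] by (simp add: link_def)

lemma inclusion:
  assumes "m \<le> n"
  shows "continuous_map (\<tau> n) (\<tau> m) (\<lambda>x. x) \<and> (\<forall>t\<ge>0. \<forall>x\<in>X n. T n t x = T m t x)"
  using assms
proof (induction n rule: int_ge_induct)
  case (step i)
  have s: "continuous_map (\<tau> (i + 1)) (\<tau> i) (\<lambda>x. x)"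
    "\<forall>t\<ge>0. \<forall>x\<in>X (i + 1). T (i + 1) t x = T i t x"
    using link_all[of i] by (simp_all add: link_def)
  have "continuous_map (\<tau> (i + 1)) (\<tau> m) ((\<lambda>x. x) \<circ> (\<lambda>x. x))"
    using continuous_map_compose[OF s(1)] step.IH by blast
  then show ?case using s(2) step.IH continuous_map_in[OF s(1)] by (simp add: comp_def)
qed simp

lemma inclusion_continuous: "m \<le> n \<Longrightarrow> continuous_map (\<tau> n) (\<tau> m) (\<lambda>x. x)"
  using inclusion by blast

lemma X_antimono: "m \<le> n \<Longrightarrow> x \<in> X n \<Longrightarrow> x \<in> X m"
  using continuous_map_in[OF inclusion_continuous] .

lemma T_tower: "m \<le> n \<Longrightarrow> t \<ge> 0 \<Longrightarrow> x \<in> X n \<Longrightarrow> T n t x = T m t x"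
  using inclusion by blast

lemma T_consistent: "t \<ge> 0 \<Longrightarrow> x \<in> X n \<Longrightarrow> x \<in> X m \<Longrightarrow> T n t x = T m t x"
  using T_tower[of m n t x] T_tower[of n m t x] by (cases "m \<le> n") auto

text \<open>The inclusion of level \<open>n\<close> into level \<open>m\<close> is continuous and
  intertwines the semigroups, so a derivative taken in the finer topology is also one in the coarser
  topology.\<close>

lemma A_tower:
  assumes mn: "m \<le> n" and x: "x \<in> X (n + 1)"
  shows "A n x = A m x"
proof -
  note LD = invertible_levelD[OF inv_level]
  note V = lc_subspace[OF LD(1)]
  have xn: "x \<in> X n" using X_antimono[of n "n + 1"] x by simp
  have "gen_limit scl (\<tau> n) (T n) x (A n x)"
    using gen_limit_gen[OF LD(2)] x gen_dom_tower by simp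
  then have "gen_limit scl (\<tau> m) (T m) x (A n x)"
    by (rule gen_limit_image[OF inclusion_continuous[OF mn] _ V _ _ xn, rotated -1])
      (use semigroup_expD(3)[OF LD(4) _ xn] T_tower[OF mn _ xn] in \<open>auto simp: linear_on_space_def\<close>)
  then show ?thesis using gen_eqI[OF LD(2)] by simp
qed

lemma A_consistent: "x \<in> X (n + 1) \<Longrightarrow> x \<in> X (m + 1) \<Longrightarrow> A n x = A m x"
  using A_tower[of m n x] A_tower[of n m x] by (cases "m \<le> n") auto

lemma R_tower:
  assumes mn: "m \<le> n" and x: "x \<in> X n"
  shows "R n x = R m x"
proof -
  note LD = invertible_levelD[OF inv_level]
  define y where "y = R n x"
  have y: "y \<in> X (n + 1)" "A n y = x" using LD(6,7)[OF x] gen_dom_tower by (simp_all add: y_def)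
  then have "y \<in> D m" using X_antimono[of "m + 1" "n + 1"] mn gen_dom_tower by simp
  then show ?thesis using LD(8)[of y m] A_tower[OF mn y(1)] y(2) by (simp add: y_def)
qed

lemma R_consistent: "x \<in> X n \<Longrightarrow> x \<in> X m \<Longrightarrow> R n x = R m x"
  using R_tower[of m n x] R_tower[of n m x] by (cases "m \<le> n") auto

lemma induced_T:
  assumes "t \<ge> 0" "x \<in> X n"
  shows "induced_map X (\<lambda>n. T n t) x = T n t x"
  by (rule induced_map_eq[of x X n "\<lambda>n. T n t", OF assms(2)]) (rule T_consistent[OF assms(1) _ assms(2)])

lemma induced_A:
  assumes "x \<in> X (n + 1)"
  shows "induced_map (\<lambda>n. X (n + 1)) A x = A n x"
  by (rule induced_map_eq[of x "\<lambda>n. X (n + 1)" n A, OF assms]) (rule A_consistent[OF _ assms])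

lemma induced_R:
  assumes "x \<in> X n"
  shows "induced_map X R x = R n x"
  by (rule induced_map_eq[of x X n R, OF assms]) (rule R_consistent[OF _ assms])

lemma antimono_X: "antimono X"
  by (intro antimonoI subsetI) (rule X_antimono)

lemma induced_R_linear: "linear_on_space scl (\<Union>n. X n) (induced_map X R)"
proof (rule linear_on_nested_Union[OF antimono_X])
  fix n
  note V = lc_subspace[OF invertible_levelD(1)[OF inv_level[of n]]]
  show "linear_on_space scl (X n) (induced_map X R)"
    using gen_inv_linear[OF inv_level[of n]] subspace_add[OF V] subspace_scale[OF V]
    unfolding linear_on_space_def by (simp add: induced_R[of _ n])
qed

text \<open>On level \<open>n\<close> the map is \<open>R n\<close>, followed by the inclusion of
  level \<open>n + 1\<close>; continuity there is all that the inductive limit topology asks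
  for.\<close>

lemma induced_R_continuous:
  assumes lim: "is_lc_inductive_limit scl \<tau> \<sigma>"
  shows "continuous_map \<sigma> \<sigma> (induced_map X R)"
proof -
  have \<sigma>: "lc_space scl \<sigma>" and top: "topspace \<sigma> = (\<Union>n. X n)"
    and incl: "\<And>n. continuous_map (\<tau> n) \<sigma> (\<lambda>x. x)"
    using lim unfolding is_lc_inductive_limit_def by simp_all
  note lc = invertible_levelD(1)[OF inv_level] and lin = induced_R_linear[folded top]
  have Rn: "continuous_map (\<tau> n) \<sigma> (R n)" for n
    using continuous_map_compose[OF gen_inv_tower_continuous incl] by (simp add: comp_def)
  show ?thesis
  proof (rule continuous_map_linearI[OF lc_subspace[OF \<sigma>] \<sigma> lin])
    fix x assume "x \<in> topspace \<sigma>"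
    then obtain n where n: "x \<in> X n" using top by auto
    show "induced_map X R x \<in> topspace \<sigma>"
      using continuous_map_in[OF Rn n] induced_R[OF n] by simp
  next
    fix q assume q: "q \<in> csn \<sigma>"
    show "(\<lambda>x. q (induced_map X R x)) \<in> csn \<sigma>"
    proof (rule inductive_limit_csnI[OF lim antimono_X lc])
      fix n
      show "(\<lambda>x. q (induced_map X R x)) \<in> csn (\<tau> n)"
        by (rule csn_cong[OF lc_subspace[OF lc]
              csn_pullback[OF lc_subspace[OF lc] Rn gen_inv_linear[OF inv_level] q]])
          (simp add: induced_R[of _ n])
    qed
  qed
qed

section \<open>The universal extrapolation space\<close>

context
  fixes \<sigma> \<tau>inf :: "'a topology" and Tinf :: "real \<Rightarrow> 'a \<Rightarrow> 'a" and Ainf :: "'a \<Rightarrow> 'a"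
  assumes lim: "is_lc_inductive_limit scl \<tau> \<sigma>"
    and compl: "is_completion scl \<sigma> \<tau>inf"
    and Tinf_ext: "\<forall>t\<ge>0. cont_operator scl \<tau>inf (Tinf t) \<and>
      cont_extension \<tau>inf (topspace \<sigma>) (induced_map X (\<lambda>n. T n t)) (Tinf t)"
    and Ainf: "cont_operator scl \<tau>inf Ainf"
      "cont_extension \<tau>inf (topspace \<sigma>) (induced_map (\<lambda>n. X (n + 1)) A) Ainf"
begin

lemma limit_facts: "lc_space scl \<sigma>" "topspace \<sigma> = (\<Union>n. X n)" "continuous_map (\<tau> n) \<sigma> (\<lambda>x. x)"
  using lim unfolding is_lc_inductive_limit_def by simp_all

lemma completion_facts: "lc_space scl \<tau>inf" "Hausdorff_space \<tau>inf" "complete_lc \<tau>inf"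
  "topspace \<sigma> \<subseteq> topspace \<tau>inf" "subtopology \<tau>inf (topspace \<sigma>) = \<sigma>"
  "\<tau>inf closure_of topspace \<sigma> = topspace \<tau>inf"
  using compl unfolding is_completion_def by simp_all

lemma continuous_map_into_completion: "continuous_map \<rho> \<sigma> f \<Longrightarrow> continuous_map \<rho> \<tau>inf f"
  using continuous_map_into_fulltopology[of \<rho> \<tau>inf "topspace \<sigma>" f] completion_facts(5) by simp

lemma step_inclusion: "continuous_map (\<tau> n) \<tau>inf (\<lambda>x. x)"
  by (rule continuous_map_into_completion[OF limit_facts(3)])

lemma step_subset: "x \<in> X n \<Longrightarrow> x \<in> topspace \<sigma>"
  using continuous_map_in[OF limit_facts(3)] .

lemma Tinf_eq:
  assumes "t \<ge> 0" "x \<in> X n"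
  shows "Tinf t x = T n t x"
proof -
  have "Tinf t x = induced_map X (\<lambda>n. T n t) x"
    using Tinf_ext assms(1) step_subset[OF assms(2)] by (simp add: cont_extension_def)
  then show ?thesis using induced_T[OF assms] by simp
qed

lemma Ainf_eq:
  assumes "x \<in> X (n + 1)"
  shows "Ainf x = A n x"
proof -
  have "Ainf x = induced_map (\<lambda>n. X (n + 1)) A x"
    using Ainf(2) step_subset[OF assms] by (simp add: cont_extension_def)
  then show ?thesis using induced_A[OF assms] by simp
qed

lemma Tinf_semigroup: "semigroup_exp \<tau>inf Tinf \<omega>"
proof (rule semigroup_exp_from_dense[OF completion_facts(1,2,4,6)])
  show "t \<ge> 0 \<Longrightarrow> cont_operator scl \<tau>inf (Tinf t)" for t using Tinf_ext by blast
next
  note LD = invertible_levelD[OF inv_level]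
  note TD = semigroup_expD[OF LD(4)]
  fix y assume "y \<in> topspace \<sigma>"
  then obtain n where n: "y \<in> X n" using limit_facts(2) by auto
  show "Tinf (t + s) y = Tinf t (Tinf s y)" if ts: "t \<ge> 0" "s \<ge> 0" for t s
    using Tinf_eq[OF _ n, of "t + s"] Tinf_eq[OF ts(2) n] Tinf_eq[OF ts(1) TD(3)[OF ts(2) n]]
      TD(4)[OF ts n] ts by simp
  show "Tinf 0 y = y" using Tinf_eq[OF _ n, of 0] TD(5)[OF order_refl n] by simp
  have "continuous_map (top_of_set {0..}) (\<tau> n) (\<lambda>t. T n t y)"
    using LD(4) n by (simp add: semigroup_exp_def)
  from continuous_map_compose[OF this step_inclusion]
  show "continuous_map (top_of_set {0..}) \<tau>inf (\<lambda>t. Tinf t y)"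
    by (rule continuous_map_eq) (simp add: Tinf_eq[OF _ n])
next
  fix q assume q: "q \<in> csn \<tau>inf"
  note V = lc_subspace[OF limit_facts(1)]
  have "q \<in> csn \<sigma>"
    using csn_subtopology[OF lc_subspace[OF completion_facts(1)] completion_facts(4) V q]
    unfolding completion_facts(5) .
  from inductive_limit_exp_bound[OF lim antimono_X invertible_levelD(1,4)[OF inv_level] Tinf_eq this]
  obtain r where r: "r \<in> csn \<sigma>" "\<forall>t\<ge>0. \<forall>x\<in>topspace \<sigma>. exp (\<omega> * t) * q (Tinf t x) \<le> r x"
    by (rule bexE)
  \<comment> \<open>The bound obtained so far is a seminorm on the union only; it is replaced by a
    dominating one that lives on the completion.\<close>
  obtain s where "s \<in> csn \<tau>inf" "\<forall>y\<in>topspace \<sigma>. r y \<le> s y"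
    using csn_subtopology_dominated[OF completion_facts(1) V completion_facts(4)] r(1) completion_facts(5) by auto
  then show "\<exists>r\<in>csn \<tau>inf. \<forall>t\<ge>0. \<forall>y\<in>topspace \<sigma>. exp (\<omega> * t) * q (Tinf t y) \<le> r y"
    using r(2) by (intro bexI[of _ s]) (auto intro: order_trans)
qed

text \<open>Every vector of the union lies in the domain of some generator of the tower, so its
  orbit is differentiable in a finer topology; the closing argument by density then covers the
  completion.\<close>

lemma gen_limit_Ainf:
  assumes "x \<in> topspace \<tau>inf"
  shows "gen_limit scl \<tau>inf Tinf x (Ainf x)"
proof (rule gen_limit_from_dense[OF completion_facts(1) Tinf_semigroup completion_facts(6) Ainf(1) _ assms])
  fix y assume "y \<in> topspace \<sigma>"
  then obtain n where "y \<in> X n" using limit_facts(2) by auto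
  \<comment> \<open>A vector of level \<open>n\<close> is regarded as an element of the domain one
    level below; the tower always has such a level.\<close>
  then have n: "y \<in> X (n - 1 + 1)" by simp
  note LD = invertible_levelD[OF inv_level[of "n - 1"]]
  have y: "y \<in> D (n - 1)" using n gen_dom_tower by blast
  then have yX: "y \<in> X (n - 1)" using gen_dom_subset by blast
  have "gen_limit scl \<tau>inf Tinf y (A (n - 1) y)"
    by (rule gen_limit_image[OF step_inclusion _ lc_subspace[OF LD(1)] _ _ yX gen_limit_gen[OF LD(2) y]])
      (use semigroup_expD(3)[OF LD(4) _ yX] Tinf_eq[OF _ yX] in \<open>auto simp: linear_on_space_def\<close>)
  then show "gen_limit scl \<tau>inf Tinf y (Ainf y)" using Ainf_eq[OF n] by simp
qed

lemma gen_dom_Tinf: "gen_dom scl \<tau>inf Tinf = topspace \<tau>inf"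
  by (intro equalityI gen_dom_subset subsetI gen_domI) (assumption, rule gen_limit_Ainf)

lemma gen_Tinf: "x \<in> topspace \<tau>inf \<Longrightarrow> gen scl \<tau>inf Tinf x = Ainf x"
  using gen_eqI[OF completion_facts(2) gen_limit_Ainf] .

text \<open>\<open>G\<close> is the extension of the inverse on the union. Both compositions are the
  identity there, level by level with the shift by one, and hence on the completion by
  density.\<close>

lemma Ainf_inverse:
  obtains G where "continuous_map \<tau>inf \<tau>inf G" "\<And>x. x \<in> topspace \<sigma> \<Longrightarrow> G x = induced_map X R x"
    "\<And>x. x \<in> topspace \<tau>inf \<Longrightarrow> G (Ainf x) = x" "\<And>x. x \<in> topspace \<tau>inf \<Longrightarrow> Ainf (G x) = x"
proof -
  have "continuous_map (subtopology \<tau>inf (topspace \<sigma>)) \<tau>inf (induced_map X R)"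
    using continuous_map_into_completion[OF induced_R_continuous[OF lim]] completion_facts(5) by simp
  from continuous_linear_extension[OF completion_facts(1,1,3,2) lc_subspace[OF limit_facts(1)] completion_facts(4,6)
      induced_R_linear[folded limit_facts(2)] this]
  obtain G where G: "continuous_map \<tau>inf \<tau>inf G" and GR: "\<forall>y\<in>topspace \<sigma>. G y = induced_map X R y"
    by (elim exE conjE)
  have GRn: "G x = R n x" if "x \<in> X n" for x n
    using GR induced_R[OF that] step_subset[OF that] by simp
  note Acont = cont_operatorD(2)[OF Ainf(1)] and LD = invertible_levelD[OF inv_level]
  have 1: "G (Ainf x) = x" if "x \<in> topspace \<tau>inf" for x
  proof -
    have "(G \<circ> Ainf) x = (\<lambda>x. x) x"
    proof (rule dense_eq[OF completion_facts(6,2) continuous_map_compose[OF Acont G] _ _ that])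
      fix y assume "y \<in> topspace \<sigma>"
      then obtain n where "y \<in> X n" using limit_facts(2) by auto
      then have n: "y \<in> X (n - 1 + 1)" by simp
      then have "y \<in> D (n - 1)" using gen_dom_tower by blast
      then show "(G \<circ> Ainf) y = y" using LD(8,9) GRn[of _ "n - 1"] Ainf_eq[OF n] by simp
    qed simp
    then show ?thesis by simp
  qed
  have 2: "Ainf (G x) = x" if "x \<in> topspace \<tau>inf" for x
  proof -
    have "(Ainf \<circ> G) x = (\<lambda>x. x) x"
    proof (rule dense_eq[OF completion_facts(6,2) continuous_map_compose[OF G Acont] _ _ that])
      fix y assume "y \<in> topspace \<sigma>"
      then obtain n where n: "y \<in> X n" using limit_facts(2) by auto
      then have "R n y \<in> X (n + 1)" using LD(6) gen_dom_tower by blast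
      then show "(Ainf \<circ> G) y = y" using GRn[OF n] Ainf_eq LD(7)[OF n] by simp
    qed simp
    then show ?thesis by simp
  qed
  show thesis using that[OF G] GR 1 2 by blast
qed

lemma Ainf_homeomorphic:
  "homeomorphic_map \<tau>inf \<tau>inf Ainf"
  "cont_extension \<tau>inf (topspace \<sigma>) (induced_map X R) (the_inv_into (topspace \<tau>inf) Ainf)"
proof -
  obtain G where G: "continuous_map \<tau>inf \<tau>inf G" "\<And>x. x \<in> topspace \<sigma> \<Longrightarrow> G x = induced_map X R x"
    and GA: "\<And>x. x \<in> topspace \<tau>inf \<Longrightarrow> G (Ainf x) = x"
    and AG: "\<And>x. x \<in> topspace \<tau>inf \<Longrightarrow> Ainf (G x) = x"
    using Ainf_inverse by blast
  have "homeomorphic_maps \<tau>inf \<tau>inf Ainf G"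
    unfolding homeomorphic_maps_def using cont_operatorD(2)[OF Ainf(1)] G(1) GA AG by blast
  then show "homeomorphic_map \<tau>inf \<tau>inf Ainf" using homeomorphic_maps_map by blast
  have inj: "inj_on Ainf (topspace \<tau>inf)" by (rule inj_on_inverseI) (rule GA)
  have inv: "G x = the_inv_into (topspace \<tau>inf) Ainf x" if "x \<in> topspace \<tau>inf" for x
    by (rule the_inv_into_f_eq[OF inj AG[OF that] continuous_map_in[OF G(1) that], symmetric])
  have "continuous_map \<tau>inf \<tau>inf (the_inv_into (topspace \<tau>inf) Ainf)"
    by (rule continuous_map_eq[OF G(1) inv])
  then show "cont_extension \<tau>inf (topspace \<sigma>) (induced_map X R) (the_inv_into (topspace \<tau>inf) Ainf)"
    unfolding cont_extension_def using G(2) inv completion_facts(4) by (metis subsetD)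
qed

lemma cont_extension_unique:
  assumes "cont_extension \<tau>inf (topspace \<sigma>) f g" "cont_extension \<tau>inf (topspace \<sigma>) f h"
    and "x \<in> topspace \<tau>inf"
  shows "g x = h x"
  by (rule dense_eq[OF completion_facts(6,2) _ _ _ assms(3)])
    (use assms(1,2) in \<open>auto simp: cont_extension_def\<close>)

end

end

theorem theorem4p3:
  fixes scl :: "'k::real_normed_field \<Rightarrow> 'a::ab_group_add \<Rightarrow> 'a"
    and \<Gamma> :: "'g set"
    and \<tau> :: "int \<Rightarrow> 'a topology"
    and p :: "int \<Rightarrow> 'g \<Rightarrow> 'a \<Rightarrow> real"
    and T :: "int \<Rightarrow> real \<Rightarrow> 'a \<Rightarrow> 'a"
    and \<tau>X \<tau>inf :: "'a topology"
    and Tinf :: "real \<Rightarrow> 'a \<Rightarrow> 'a"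
    and Ainf :: "'a \<Rightarrow> 'a"
  assumes "vector_space scl"
    and "module.subspace scl (topspace (\<tau> 0))"
    and "\<forall>\<gamma>\<in>\<Gamma>. seminorm_on scl (topspace (\<tau> 0)) (p 0 \<gamma>)"
    and "\<tau> 0 = seminorm_topology (topspace (\<tau> 0)) (p 0 ` \<Gamma>)"
    and "Hausdorff_space (\<tau> 0)" and "complete_lc (\<tau> 0)"
    and "sc_exp_equicont_semigroup scl (\<tau> 0) (T 0)"
    and "bij_betw (gen scl (\<tau> 0) (T 0)) (gen_dom scl (\<tau> 0) (T 0)) (topspace (\<tau> 0))"
    and "continuous_map (\<tau> 0) (\<tau> 0) (gen_inv scl (\<tau> 0) (T 0))"
    and "sobolev_tower scl \<Gamma> \<tau> p T"
    and "is_lc_inductive_limit scl \<tau> \<tau>X" and "Hausdorff_space \<tau>X"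
    and "is_completion scl \<tau>X \<tau>inf"
    and "\<forall>t\<ge>0. cont_operator scl \<tau>inf (Tinf t) \<and>
           cont_extension \<tau>inf (topspace \<tau>X) (induced_map (\<lambda>n. topspace (\<tau> n)) (\<lambda>n. T n t)) (Tinf t)"
    and "cont_operator scl \<tau>inf Ainf"
    and "cont_extension \<tau>inf (topspace \<tau>X)
           (induced_map (\<lambda>n. topspace (\<tau> (n + 1))) (\<lambda>n. gen scl (\<tau> n) (T n))) Ainf"
  shows
    "(sc_exp_equicont_semigroup scl \<tau>inf Tinf \<and>
      topspace \<tau>X \<subseteq> gen_dom scl \<tau>inf Tinf \<and>
      gen_dom scl \<tau>inf Tinf \<subseteq> topspace \<tau>inf \<and>
      (\<forall>x\<in>gen_dom scl \<tau>inf Tinf. Ainf x = gen scl \<tau>inf Tinf x) \<and>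
      continuous_map (subtopology \<tau>inf (gen_dom scl \<tau>inf Tinf)) \<tau>inf (gen scl \<tau>inf Tinf)) \<and>
     (barrelled scl \<tau>inf \<longrightarrow>
      gen_dom scl \<tau>inf Tinf = topspace \<tau>inf \<and>
      (\<forall>x\<in>topspace \<tau>inf. gen scl \<tau>inf Tinf x = Ainf x)) \<and>
     (linear_on_space scl (topspace \<tau>inf) Ainf \<and>
      homeomorphic_map \<tau>inf \<tau>inf Ainf \<and>
      (let Binf = the_inv_into (topspace \<tau>inf) Ainf;
           B = induced_map (\<lambda>n. topspace (\<tau> n)) (\<lambda>n. gen_inv scl (\<tau> n) (T n))
       in cont_extension \<tau>inf (topspace \<tau>X) B Binf \<and>
          (\<forall>g. cont_extension \<tau>inf (topspace \<tau>X) B g \<longrightarrow> (\<forall>x\<in>topspace \<tau>inf. g x = Binf x))))"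
proof -
  interpret scalar_space scl using assms(1) by (rule scalar_space.intro)
  have lc0: "lc_space scl (\<tau> 0)"
    by (subst assms(4), rule lc_seminorm_topology[OF assms(2)]) (use assms(3) in auto)
  obtain \<omega> where \<omega>: "semigroup_exp (\<tau> 0) (T 0) \<omega>"
    using assms(7) sc_exp_equicont_semigroup_iff[OF lc0] by blast
  interpret sobolev_setup scl \<Gamma> \<tau> p T \<omega>
  proof
    show "invertible_level (\<tau> 0) (T 0) \<omega>"
      unfolding invertible_level_def using lc0 assms(5,6) \<omega> assms(8,9) by blast
  qed (use assms in simp_all)
  note hyps = assms(11,13-16)
  have lc: "lc_space scl \<tau>inf" and sub: "topspace \<tau>X \<subseteq> topspace \<tau>inf"
    using assms(13) by (simp_all add: is_completion_def)
  note dom = gen_dom_Tinf[OF hyps] and gen = gen_Tinf[OF hyps] and A = cont_operatorD[OF assms(15)]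
  have "sc_exp_equicont_semigroup scl \<tau>inf Tinf"
    unfolding sc_exp_equicont_semigroup_iff[OF lc] by (rule exI, rule Tinf_semigroup[OF hyps])
  \<comment> \<open>Stated with the full subtopology so that it matches the goal once
    \<open>dom\<close> has replaced the domain of the generator.\<close>
  moreover have "continuous_map (subtopology \<tau>inf (topspace \<tau>inf)) \<tau>inf (gen scl \<tau>inf Tinf)"
    using continuous_map_eq[OF A(2) gen[symmetric]] by simp
  moreover have "\<forall>x\<in>topspace \<tau>inf. Ainf x = gen scl \<tau>inf Tinf x" by (simp add: gen)
  moreover note ext = Ainf_homeomorphic(2)[OF hyps]
  have "\<forall>g. cont_extension \<tau>inf (topspace \<tau>X) (induced_map X R) g \<longrightarrow>
      (\<forall>x\<in>topspace \<tau>inf. g x = the_inv_into (topspace \<tau>inf) Ainf x)"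
    by (intro allI impI ballI) (rule cont_extension_unique[OF hyps _ ext])
  ultimately show ?thesis
    unfolding dom Let_def using sub A(1) Ainf_homeomorphic[OF hyps] by simp
qed

end
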